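(* Let $\Bbbk$ be a unital commutative ring and $\mathsf{L}$ the (linearized) species of linear orders with its cosymmetric $\mathsf{E}$-bicomodule structure. For $j\ge0$ let $f_j\in K^j(\mathsf{L})=\operatorname{Hom}_{S_j}(\mathsf{L}[j],\operatorname{sgn}_j)$ be the generator $f_j(\sigma)=(-1)^\sigma$. The algebra $K^*(\mathsf{L})$ is generated by the elements $f_1$ and $f_2$, so that for all $p,q\ge0$ $$f_{2p}\smile f_{2q}=\binom{p+q}{p}f_{2(p+q)},\qquad f_1\smile f_{2p}=f_{2p+1},\qquad f_1\smile f_{2p+1}=0.$$ These relations exhibit $H^*(\mathsf{L})$ as a tensor product of a divided power algebra and an exterior algebra.
   Context: A (linear) species is a functor from finite sets and bijections to $\Bbbk$-modules; $\mathsf{X}[n]$ is its value on $[n]=\{1,\ldots,n\}$. A decomposition of $I$ is a tuple of disjoint, possibly empty, subsets with union $I$. The Cauchy product is $(\mathsf{X}\cdot\mathsf{Y})[I]=\bigoplus_{(S,T)}\mathsf{X}[S]\otimes\mathsf{Y}[T]$ over decompositions. $\mathsf{E}[I]=\Bbbk e_I$ is the exponential species, with coproduct $e_I\mapsto e_S\otimes e_T$. A cosymmetric $\mathsf{E}$-bicomodule is a species $\mathsf{X}$ with functorial natural restriction maps $z\mapsto z|_S$, $\mathsf{X}[I]\to\mathsf{X}[S]$ for $S\subseteq I$, with coactions $\lambda(z)=\sum e_S\otimes z|_T$, $\rho(z)=\sum z|_S\otimes e_T$. $\mathsf{L}[I]$ is free on the linear orders of $I$, with restriction the usual restriction of orders;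 a permutation $\sigma\in S_j$ is identified with the linear order $\sigma(1)<\cdots<\sigma(j)$ of $[j]$, so $\mathsf{L}[j]$ is the regular representation. $H^*(\mathsf{X})$ is the cohomology of $C^n(\mathsf{X})=\operatorname{Hom}(\mathsf{X},\mathsf{E}^{\cdot n})$; cochains are given by coefficients $\alpha(F_1,\ldots,F_n)(z)$, and $\delta=\sum_{i=0}^{n+1}(-1)^id^i$ with $(d^0\alpha)(F_0,\ldots,F_n)(z)=\alpha(F_1,\ldots,F_n)(z|_{F_0^c})$, $(d^i\alpha)(F_0,\ldots,F_n)(z)=\alpha(F_0,\ldots,F_{i-1}\cup F_i,\ldots,F_n)(z)$ for $0<i<n+1$, $(d^{n+1}\alpha)(F_0,\ldots,F_n)(z)=\alpha(F_0,\ldots,F_{n-1})(z|_{F_n^c})$; its product is induced by $(\alpha\smile\beta)(F_1,\ldots,F_{p+q})(z)=\alpha(F_1,\ldots,F_p)(z|_{F_1\cup\cdots\cup F_p})\beta(F_{p+1},\ldots,F_{p+q})(z|_{F_{p+1}\cup\cdots\cup F_{p+q}})$ on basis elements $z$. The Koszul complex $K^p(\mathsf{X})=\operatorname{Hom}_{S_p}(\mathsf{X}[p],\operatorname{sgn}_p)$ (sign representation), with zero differential in the cosymmetric case, has product $(f\smile g)(z)=\sum_{(S,T)}(-1)^{\operatorname{sch}(S,T)}f(\lambda_S(z|_S))g(\lambda_T(z|_T))$ for basis elements $z\in\mathsf{X}[p+q]$, over decompositions of $[p+q]$ with $\#S=p$, $\#T=q$; $\lambda_S:S\to[p]$, $\lambda_T:T\to[q]$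 are the order-preserving bijections and $\operatorname{sch}(S,T)=\#\{(s,t)\in S\times T:s>t\}$.
   Formalization: "Generated by f_1 and f_2" fails over Z (f_2^2 = 2f_4, so f_4 is not generated). Proved instead: generated by f_1 and all f_{2p} for every nonzero ring, and by f_1, f_2 when every positive integer is invertible. *)

theory Defs
  imports
    "HOL-Algebra.QuotRing"
    "HOL-Algebra.Subrings"
    "HOL-Algebra.Module"
    "HOL-Combinatorics.Permutations"
    "HOL-Combinatorics.Multiset_Permutations"
    "HOL-Library.Poly_Mapping"
    "HOL-Library.Function_Algebras"
begin

section \<open>Free modules and their linear functionals\<close>

text \<open>
  The free \<open>'k\<close>-module on a set \<open>B\<close> consists of the \<open>v :: 'b \<Rightarrow>\<^sub>0 'k\<close> with
  \<open>keys v \<subseteq> B\<close>; the basis element \<open>z \<in> B\<close> is \<open>Poly_Mapping.single z 1\<close>.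
\<close>

abbreviation keys :: "('b \<Rightarrow>\<^sub>0 'k::zero) \<Rightarrow> 'b set"
  where "keys \<equiv> Poly_Mapping.keys"

abbreviation lookup :: "('b \<Rightarrow>\<^sub>0 'k::zero) \<Rightarrow> 'b \<Rightarrow> 'k"
  where "lookup \<equiv> Poly_Mapping.lookup"

definition scale_fm :: "'k::comm_ring_1 \<Rightarrow> ('b \<Rightarrow>\<^sub>0 'k) \<Rightarrow> ('b \<Rightarrow>\<^sub>0 'k)"
  where "scale_fm c v = Poly_Mapping.map ((*) c) v"

lemma lookup_scale_fm: "lookup (scale_fm c v) z = c * lookup v z"
  by (simp add: scale_fm_def map.rep_eq when_def)

interpretation fm: Modules.module "scale_fm :: 'k::comm_ring_1 \<Rightarrow> ('b \<Rightarrow>\<^sub>0 'k) \<Rightarrow> ('b \<Rightarrow>\<^sub>0 'k)"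
  by unfold_locales
    (auto intro!: poly_mapping_eqI simp: lookup_scale_fm lookup_add algebra_simps)

definition push_fm :: "('b \<Rightarrow> 'c) \<Rightarrow> ('b \<Rightarrow>\<^sub>0 'k::comm_ring_1) \<Rightarrow> ('c \<Rightarrow>\<^sub>0 'k)"
  where "push_fm \<phi> v = (\<Sum>z\<in>keys v. Poly_Mapping.single (\<phi> z) (lookup v z))"

text \<open>
  Functionals are made total by the value \<open>0\<close> outside of the free module on \<open>B\<close>, so that
  equality of functionals is equality of functions.
\<close>

definition functionals :: "'b set \<Rightarrow> (('b \<Rightarrow>\<^sub>0 'k::comm_ring_1) \<Rightarrow> 'k) set"
  where "functionals B = {f.
    (\<forall>v w. keys v \<subseteq> B \<longrightarrow> keys w \<subseteq> B \<longrightarrow> f (v + w) = f v + f w) \<and>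
    (\<forall>c v. keys v \<subseteq> B \<longrightarrow> f (scale_fm c v) = c * f v) \<and>
    (\<forall>v. \<not> keys v \<subseteq> B \<longrightarrow> f v = 0)}"

definition lin_ext :: "'b set \<Rightarrow> ('b \<Rightarrow> 'k::comm_ring_1) \<Rightarrow> (('b \<Rightarrow>\<^sub>0 'k) \<Rightarrow> 'k)"
  where "lin_ext B \<phi> v =
    (if keys v \<subseteq> B then \<Sum>z\<in>keys v. lookup v z * \<phi> z else 0)"


section \<open>Graded algebras\<close>

text \<open>
  The scalars are the elements of the type \<open>'k\<close>; \<open>hpart A n\<close> is the homogeneous component
  of degree \<open>n\<close>.
\<close>

record ('k, 'a) graded_alg = "('k, 'a) module" +
  hpart :: "nat \<Rightarrow> 'a set"

locale graded_algebra = ring A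
  for A :: "('k::comm_ring_1, 'a) graded_alg" (structure) +
  assumes smult_closed: "x \<in> carrier A \<Longrightarrow> c \<odot>\<^bsub>A\<^esub> x \<in> carrier A"
    and smult_add_left: "x \<in> carrier A \<Longrightarrow> (c + d) \<odot>\<^bsub>A\<^esub> x = c \<odot>\<^bsub>A\<^esub> x \<oplus>\<^bsub>A\<^esub> d \<odot>\<^bsub>A\<^esub> x"
    and smult_add_right: "x \<in> carrier A \<Longrightarrow> y \<in> carrier A \<Longrightarrow>
      c \<odot>\<^bsub>A\<^esub> (x \<oplus>\<^bsub>A\<^esub> y) = c \<odot>\<^bsub>A\<^esub> x \<oplus>\<^bsub>A\<^esub> c \<odot>\<^bsub>A\<^esub> y"
    and smult_smult: "x \<in> carrier A \<Longrightarrow> (c * d) \<odot>\<^bsub>A\<^esub> x = c \<odot>\<^bsub>A\<^esub> (d \<odot>\<^bsub>A\<^esub> x)"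
    and smult_unit: "x \<in> carrier A \<Longrightarrow> 1 \<odot>\<^bsub>A\<^esub> x = x"
    and smult_mult_left: "x \<in> carrier A \<Longrightarrow> y \<in> carrier A \<Longrightarrow>
      (c \<odot>\<^bsub>A\<^esub> x) \<otimes>\<^bsub>A\<^esub> y = c \<odot>\<^bsub>A\<^esub> (x \<otimes>\<^bsub>A\<^esub> y)"
    and smult_mult_right: "x \<in> carrier A \<Longrightarrow> y \<in> carrier A \<Longrightarrow>
      x \<otimes>\<^bsub>A\<^esub> (c \<odot>\<^bsub>A\<^esub> y) = c \<odot>\<^bsub>A\<^esub> (x \<otimes>\<^bsub>A\<^esub> y)"
    and hpart_subgroup: "subgroup (hpart A n) (add_monoid A)"
    and hpart_smult: "x \<in> hpart A n \<Longrightarrow> c \<odot>\<^bsub>A\<^esub> x \<in> hpart A n"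
    and hpart_one: "\<one>\<^bsub>A\<^esub> \<in> hpart A 0"
    and hpart_mult: "x \<in> hpart A m \<Longrightarrow> y \<in> hpart A n \<Longrightarrow> x \<otimes>\<^bsub>A\<^esub> y \<in> hpart A (m + n)"
    and hpart_direct_sum: "x \<in> carrier A \<Longrightarrow>
      \<exists>!h. (\<forall>n. h n \<in> hpart A n) \<and> finite {n. h n \<noteq> \<zero>\<^bsub>A\<^esub>} \<and>
        x = (\<Oplus>\<^bsub>A\<^esub>n\<in>{n. h n \<noteq> \<zero>\<^bsub>A\<^esub>}. h n)"

definition graded_hom ::
    "('k::comm_ring_1, 'a) graded_alg \<Rightarrow> ('k, 'b) graded_alg \<Rightarrow> ('a \<Rightarrow> 'b) set"
  where "graded_hom A B = {h \<in> ring_hom A B.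
    (\<forall>c. \<forall>x\<in>carrier A. h (c \<odot>\<^bsub>A\<^esub> x) = c \<odot>\<^bsub>B\<^esub> h x) \<and>
    (\<forall>n. h ` hpart A n \<subseteq> hpart B n)}"

definition graded_iso ::
    "('k::comm_ring_1, 'a) graded_alg \<Rightarrow> ('k, 'b) graded_alg \<Rightarrow> ('a \<Rightarrow> 'b) set"
  where "graded_iso A B = {h \<in> graded_hom A B.
    bij_betw h (carrier A) (carrier B) \<and> (\<forall>n. h ` hpart A n = hpart B n)}"

definition subalgebra :: "'a set \<Rightarrow> ('k::comm_ring_1, 'a) graded_alg \<Rightarrow> bool"
  where "subalgebra S A \<longleftrightarrow> subring S A \<and> (\<forall>c. \<forall>x\<in>S. c \<odot>\<^bsub>A\<^esub> x \<in> S)"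

definition generated_subalgebra :: "('k::comm_ring_1, 'a) graded_alg \<Rightarrow> 'a set \<Rightarrow> 'a set"
  where "generated_subalgebra A G = \<Inter>{S. subalgebra S A \<and> G \<subseteq> S}"

text \<open>
  \<open>direct_sum_algebra sc P u m\<close> is the graded algebra \<open>\<Oplus>\<^sub>n P n\<close>, for graded pieces \<open>P n\<close>
  in a type carrying pointwise \<open>+\<close> and \<open>0\<close>, with scalar action \<open>sc\<close>, unit \<open>u \<in> P 0\<close> and
  products \<open>m p q : P p \<times> P q \<rightarrow> P (p + q)\<close>.
\<close>

definition direct_sum_algebra ::
    "('k \<Rightarrow> 'c \<Rightarrow> 'c) \<Rightarrow> (nat \<Rightarrow> 'c set) \<Rightarrow> 'c \<Rightarrow> (nat \<Rightarrow> nat \<Rightarrow> 'c \<Rightarrow> 'c \<Rightarrow> 'c) \<Rightarrow>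
     ('k::comm_ring_1, nat \<Rightarrow> 'c::ab_group_add) graded_alg"
  where "direct_sum_algebra sc P u m =
    \<lparr> carrier = {x. (\<forall>n. x n \<in> P n) \<and> finite {n. x n \<noteq> 0}},
      monoid.mult = (\<lambda>x y n. \<Sum>p\<le>n. m p (n - p) (x p) (y (n - p))),
      one = (\<lambda>n. if n = 0 then u else 0),
      zero = (\<lambda>n. 0),
      add = (\<lambda>x y n. x n + y n),
      smult = (\<lambda>c x n. sc c (x n)),
      hpart = (\<lambda>n. {x. x n \<in> P n \<and> (\<forall>k. k \<noteq> n \<longrightarrow> x k = 0)}) \<rparr>"

text \<open>
  The submodule of the free module on \<open>carrier A \<times> carrier B\<close> whose quotient is
  the tensor product of modules \<open>A \<otimes> B\<close>.
\<close>

definition tensor_relations ::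
    "('k::comm_ring_1, 'a) graded_alg \<Rightarrow> ('k, 'b) graded_alg \<Rightarrow> (('a \<times> 'b) \<Rightarrow>\<^sub>0 'k) set"
  where "tensor_relations A B = (let e = (\<lambda>a b. Poly_Mapping.single (a, b) 1) in fm.span (
      {e (a \<oplus>\<^bsub>A\<^esub> a') b - e a b - e a' b | a a' b.
        a \<in> carrier A \<and> a' \<in> carrier A \<and> b \<in> carrier B} \<union>
      {e a (b \<oplus>\<^bsub>B\<^esub> b') - e a b - e a b' | a b b'.
        a \<in> carrier A \<and> b \<in> carrier B \<and> b' \<in> carrier B} \<union>
      {e (c \<odot>\<^bsub>A\<^esub> a) b - scale_fm c (e a b) | c a b. a \<in> carrier A \<and> b \<in> carrier B} \<union>
      {e a (c \<odot>\<^bsub>B\<^esub> b) - scale_fm c (e a b) | c a b. a \<in> carrier A \<and> b \<in> carrier B}))"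

text \<open>
  \<open>T\<close> is the tensor product of the graded algebras \<open>A\<close> and \<open>B\<close> by way of \<open>i : A \<rightarrow> T\<close> and
  \<open>j : B \<rightarrow> T\<close>: the map \<open>a \<otimes> b \<mapsto> i a \<cdot> j b\<close> is a bijection from the tensor product of modules
  \<open>A \<otimes> B\<close> (the free module modulo the relations above) to \<open>T\<close>. Since \<open>i\<close> and \<open>j\<close> are
  algebra maps and \<open>T\<close> is associative, the sign rule for \<open>j b \<cdot> i a\<close> says that this map takes
  \<open>(a \<otimes> b) (a' \<otimes> b') = (-1)^(deg b deg a') aa' \<otimes> bb'\<close> to the product of \<open>T\<close>.
\<close>

definition graded_tensor_product ::
    "('k::comm_ring_1, 'a) graded_alg \<Rightarrow> ('k, 'b) graded_alg \<Rightarrow> ('k, 't) graded_alg \<Rightarrow>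
     ('a \<Rightarrow> 't) \<Rightarrow> ('b \<Rightarrow> 't) \<Rightarrow> bool"
  where "graded_tensor_product A B T i j \<longleftrightarrow>
    graded_algebra T \<and> i \<in> graded_hom A T \<and> j \<in> graded_hom B T \<and>
    (\<forall>m n. \<forall>a\<in>hpart A m. \<forall>b\<in>hpart B n.
      j b \<otimes>\<^bsub>T\<^esub> i a = ((-1) ^ (m * n)) \<odot>\<^bsub>T\<^esub> (i a \<otimes>\<^bsub>T\<^esub> j b)) \<and>
    (let F = {v. keys v \<subseteq> carrier A \<times> carrier B};
         \<mu> = (\<lambda>v. \<Oplus>\<^bsub>T\<^esub>x\<in>keys v. lookup v x \<odot>\<^bsub>T\<^esub> (i (fst x) \<otimes>\<^bsub>T\<^esub> j (snd x)))
     in \<mu> ` F = carrier T \<and> {v \<in> F. \<mu> v = \<zero>\<^bsub>T\<^esub>} = tensor_relations A B)"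

text \<open>
  The divided power algebra on one generator \<open>x\<close> of degree \<open>d\<close>: free on the divided powers
  \<open>x\<^sup>[\<^sup>p\<^sup>] = Poly_Mapping.single p 1\<close>, of degree \<open>d * p\<close>.
\<close>

definition divided_power_algebra :: "nat \<Rightarrow> ('k::comm_ring_1, nat \<Rightarrow>\<^sub>0 'k) graded_alg"
  where "divided_power_algebra d =
    \<lparr> carrier = UNIV,
      monoid.mult = (\<lambda>u v. \<Sum>p\<in>keys u. \<Sum>q\<in>keys v.
        Poly_Mapping.single (p + q) (of_nat ((p + q) choose p) * (lookup u p * lookup v q))),
      one = Poly_Mapping.single 0 1,
      zero = 0,
      add = (+),
      smult = scale_fm,
      hpart = (\<lambda>n. {u. \<forall>p\<in>keys u. d * p = n}) \<rparr>"

text \<open>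
  The exterior algebra on one generator \<open>y\<close> of degree \<open>d > 0\<close>: the pair \<open>(a, b)\<close> stands for
  \<open>a + b y\<close>, and \<open>y\<^sup>2 = 0\<close>.
\<close>

definition exterior_algebra :: "nat \<Rightarrow> ('k::comm_ring_1, 'k \<times> 'k) graded_alg"
  where "exterior_algebra d =
    \<lparr> carrier = UNIV,
      monoid.mult = (\<lambda>(a, b) (a', b'). (a * a', a * b' + b * a')),
      one = (1, 0),
      zero = (0, 0),
      add = (\<lambda>(a, b) (a', b'). (a + a', b + b')),
      smult = (\<lambda>c (a, b). (c * a, c * b)),
      hpart = (\<lambda>n. {(a, b). (n \<noteq> 0 \<longrightarrow> a = 0) \<and> (n \<noteq> d \<longrightarrow> b = 0)}) \<rparr>"


section \<open>Linearized cosymmetric bicomodules over the exponential species\<close>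

text \<open>
  Finite sets are the finite subsets of \<open>nat\<close>, a full subcategory equivalent to that of all
  finite sets and bijections. The value of the species at \<open>I\<close> is the free module on
  \<open>sp_basis X I\<close>; the bijection \<open>I \<rightarrow> \<sigma> ` I\<close> given by \<open>\<sigma>\<close>, injective on \<open>I\<close>, acts on
  basis elements by \<open>sp_map X \<sigma>\<close>, and \<open>sp_restr X S z\<close> is \<open>z|\<^sub>S\<close>.
\<close>

record 'b species =
  sp_basis :: "nat set \<Rightarrow> 'b set"
  sp_map :: "(nat \<Rightarrow> nat) \<Rightarrow> 'b \<Rightarrow> 'b"
  sp_restr :: "nat set \<Rightarrow> 'b \<Rightarrow> 'b"

locale cosymmetric_bicomodule =
  fixes X :: "'b species"
  assumes map_in: "finite I \<Longrightarrow> inj_on \<sigma> I \<Longrightarrow> z \<in> sp_basis X I \<Longrightarrow>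
      sp_map X \<sigma> z \<in> sp_basis X (\<sigma> ` I)"
    and map_cong: "finite I \<Longrightarrow> inj_on \<sigma> I \<Longrightarrow> (\<And>s. s \<in> I \<Longrightarrow> \<sigma> s = \<tau> s) \<Longrightarrow>
      z \<in> sp_basis X I \<Longrightarrow> sp_map X \<sigma> z = sp_map X \<tau> z"
    and map_ident: "finite I \<Longrightarrow> z \<in> sp_basis X I \<Longrightarrow> sp_map X (\<lambda>s. s) z = z"
    and map_comp: "finite I \<Longrightarrow> inj_on \<sigma> I \<Longrightarrow> inj_on \<tau> (\<sigma> ` I) \<Longrightarrow> z \<in> sp_basis X I \<Longrightarrow>
      sp_map X (\<tau> \<circ> \<sigma>) z = sp_map X \<tau> (sp_map X \<sigma> z)"
    and restr_in: "finite I \<Longrightarrow> S \<subseteq> I \<Longrightarrow> z \<in> sp_basis X I \<Longrightarrow> sp_restr X S z \<in> sp_basis X S"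
    and restr_full: "finite I \<Longrightarrow> z \<in> sp_basis X I \<Longrightarrow> sp_restr X I z = z"
    and restr_restr: "finite I \<Longrightarrow> S \<subseteq> I \<Longrightarrow> T \<subseteq> S \<Longrightarrow> z \<in> sp_basis X I \<Longrightarrow>
      sp_restr X T (sp_restr X S z) = sp_restr X T z"
    and restr_map: "finite I \<Longrightarrow> inj_on \<sigma> I \<Longrightarrow> S \<subseteq> I \<Longrightarrow> z \<in> sp_basis X I \<Longrightarrow>
      sp_restr X (\<sigma> ` S) (sp_map X \<sigma> z) = sp_map X \<sigma> (sp_restr X S z)"

text \<open>A linear order of \<open>I\<close> is the list of the elements of \<open>I\<close> in increasing order.\<close>

definition linear_orders :: "nat list species"
  where "linear_orders =
    \<lparr> sp_basis = permutations_of_set, sp_map = map, sp_restr = (\<lambda>S. filter (\<lambda>s. s \<in> S)) \<rparr>"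

lemma linear_orders_bicomodule: "cosymmetric_bicomodule linear_orders"
proof
  fix I S :: "nat set" and \<sigma> :: "nat \<Rightarrow> nat" and z :: "nat list"
  assume inj: "inj_on \<sigma> I" and "S \<subseteq> I" and "z \<in> sp_basis linear_orders I"
  then have z: "set z = I" and S: "S \<subseteq> I"
    by (auto simp: linear_orders_def permutations_of_set_def)
  have "\<sigma> s \<in> \<sigma> ` S \<longleftrightarrow> s \<in> S" if "s \<in> set z" for s
    using that inj S z by (metis inj_on_image_mem_iff)
  then show "sp_restr linear_orders (\<sigma> ` S) (sp_map linear_orders \<sigma> z) =
      sp_map linear_orders \<sigma> (sp_restr linear_orders S z)"
    by (auto simp: linear_orders_def filter_map o_def cong: filter_cong)
qed (auto simp: linear_orders_def permutations_of_set_def distinct_map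
      intro: inj_on_subset filter_cong)


section \<open>The cochain complex and its cohomology algebra\<close>

text \<open>The decompositions \<open>(F\<^sub>1, \<dots>, F\<^sub>n)\<close> of finite sets; the decomposed set is \<open>\<Union>(set F)\<close>.\<close>

definition decompositions :: "nat \<Rightarrow> nat set list set"
  where "decompositions n = {F. length F = n \<and> finite (\<Union>(set F)) \<and>
    (\<forall>i<n. \<forall>j<n. i \<noteq> j \<longrightarrow> F ! i \<inter> F ! j = {})}"

text \<open>
  \<open>\<alpha> F v\<close> is the coefficient \<open>\<alpha>(F\<^sub>1, \<dots>, F\<^sub>n)(v)\<close>, for \<open>v\<close> in the value of \<open>X\<close> at \<open>\<Union>(set F)\<close>;
  as for functionals, it is \<open>0\<close> for all other arguments.
\<close>

definition cochains ::
    "'b species \<Rightarrow> nat \<Rightarrow> (nat set list \<Rightarrow> ('b \<Rightarrow>\<^sub>0 'k::comm_ring_1) \<Rightarrow> 'k) set"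
  where "cochains X n = {\<alpha>.
    (\<forall>F\<in>decompositions n.
      \<alpha> F \<in> functionals (sp_basis X (\<Union>(set F))) \<and>
      (\<forall>\<sigma> v. inj_on \<sigma> (\<Union>(set F)) \<longrightarrow> keys v \<subseteq> sp_basis X (\<Union>(set F)) \<longrightarrow>
        \<alpha> (map ((`) \<sigma>) F) (push_fm (sp_map X \<sigma>) v) = \<alpha> F v)) \<and>
    (\<forall>F. F \<notin> decompositions n \<longrightarrow> \<alpha> F = 0)}"

text \<open>
  In \<open>coface X n i \<alpha> F\<close> the cochain \<open>\<alpha>\<close> has degree \<open>n\<close>, and the entries \<open>F\<^sub>0, \<dots>, F\<^sub>n\<close> of
  the list \<open>F\<close> are \<open>F ! 0, \<dots>, F ! n\<close>.
\<close>

definition coface ::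
    "'b species \<Rightarrow> nat \<Rightarrow> nat \<Rightarrow> (nat set list \<Rightarrow> ('b \<Rightarrow>\<^sub>0 'k::comm_ring_1) \<Rightarrow> 'k) \<Rightarrow>
     nat set list \<Rightarrow> ('b \<Rightarrow>\<^sub>0 'k) \<Rightarrow> 'k"
  where "coface X n i \<alpha> F v =
    (if i = 0 then \<alpha> (tl F) (push_fm (sp_restr X (\<Union>(set F) - hd F)) v)
     else if i \<le> n then \<alpha> (take (i - 1) F @ (F ! (i - 1) \<union> F ! i) # drop (i + 1) F) v
     else \<alpha> (butlast F) (push_fm (sp_restr X (\<Union>(set F) - last F)) v))"

definition coboundary ::
    "'b species \<Rightarrow> nat \<Rightarrow> (nat set list \<Rightarrow> ('b \<Rightarrow>\<^sub>0 'k::comm_ring_1) \<Rightarrow> 'k) \<Rightarrow>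
     nat set list \<Rightarrow> ('b \<Rightarrow>\<^sub>0 'k) \<Rightarrow> 'k"
  where "coboundary X n \<alpha> F v =
    (if F \<in> decompositions (n + 1) \<and> keys v \<subseteq> sp_basis X (\<Union>(set F))
     then \<Sum>i\<le>n + 1. (-1) ^ i * coface X n i \<alpha> F v else 0)"

definition cup ::
    "'b species \<Rightarrow> nat \<Rightarrow> nat \<Rightarrow> (nat set list \<Rightarrow> ('b \<Rightarrow>\<^sub>0 'k::comm_ring_1) \<Rightarrow> 'k) \<Rightarrow>
     (nat set list \<Rightarrow> ('b \<Rightarrow>\<^sub>0 'k) \<Rightarrow> 'k) \<Rightarrow> nat set list \<Rightarrow> ('b \<Rightarrow>\<^sub>0 'k) \<Rightarrow> 'k"
  where "cup X p q \<alpha> \<beta> F =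
    (if F \<in> decompositions (p + q) then
       lin_ext (sp_basis X (\<Union>(set F))) (\<lambda>z.
         \<alpha> (take p F) (Poly_Mapping.single (sp_restr X (\<Union>(set (take p F))) z) 1) *
         \<beta> (drop p F) (Poly_Mapping.single (sp_restr X (\<Union>(set (drop p F))) z) 1))
     else 0)"

text \<open>The unit, of degree \<open>0\<close>, takes the value \<open>1\<close> at every basis element over the empty set.\<close>

definition cochain_algebra ::
    "'b species \<Rightarrow>
     ('k::comm_ring_1, nat \<Rightarrow> nat set list \<Rightarrow> ('b \<Rightarrow>\<^sub>0 'k) \<Rightarrow> 'k) graded_alg"
  where "cochain_algebra X = direct_sum_algebra (\<lambda>c \<alpha> F v. c * \<alpha> F v) (cochains X)
    (\<lambda>F. if F = [] then lin_ext (sp_basis X {}) (\<lambda>z. 1) else 0) (cup X)"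

definition differential ::
    "'b species \<Rightarrow> (nat \<Rightarrow> nat set list \<Rightarrow> ('b \<Rightarrow>\<^sub>0 'k::comm_ring_1) \<Rightarrow> 'k) \<Rightarrow>
     nat \<Rightarrow> nat set list \<Rightarrow> ('b \<Rightarrow>\<^sub>0 'k) \<Rightarrow> 'k"
  where "differential X x n = (case n of 0 \<Rightarrow> 0 | Suc m \<Rightarrow> coboundary X m (x m))"

definition cocycle_algebra ::
    "'b species \<Rightarrow>
     ('k::comm_ring_1, nat \<Rightarrow> nat set list \<Rightarrow> ('b \<Rightarrow>\<^sub>0 'k) \<Rightarrow> 'k) graded_alg"
  where "cocycle_algebra X = (cochain_algebra X)
    \<lparr> carrier := {x \<in> carrier (cochain_algebra X). differential X x = 0},
      hpart := (\<lambda>n. {x \<in> hpart (cochain_algebra X) n. differential X x = 0}) \<rparr>"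

definition coboundaries ::
    "'b species \<Rightarrow> (nat \<Rightarrow> nat set list \<Rightarrow> ('b \<Rightarrow>\<^sub>0 'k::comm_ring_1) \<Rightarrow> 'k) set"
  where "coboundaries X = differential X ` carrier (cochain_algebra X)"

definition cohomology_algebra ::
    "'b species \<Rightarrow>
     ('k::comm_ring_1, (nat \<Rightarrow> nat set list \<Rightarrow> ('b \<Rightarrow>\<^sub>0 'k) \<Rightarrow> 'k) set) graded_alg"
  where "cohomology_algebra X = (let Z = cocycle_algebra X; B = coboundaries X; Q = Z Quot B in
    \<lparr> carrier = carrier Q, monoid.mult = monoid.mult Q, one = one Q, zero = zero Q, add = add Q,
      smult = (\<lambda>c a. \<Union>x\<in>a. B +>\<^bsub>Z\<^esub> (c \<odot>\<^bsub>Z\<^esub> x)),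
      hpart = (\<lambda>n. (\<lambda>x. B +>\<^bsub>Z\<^esub> x) ` hpart Z n) \<rparr>)"


section \<open>The Koszul algebra\<close>

definition koszul ::
    "'b species \<Rightarrow> nat \<Rightarrow> (('b \<Rightarrow>\<^sub>0 'k::comm_ring_1) \<Rightarrow> 'k) set"
  where "koszul X p = {f \<in> functionals (sp_basis X {1..p}).
    \<forall>\<pi> v. \<pi> permutes {1..p} \<longrightarrow> keys v \<subseteq> sp_basis X {1..p} \<longrightarrow>
      f (push_fm (sp_map X \<pi>) v) = of_int (sign \<pi>) * f v}"

definition sch :: "nat set \<Rightarrow> nat set \<Rightarrow> nat"
  where "sch S T = card {(s, t) \<in> S \<times> T. s > t}"

definition order_relabel :: "nat set \<Rightarrow> nat \<Rightarrow> nat"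
  where "order_relabel S s = card {t \<in> S. t \<le> s}"

lemma order_relabel:
  assumes "finite S"
  shows "strict_mono_on S (order_relabel S)" and "bij_betw (order_relabel S) S {1..card S}"
proof -
  show mono: "strict_mono_on S (order_relabel S)"
  proof (rule strict_mono_onI)
    fix r s assume "r \<in> S" "s \<in> S" "r < s"
    then have "{t \<in> S. t \<le> r} \<subseteq> {t \<in> S. t \<le> s}" "s \<in> {t \<in> S. t \<le> s} - {t \<in> S. t \<le> r}"
      by auto
    then show "order_relabel S r < order_relabel S s"
      unfolding order_relabel_def using assms by (intro psubset_card_mono) auto
  qed
  have "order_relabel S ` S \<subseteq> {1..card S}"
  proof (rule image_subsetI)
    fix s assume "s \<in> S"
    then have "card {t \<in> S. t \<le> s} > 0" "card {t \<in> S. t \<le> s} \<le> card S"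
      using assms by (auto simp: card_gt_0_iff intro: card_mono)
    then show "order_relabel S s \<in> {1..card S}"
      by (simp add: order_relabel_def)
  qed
  then show "bij_betw (order_relabel S) S {1..card S}"
    by (metis bij_betw_def card_atLeastAtMost card_image card_subset_eq diff_Suc_1
        finite_atLeastAtMost mono strict_mono_on_imp_inj_on)
qed

definition koszul_prod ::
    "'b species \<Rightarrow> nat \<Rightarrow> nat \<Rightarrow> (('b \<Rightarrow>\<^sub>0 'k::comm_ring_1) \<Rightarrow> 'k) \<Rightarrow>
     (('b \<Rightarrow>\<^sub>0 'k) \<Rightarrow> 'k) \<Rightarrow> ('b \<Rightarrow>\<^sub>0 'k) \<Rightarrow> 'k"
  where "koszul_prod X p q f g = lin_ext (sp_basis X {1..p + q}) (\<lambda>z.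
    \<Sum>(S, T) \<in> {(S, T). S \<union> T = {1..p + q} \<and> S \<inter> T = {} \<and> card S = p \<and> card T = q}.
      (-1) ^ sch S T *
      f (Poly_Mapping.single (sp_map X (order_relabel S) (sp_restr X S z)) 1) *
      g (Poly_Mapping.single (sp_map X (order_relabel T) (sp_restr X T z)) 1))"

definition koszul_algebra ::
    "'b species \<Rightarrow> ('k::comm_ring_1, nat \<Rightarrow> ('b \<Rightarrow>\<^sub>0 'k) \<Rightarrow> 'k) graded_alg"
  where "koszul_algebra X = direct_sum_algebra (\<lambda>c f v. c * f v) (koszul X)
    (lin_ext (sp_basis X {}) (\<lambda>z. 1)) (koszul_prod X)"

text \<open>The permutation \<open>\<sigma>\<close> of \<open>{1..j}\<close> identified with the linear order \<open>\<sigma> 1 < \<dots> < \<sigma> j\<close>.\<close>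

definition perm_of_order :: "nat list \<Rightarrow> nat \<Rightarrow> nat"
  where "perm_of_order z i = (if i \<in> {1..length z} then z ! (i - 1) else i)"

lemma perm_of_order_map:
  assumes "\<sigma> permutes {1..j}"
  shows "perm_of_order (map \<sigma> [1..<j + 1]) = \<sigma>"
proof
  fix i
  show "perm_of_order (map \<sigma> [1..<j + 1]) i = \<sigma> i"
    using permutes_not_in[OF assms, of i] by (auto simp: perm_of_order_def simp del: upt_Suc)
qed

text \<open>\<open>koszul_gen j\<close> is \<open>f\<^sub>j\<close>, as an element of the direct sum of the graded pieces.\<close>

definition koszul_gen :: "nat \<Rightarrow> nat \<Rightarrow> (nat list \<Rightarrow>\<^sub>0 'k::comm_ring_1) \<Rightarrow> 'k"
  where "koszul_gen j n =
    (if n = j then lin_ext (sp_basis linear_orders {1..j}) (\<lambda>z. of_int (sign (perm_of_order z)))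
     else 0)"

end

theory Submission
  imports Defs
begin

text \<open>
  A cochain of degree \<open>n\<close> is natural, so it is determined by its values at the standard
  orders \<open>0 < \<dots> < m - 1\<close>. A decomposition of \<open>{..<m}\<close> into \<open>n\<close> blocks is a word of length \<open>m\<close> in
  \<open>n\<close> letters: the \<open>k\<close>-th letter names the block of \<open>k\<close>. Hence degree \<open>n\<close> cochains of the species of
  linear orders are arbitrary functions on words with letters in \<open>{..<n}\<close>. An inner coface
  identifies two adjacent letters, and the two outer cofaces delete the first or the last letter.
  This is the cochain complex of the simplicial set whose \<open>n\<close>-simplices are the words in \<open>n\<close> letters,
  that is, of the free monoid on the pointed simplicial circle. That is the James
  construction, a model of the loop space of the 2-sphere, so the divided power algebra on a class
  of degree 2 tensor the exterior algebra on a class of degree 1 is what one expects.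
  
  The proof makes the topology explicit. Splitting off the first letter of a word exhibits the
  augmentation ideal of the free monoid ring as the reduced circle tensor the whole ring,
  and the shuffle and Alexander-Whitney maps for this tensor product give operators
  \<open>desuspension\<close> and \<open>suspension\<close> that shift degrees by one. The explicit homotopy in
  \<open>homotopy_identity\<close> shows that they are inverse to each other on cohomology, up to the constants.
  By induction on the degree (\<open>word_cocycle_decomp\<close>), a cocycle \<open>a\<close> of degree \<open>n\<close> is the sum of a
  coboundary and of \<open>alternation n a\<close> times the cocycle \<open>subword_count n\<close>, which counts the occurrences of
  the subword \<open>0 1 \<dots> (n - 1)\<close>. The number \<open>alternation n a\<close> is the sum of \<open>a\<close> over the permutations
  of the \<open>n\<close> letters, with signs. It vanishes on coboundaries, so it is a complete invariant of the
  cohomology class.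
  
  For the products, an alternating sum over the permutations of \<open>p + q\<close> letters of a cup product
  factors, with the signed number of \<open>(p, q)\<close>-shuffles as structure constant
  (\<open>alternation_word_cup\<close>). The product of sign functionals on the Koszul side runs over the same
  shuffles (\<open>sum_splittings\<close>). This constant is the Gaussian binomial coefficient at \<open>-1\<close>: it is
  \<open>0\<close> if \<open>p\<close> and \<open>q\<close> are odd, and the binomial coefficient of the halves otherwise
  (\<open>signed_shuffles_eq\<close>). So the Koszul algebra and the cohomology algebra are both isomorphic to one
  explicit model, \<open>shuffle_algebra\<close>, which is free on one basis element in every degree. There the
  tensor product decomposition is a computation: the even basis elements are the divided powers,
  and multiplication by the basis element of degree 1 maps the even part onto the odd part.
\<close>

section \<open>Words and the James construction\<close>

definition merge_at :: "nat \<Rightarrow> nat \<Rightarrow> nat"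
  where "merge_at i c = (if c < i then c else c - 1)"

definition skip_at :: "nat \<Rightarrow> nat \<Rightarrow> nat"
  where "skip_at j c = (if c < j then c else Suc c)"

text \<open>
  In degree \<open>N\<close> the outer faces, \<open>0\<close> and \<open>N\<close>, send the first and the last letter to the base point of
  the circle, which is the empty word. If \<open>N = 1\<close>, then both of them delete the only letter.
\<close>

definition survives :: "nat \<Rightarrow> nat \<Rightarrow> nat \<Rightarrow> bool"
  where "survives N i c \<longleftrightarrow> \<not> (i = 0 \<and> c = 0) \<and> \<not> (i = N \<and> Suc c = N)"

definition word_face :: "nat \<Rightarrow> nat \<Rightarrow> nat list \<Rightarrow> nat list"
  where "word_face N i w = map (merge_at i) (filter (survives N i) w)"

definition word_coboundary :: "nat \<Rightarrow> (nat list \<Rightarrow> 'k::comm_ring_1) \<Rightarrow> nat list \<Rightarrow> 'k"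
  where "word_coboundary n a w = (\<Sum>i\<le>Suc n. (-1) ^ i * a (word_face (Suc n) i w))"

text \<open>
  Precomposition with the shuffle product by the fundamental simplex of the circle: the letter \<open>j\<close> in
  front is the nondegenerate 1-simplex, and \<open>skip_at j\<close> is the degeneracy of the remaining word that makes
  room for it.
\<close>

definition desuspension :: "nat \<Rightarrow> (nat list \<Rightarrow> 'k::comm_ring_1) \<Rightarrow> nat list \<Rightarrow> 'k"
  where "desuspension n a w = (\<Sum>j\<le>n. (-1) ^ j * a (j # map (skip_at j) w))"

text \<open>
  Precomposition with the Alexander-Whitney map for the first letter, applied to every suffix of the
  word. The sum over suffixes expresses the coordinates in which a word \<open>c # w\<close> is replaced by
  \<open>c # w\<close> minus \<open>w\<close>; these differences span the reduced circle tensor the free monoid ring.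
\<close>

fun suspension :: "(nat list \<Rightarrow> 'k::comm_ring_1) \<Rightarrow> nat list \<Rightarrow> 'k" where
  "suspension a [] = 0"
| "suspension a (c # w) =
    (if c = 0 then a (map (merge_at 0) (filter (\<lambda>c. c \<noteq> 0) w)) else 0) + suspension a w"

text \<open>
  Prism operators for the contraction of the cone over a word, the first letter being the cone
  coordinate. As for \<open>suspension\<close>, the recursion undoes the passage to differences \<open>c # w\<close> minus \<open>w\<close>.
\<close>

fun homotopy :: "nat \<Rightarrow> (nat list \<Rightarrow> 'k::comm_ring_1) \<Rightarrow> nat list \<Rightarrow> 'k" where
  "homotopy n a [] = 0"
| "homotopy n a (c # w) =
    (\<Sum>j\<in>{c<..n}. (-1) ^ j * a (j # map (skip_at j) w)) + homotopy n a w"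

text \<open>
  Unfolding the recursion, \<open>alternation n a\<close> is the sum of \<open>a\<close> over all permutations of the
  letters, with signs: \<open>(-1) ^ j\<close> is the contribution of the inversions that involve a first letter \<open>j\<close>.
\<close>

fun alternation :: "nat \<Rightarrow> (nat list \<Rightarrow> 'k::comm_ring_1) \<Rightarrow> 'k" where
  "alternation 0 a = a []"
| "alternation (Suc n) a = alternation n (desuspension n a)"

text \<open>
  The number of occurrences of the word \<open>0 1 \<dots> (n - 1)\<close> as a (not necessarily contiguous) subword.
\<close>

fun subword_count :: "nat \<Rightarrow> nat list \<Rightarrow> 'k::comm_ring_1" where
  "subword_count 0 w = 1"
| "subword_count (Suc n) w = suspension (subword_count n) w"

lemma word_face_Nil [simp]: "word_face N i [] = []"
  by (simp add: word_face_def)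

lemma word_face_Cons:
  "word_face N i (c # w) =
    (if survives N i c then merge_at i c # word_face N i w else word_face N i w)"
  by (simp add: word_face_def)

lemma map_filter_cong:
  assumes "\<And>x. x \<in> set xs \<Longrightarrow> P (f x) \<longleftrightarrow> Q x"
    and "\<And>x. x \<in> set xs \<Longrightarrow> Q x \<Longrightarrow> g (f x) = f' (g' x)"
  shows "map g (filter P (map f xs)) = map f' (map g' (filter Q xs))"
  using assms by (induction xs) auto

text \<open>
  The simplicial identities between faces and degeneracies, letter by letter.
\<close>

lemma word_face_skip_below:
  assumes "i < j" "j \<le> N"
  shows "word_face (Suc N) i (map (skip_at j) w) = map (skip_at (j - 1)) (word_face N i w)"
  unfolding word_face_def
  by (rule map_filter_cong)
    (use assms in \<open>auto simp: survives_def merge_at_def skip_at_def split: if_splits\<close>)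

lemma word_face_skip_above:
  assumes "j < i" "i \<le> N" "set w \<subseteq> {..<N}"
  shows "word_face (Suc N) (Suc i) (map (skip_at j) w) = map (skip_at j) (word_face N i w)"
  unfolding word_face_def
  by (rule map_filter_cong)
    (use assms in \<open>auto simp: survives_def merge_at_def skip_at_def split: if_splits\<close>)

lemma word_face_skip_id:
  assumes "i = j \<or> i = Suc j" "j \<le> N" "set w \<subseteq> {..<N}"
  shows "word_face (Suc N) i (map (skip_at j) w) = w"
proof -
  have "word_face (Suc N) i (map (skip_at j) w) = map id (map id (filter (\<lambda>_. True) w))"
    unfolding word_face_def
    by (rule map_filter_cong)
      (use assms in \<open>auto simp: survives_def merge_at_def skip_at_def split: if_splits\<close>)
  then show ?thesis by simp
qed

section \<open>The loop space homotopy\<close>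

definition prism :: "nat \<Rightarrow> (nat list \<Rightarrow> 'k::comm_ring_1) \<Rightarrow> nat list \<Rightarrow> nat \<Rightarrow> nat \<Rightarrow> 'k"
  where "prism N a w i j = (-1) ^ (i + j) * a (j # map (skip_at j) (word_face N i w))"

text \<open>
  Faces of \<open>j # map (skip_at j) w\<close>: the faces \<open>j\<close> and \<open>j + 1\<close> cancel the degeneracy and change only the
  first letter, which is lost if it runs off either end. The other faces commute past the
  degeneracy and land in the same shape with \<open>j\<close> or \<open>j - 1\<close> in front. When this is summed over an
  interval of \<open>j\<close>, the first kind of terms telescopes.
\<close>

lemma word_coboundary_prism:
  assumes j: "j \<le> N" and w: "set w \<subseteq> {..<N}"
  shows "(-1) ^ j * word_coboundary N a (j # map (skip_at j) w) =
    (if j = 0 then a w else a ((j - 1) # w)) - (if j < N then a (j # w) else a w)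
    - (\<Sum>i<j. prism N a w i (j - 1)) - (\<Sum>i\<in>{j<..N}. prism N a w i j)"
proof -
  let ?t = "\<lambda>i. (-1) ^ j * ((-1) ^ i * a (word_face (Suc N) i (j # map (skip_at j) w)))"
  have split: "{..Suc N} = {..<j} \<union> {j, Suc j} \<union> Suc ` {j<..N}"
    using j by (auto simp: image_iff) 
      (metis Suc_diff_1 Suc_le_mono not_less_eq gr0_conv_Suc greaterThanAtMost_iff
        Suc_less_eq not_less_less_Suc_eq le_Suc_eq linorder_neqE_nat)
  have below: "?t i = - prism N a w i (j - 1)" if "i < j" for i
  proof -
    from that obtain j' where j': "j = Suc j'" using less_imp_Suc_add by blast
    have "word_face (Suc N) i (j # map (skip_at j) w) = j' # map (skip_at j') (word_face N i w)"
      using that j word_face_skip_below[of i j N w]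
      by (auto simp: word_face_Cons survives_def merge_at_def j')
    then show ?thesis by (simp add: prism_def j' power_add mult.assoc)
  qed
  have above: "?t (Suc i) = - prism N a w i j" if "i \<in> {j<..N}" for i
  proof -
    have "word_face (Suc N) (Suc i) (j # map (skip_at j) w) = j # map (skip_at j) (word_face N i w)"
      using that j word_face_skip_above[of j i N w] w
      by (auto simp: word_face_Cons survives_def merge_at_def)
    then show ?thesis by (simp add: prism_def power_add mult.assoc)
  qed
  have at1: "?t j = (if j = 0 then a w else a ((j - 1) # w))"
    using word_face_skip_id[of j j N w] w j
    by (auto simp: word_face_Cons survives_def merge_at_def simp flip: mult.assoc power_add)
  have at2: "?t (Suc j) = - (if j < N then a (j # w) else a w)"
    using word_face_skip_id[of "Suc j" j N w] w j
    by (auto simp: word_face_Cons survives_def merge_at_def simp flip: mult.assoc power_add)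
  have "(-1) ^ j * word_coboundary N a (j # map (skip_at j) w) = sum ?t {..Suc N}"
    by (simp only: word_coboundary_def sum_distrib_left)
  also have "\<dots> = sum ?t {..<j} + (?t j + ?t (Suc j)) + sum ?t (Suc ` {j<..N})"
    unfolding split by (subst sum.union_disjoint; (subst sum.union_disjoint)?; auto)
  also have "sum ?t {..<j} = - (\<Sum>i<j. prism N a w i (j - 1))"
    using below by (simp add: sum_negf)
  also have "sum ?t (Suc ` {j<..N}) = - (\<Sum>i\<in>{j<..N}. prism N a w i j)"
    using above by (subst sum.reindex) (auto simp: sum_negf)
  finally show ?thesis unfolding at1 at2 by simp
qed

lemma set_word_face: "set w \<subseteq> {..<Suc N} \<Longrightarrow> i \<le> Suc N \<Longrightarrow> set (word_face (Suc N) i w) \<subseteq> {..<N}"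
  by (fastforce simp: word_face_def survives_def merge_at_def split: if_splits)

lemma word_face_0: "N \<noteq> 0 \<Longrightarrow> word_face N 0 w = map (merge_at 0) (filter (\<lambda>c. c \<noteq> 0) w)"
  unfolding word_face_def by (rule arg_cong[where f = "map _"], rule filter_cong) (auto simp: survives_def)

lemma word_coboundary_cong:
  assumes "\<And>w. set w \<subseteq> {..<n} \<Longrightarrow> a w = b w" "set w \<subseteq> {..<Suc n}"
  shows "word_coboundary n a w = word_coboundary n b w"
  unfolding word_coboundary_def by (intro sum.cong refl) (simp add: assms set_word_face)

lemma word_coboundary_linear:
  "word_coboundary n (\<lambda>w. a w + c * b w) w = word_coboundary n a w + c * word_coboundary n b w"
  unfolding word_coboundary_def sum_distrib_left sum.distrib[symmetric]
  by (simp only: distrib_left mult.left_commute)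

lemma desuspension_cong:
  assumes "\<And>w. set w \<subseteq> {..<Suc n} \<Longrightarrow> a w = b w" "set w \<subseteq> {..<n}"
  shows "desuspension n a w = desuspension n b w"
  unfolding desuspension_def
  by (intro sum.cong refl arg_cong2[where f = "(*)"] assms(1)) (use assms(2) in \<open>auto simp: skip_at_def\<close>)

lemma desuspension_linear:
  "desuspension n (\<lambda>w. a w + c * b w) w = desuspension n a w + c * desuspension n b w"
  unfolding desuspension_def sum_distrib_left sum.distrib[symmetric]
  by (simp only: distrib_left mult.left_commute)

lemma alternation_cong:
  assumes "\<And>w. set w \<subseteq> {..<n} \<Longrightarrow> a w = b w"
  shows "alternation n a = alternation n b"
  using assms
proof (induction n arbitrary: a b)
  case (Suc n)
  have "desuspension n a w = desuspension n b w" if "set w \<subseteq> {..<n}" for w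
    using Suc.prems that by (rule desuspension_cong)
  then show ?case unfolding alternation.simps by (rule Suc.IH)
qed simp

lemma alternation_linear:
  "alternation n (\<lambda>w. a w + c * b w) = alternation n a + c * alternation n b"
proof (induction n arbitrary: a b)
  case (Suc n)
  then show ?case by (simp add: desuspension_linear[abs_def])
qed simp

lemma suspension_cong:
  assumes "\<And>w. set w \<subseteq> {..<n} \<Longrightarrow> a w = b w" "set w \<subseteq> {..<Suc n}"
  shows "suspension a w = suspension b w"
  using assms(2)
proof (induction w)
  case (Cons c w)
  have "set (map (merge_at 0) (filter (\<lambda>c. c \<noteq> 0) w)) \<subseteq> {..<n}"
    using Cons.prems by (auto simp: merge_at_def)
  then show ?case using Cons assms(1) by simp
qed simp

lemma suspension_linear:
  "suspension (\<lambda>w. a w + c * b w) w = suspension a w + c * suspension b w"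
  by (induction w) (auto simp: algebra_simps)

text \<open>
  The telescoping terms both end at the word \<open>w\<close> itself, because the extreme values of the
  first letter are deleted by the two outer faces; this is where both outer faces enter symmetrically.
\<close>

lemma desuspension_coboundary:
  assumes w: "set w \<subseteq> {..<Suc n}"
  shows "desuspension (Suc n) (word_coboundary (Suc n) a) w =
    - word_coboundary n (desuspension n a) w"
proof -
  let ?N = "Suc n"
  let ?g = "prism ?N a w"
  let ?e = "\<lambda>j. if j = 0 then a w else a ((j - 1) # w)"
  have "desuspension ?N (word_coboundary ?N a) w =
    (\<Sum>j\<le>?N. ?e j - (if j < ?N then a (j # w) else a w) - (\<Sum>i<j. ?g i (j - 1)) - (\<Sum>i\<in>{j<..?N}. ?g i j))"
    unfolding desuspension_def
    by (intro sum.cong refl) (use word_coboundary_prism[OF _ w, of _ a] in auto)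
  also have "\<dots> = (\<Sum>j\<le>?N. ?e j) - (\<Sum>j\<le>?N. if j < ?N then a (j # w) else a w)
      - (\<Sum>j\<le>?N. \<Sum>i<j. ?g i (j - 1)) - (\<Sum>j\<le>?N. \<Sum>i\<in>{j<..?N}. ?g i j)"
    by (simp add: sum_subtractf)
  also have "(\<Sum>j\<le>?N. ?e j) = a w + (\<Sum>j\<le>n. a (j # w))"
    by (subst sum.atMost_Suc_shift) simp
  also have "(\<Sum>j\<le>?N. if j < ?N then a (j # w) else a w) = (\<Sum>j\<le>n. a (j # w)) + a w"
    by (simp add: sum.atMost_Suc)
  also have "(\<Sum>j\<le>?N. \<Sum>i<j. ?g i (j - 1)) = (\<Sum>j\<le>n. \<Sum>i<Suc j. ?g i j)"
    by (subst sum.atMost_Suc_shift) simp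
  also have "(\<Sum>j\<le>?N. \<Sum>i\<in>{j<..?N}. ?g i j) = (\<Sum>j\<le>n. \<Sum>i\<in>{j<..?N}. ?g i j)"
    by (simp add: sum.atMost_Suc)
  also have "a w + (\<Sum>j\<le>n. a (j # w)) - ((\<Sum>j\<le>n. a (j # w)) + a w) - (\<Sum>j\<le>n. \<Sum>i<Suc j. ?g i j)
      - (\<Sum>j\<le>n. \<Sum>i\<in>{j<..?N}. ?g i j) =
      - (\<Sum>j\<le>n. (\<Sum>i<Suc j. ?g i j) + (\<Sum>i\<in>{j<..?N}. ?g i j))"
    by (simp add: sum.distrib)
  also have "(\<Sum>j\<le>n. (\<Sum>i<Suc j. ?g i j) + (\<Sum>i\<in>{j<..?N}. ?g i j)) = (\<Sum>j\<le>n. \<Sum>i\<le>?N. ?g i j)"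
  proof (intro sum.cong refl)
    fix j assume "j \<in> {..n}"
    then have "{..?N} = {..<Suc j} \<union> {j<..?N}" by auto
    then show "(\<Sum>i<Suc j. ?g i j) + (\<Sum>i\<in>{j<..?N}. ?g i j) = (\<Sum>i\<le>?N. ?g i j)"
      by (simp only:) (subst sum.union_disjoint; auto)
  qed
  also have "\<dots> = word_coboundary n (desuspension n a) w"
    unfolding word_coboundary_def desuspension_def prism_def sum_distrib_left
    by (subst sum.swap) (simp add: power_add mult.assoc)
  finally show ?thesis .
qed

text \<open>
  By the previous lemma the statement reduces to degree 0, where both faces of the one-letter
  word give the empty word, with opposite signs.
\<close>

lemma alternation_coboundary: "alternation (Suc n) (word_coboundary n a) = 0"
proof (induction n arbitrary: a)
  case 0
  show ?case by (simp add: desuspension_def word_coboundary_def word_face_def survives_def)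
next
  case (Suc n)
  have "alternation (Suc (Suc n)) (word_coboundary (Suc n) a) =
      alternation (Suc n) (\<lambda>w. 0 + (-1) * word_coboundary n (desuspension n a) w)"
    unfolding alternation.simps(2)[of "Suc n"]
    by (rule alternation_cong) (simp add: desuspension_coboundary)
  also have "\<dots> = alternation (Suc n) (\<lambda>w. 0)"
    by (subst alternation_linear) (simp only: Suc mult_zero_right add_0_right)
  also have "\<dots> = 0"
    using alternation_linear[of "Suc n" "\<lambda>w. 0" "-1" "\<lambda>w. 0"] by simp
  finally show ?case .
qed

lemma sum_eq_sum_if: "finite B \<Longrightarrow> A \<subseteq> B \<Longrightarrow> sum f A = (\<Sum>x\<in>B. if x \<in> A then f x else 0)"
  by (simp add: sum.inter_restrict[symmetric] Int_absorb1)

text \<open>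
  In coordinates \<open>c # w\<close> minus \<open>w\<close>, this says that the prism operators contract everything but the
  part with first letter \<open>0\<close>, which is the image of the Alexander-Whitney map. The induction on the word sums
  these identities over all suffixes, down to the empty word. In the induction step,
  all off-diagonal terms are \<open>prism\<close> terms with indices \<open>(i, j)\<close>; those of the
  coboundary of the homotopy, together with the suspension term for \<open>(0, j)\<close>, fill the same region \<open>?R\<close> of indices as
  those of the homotopy of the coboundary, with opposite sign.
\<close>

lemma homotopy_identity:
  assumes "set w \<subseteq> {..<Suc n}"
  shows "a w - a [] = word_coboundary n (homotopy n a) w +
    homotopy (Suc n) (word_coboundary (Suc n) a) w + suspension (desuspension n a) w"
  using assms
proof (induction w)
  case Nil
  show ?case by (simp add: word_coboundary_def)
next
  case (Cons c w)
  let ?N = "Suc n"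
  let ?g = "prism ?N a w"
  let ?R = "\<Sum>i\<le>?N. \<Sum>j\<le>n. if i \<le> c \<and> c \<le> j \<or> c < i \<and> c < j then ?g i j else 0"
  have c: "c \<le> n" and w: "set w \<subseteq> {..<?N}" using Cons.prems by auto
  have "word_coboundary n (homotopy n a) (c # w) - word_coboundary n (homotopy n a) w =
    (\<Sum>i\<le>?N. \<Sum>j\<in>(if survives ?N i c then {merge_at i c<..n} else {}). ?g i j)"
    unfolding word_coboundary_def sum_subtractf[symmetric]
    by (intro sum.cong refl)
      (simp add: word_face_Cons prism_def power_add sum_distrib_left mult.assoc distrib_left)
  also have "\<dots> = ?R - (if c = 0 then \<Sum>j\<le>n. ?g 0 j else 0)"
  proof -
    have "(\<Sum>i\<le>?N. \<Sum>j\<in>(if survives ?N i c then {merge_at i c<..n} else {}). ?g i j) =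
      (\<Sum>i\<le>?N. (\<Sum>j\<le>n. if i \<le> c \<and> c \<le> j \<or> c < i \<and> c < j then ?g i j else 0) -
        (if i = 0 then if c = 0 then \<Sum>j\<le>n. ?g 0 j else 0 else 0))"
    proof (intro sum.cong refl)
      fix i assume i: "i \<in> {..?N}"
      show "(\<Sum>j\<in>(if survives ?N i c then {merge_at i c<..n} else {}). ?g i j) =
        (\<Sum>j\<le>n. if i \<le> c \<and> c \<le> j \<or> c < i \<and> c < j then ?g i j else 0) -
        (if i = 0 then if c = 0 then \<Sum>j\<le>n. ?g 0 j else 0 else 0)"
      proof (cases "i = 0 \<and> c = 0")
        case False
        have "(\<Sum>j\<in>(if survives ?N i c then {merge_at i c<..n} else {}). ?g i j) =
          (\<Sum>j\<le>n. if j \<in> (if survives ?N i c then {merge_at i c<..n} else {}) then ?g i j else 0)"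
          by (rule sum_eq_sum_if) auto
        also have "\<dots> = (\<Sum>j\<le>n. if i \<le> c \<and> c \<le> j \<or> c < i \<and> c < j then ?g i j else 0)"
          by (intro sum.cong refl if_cong) (use False i c in \<open>auto simp: survives_def merge_at_def\<close>)
        finally show ?thesis using False by auto
      qed (simp add: survives_def)
    qed
    then show ?thesis by (simp add: sum_subtractf)
  qed
  finally have 1: "word_coboundary n (homotopy n a) (c # w) - word_coboundary n (homotopy n a) w =
    ?R - (if c = 0 then \<Sum>j\<le>n. ?g 0 j else 0)" .
  have 3: "suspension (desuspension n a) (c # w) - suspension (desuspension n a) w =
    (if c = 0 then \<Sum>j\<le>n. ?g 0 j else 0)"
    by (simp add: desuspension_def prism_def word_face_0)
  have split: "{c<..?N} = Suc ` {c..n}"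
    by (auto simp: image_iff Suc_le_eq dest: less_imp_Suc_add)
  have split': "Suc ` {c..n} = insert ?N {c<..n}"
    unfolding split[symmetric] using c by auto
  have "homotopy ?N (word_coboundary ?N a) (c # w) - homotopy ?N (word_coboundary ?N a) w =
    (\<Sum>j\<in>{c<..?N}. (-1) ^ j * word_coboundary ?N a (j # map (skip_at j) w))"
    by simp
  also have "\<dots> =
    (\<Sum>j\<in>{c<..?N}. a ((j - 1) # w) - (if j < ?N then a (j # w) else a w) -
      (\<Sum>i<j. ?g i (j - 1)) - (\<Sum>i\<in>{j<..?N}. ?g i j))"
    by (intro sum.cong refl, subst word_coboundary_prism[OF _ w]) auto
  also have "\<dots> = (\<Sum>j\<in>{c<..?N}. a ((j - 1) # w)) - (\<Sum>j\<in>{c<..?N}. if j < ?N then a (j # w) else a w) -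
      (\<Sum>j\<in>{c<..?N}. \<Sum>i<j. ?g i (j - 1)) - (\<Sum>j\<in>{c<..?N}. \<Sum>i\<in>{j<..?N}. ?g i j)"
    by (simp only: sum_subtractf)
  also have "(\<Sum>j\<in>{c<..?N}. a ((j - 1) # w)) = a (c # w) + (\<Sum>j\<in>{c<..n}. a (j # w))"
    unfolding split using c by (subst sum.reindex) (auto simp: sum.head o_def)
  also have "(\<Sum>j\<in>{c<..?N}. if j < ?N then a (j # w) else a w) = a w + (\<Sum>j\<in>{c<..n}. a (j # w))"
    unfolding split split' by simp
  also have "(\<Sum>j\<in>{c<..?N}. \<Sum>i<j. ?g i (j - 1)) = (\<Sum>j\<in>{c..n}. \<Sum>i\<le>j. ?g i j)"
    unfolding split by (subst sum.reindex) (auto simp: lessThan_Suc_atMost)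
  also have "(\<Sum>j\<in>{c<..?N}. \<Sum>i\<in>{j<..?N}. ?g i j) = (\<Sum>j\<in>{c<..n}. \<Sum>i\<in>{j<..?N}. ?g i j)"
    unfolding split split' by simp
  also have "a (c # w) + (\<Sum>j\<in>{c<..n}. a (j # w)) - (a w + (\<Sum>j\<in>{c<..n}. a (j # w))) -
      (\<Sum>j\<in>{c..n}. \<Sum>i\<le>j. ?g i j) - (\<Sum>j\<in>{c<..n}. \<Sum>i\<in>{j<..?N}. ?g i j) =
    a (c # w) - a w - ((\<Sum>j\<in>{c..n}. \<Sum>i\<le>j. ?g i j) + (\<Sum>j\<in>{c<..n}. \<Sum>i\<in>{j<..?N}. ?g i j))"
    by (simp add: algebra_simps)
  also have "(\<Sum>j\<in>{c..n}. \<Sum>i\<le>j. ?g i j) + (\<Sum>j\<in>{c<..n}. \<Sum>i\<in>{j<..?N}. ?g i j) = ?R"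
  proof -
    have "(\<Sum>j\<in>{c..n}. \<Sum>i\<le>j. ?g i j) = (\<Sum>j\<le>n. \<Sum>i\<le>?N. if c \<le> j \<and> i \<le> j then ?g i j else 0)"
      by (subst sum_eq_sum_if[of "{..n}"]; (intro sum.cong refl)?)
        (auto, subst sum_eq_sum_if[of "{..?N}"], auto)
    moreover have "(\<Sum>j\<in>{c<..n}. \<Sum>i\<in>{j<..?N}. ?g i j) =
        (\<Sum>j\<le>n. \<Sum>i\<le>?N. if c < j \<and> j < i then ?g i j else 0)"
      by (subst sum_eq_sum_if[of "{..n}"]; (intro sum.cong refl)?)
        (auto, subst sum_eq_sum_if[of "{..?N}"], auto intro!: sum.cong)
    ultimately have "(\<Sum>j\<in>{c..n}. \<Sum>i\<le>j. ?g i j) + (\<Sum>j\<in>{c<..n}. \<Sum>i\<in>{j<..?N}. ?g i j) =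
        (\<Sum>j\<le>n. \<Sum>i\<le>?N. (if c \<le> j \<and> i \<le> j then ?g i j else 0) + (if c < j \<and> j < i then ?g i j else 0))"
      by (simp only: sum.distrib)
    also have "\<dots> = (\<Sum>j\<le>n. \<Sum>i\<le>?N. if i \<le> c \<and> c \<le> j \<or> c < i \<and> c < j then ?g i j else 0)"
      by (intro sum.cong refl) auto
    also have "\<dots> = ?R" by (rule sum.swap)
    finally show ?thesis .
  qed
  finally have 2: "homotopy ?N (word_coboundary ?N a) (c # w) - homotopy ?N (word_coboundary ?N a) w =
    a (c # w) - a w - ?R" .
  have "a w - a [] = word_coboundary n (homotopy n a) w +
    homotopy ?N (word_coboundary ?N a) w + suspension (desuspension n a) w"
    using Cons.IH w .
  moreover have "p - e = x1 + x2 + x3"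
    if "x1 - y1 = r - d" "x2 - y2 = p - q - r" "x3 - y3 = d" "q - e = y1 + y2 + y3"
    for p q e r d x1 x2 x3 y1 y2 y3 :: 'a
  proof -
    have "p - e = (x1 - y1) + (x2 - y2) + (x3 - y3) + (y1 + y2 + y3)"
      unfolding that(1-3) that(4)[symmetric] by simp
    then show ?thesis by simp
  qed
  ultimately show ?case using 1 2 3 by blast
qed

lemma map_filter_map_filter_cong:
  assumes "\<And>x. x \<in> set xs \<Longrightarrow> P x \<and> Q (f x) \<longleftrightarrow> P' x \<and> Q' (f' x)"
    and "\<And>x. x \<in> set xs \<Longrightarrow> P x \<Longrightarrow> Q (f x) \<Longrightarrow> g (f x) = g' (f' x)"
  shows "map g (filter Q (map f (filter P xs))) = map g' (filter Q' (map f' (filter P' xs)))"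
  using assms by (induction xs) auto

text \<open>
  Suspension only sees the letter \<open>0\<close> in front. If the front letter is \<open>0\<close>, then all faces but the
  first keep it. If it is \<open>1\<close>, then the faces \<open>0\<close> and \<open>1\<close> both turn it into \<open>0\<close>, and their
  contributions cancel.
\<close>

lemma word_coboundary_suspension:
  assumes "set w \<subseteq> {..<Suc (Suc n)}"
  shows "word_coboundary (Suc n) (suspension a) w = - suspension (word_coboundary n a) w"
  using assms
proof (induction w)
  case Nil
  show ?case by (simp add: word_coboundary_def)
next
  case (Cons c w)
  let ?N = "Suc (Suc n)" and ?d = "\<lambda>w. map (merge_at 0) (filter (\<lambda>c. c \<noteq> 0) w)"
  have w: "set w \<subseteq> {..<?N}" using Cons.prems by auto
  let ?t = "\<lambda>i. if survives ?N i c \<and> merge_at i c = 0 then (-1) ^ i * a (?d (word_face ?N i w)) else 0"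
  have "word_coboundary (Suc n) (suspension a) (c # w) - word_coboundary (Suc n) (suspension a) w =
    (\<Sum>i\<le>?N. ?t i)"
    unfolding word_coboundary_def sum_subtractf[symmetric]
    by (intro sum.cong refl) (simp add: word_face_Cons distrib_left)
  also have "\<dots> = - (if c = 0 then word_coboundary n a (?d w) else 0)"
  proof (cases "c = 0")
    case True
    have face: "?d (word_face ?N (Suc i) w) = word_face (Suc n) i (?d w)" if "i \<le> Suc n" for i
      unfolding word_face_def
      by (rule map_filter_map_filter_cong) (use w that in \<open>auto simp: survives_def merge_at_def\<close>)
    have "(\<Sum>i\<le>?N. ?t i) = (\<Sum>i\<le>Suc n. ?t (Suc i))"
      by (subst sum.atMost_Suc_shift) (simp add: survives_def True)
    also have "\<dots> = (\<Sum>i\<le>Suc n. - ((-1) ^ i * a (word_face (Suc n) i (?d w))))"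
      by (intro sum.cong refl) (simp add: True survives_def merge_at_def face del: neq0_conv)
    finally show ?thesis by (simp only: True word_coboundary_def sum_negf if_True simp_thms)
  next
    case False
    have "?t i = 0" if "i \<notin> {0, 1}" for i
      using that False by (auto simp: merge_at_def)
    then have "(\<Sum>i\<le>?N. ?t i) = (\<Sum>i\<in>{0, 1}. ?t i)"
      by (intro sum.mono_neutral_right) auto
    also have "\<dots> = 0"
    proof -
      have "?d (word_face ?N 0 w) = ?d (word_face ?N 1 w)"
        unfolding word_face_def
        by (rule map_filter_map_filter_cong) (auto simp: survives_def merge_at_def)
      then show ?thesis using False by (auto simp: survives_def merge_at_def)
    qed
    finally show ?thesis using False by simp
  qed
  finally have "word_coboundary (Suc n) (suspension a) (c # w) =
      - (if c = 0 then word_coboundary n a (?d w) else 0) + word_coboundary (Suc n) (suspension a) w"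
    by (simp only: diff_eq_eq)
  then show ?case unfolding Cons.IH[OF w] by simp
qed

lemma subword_count_cocycle:
  "set w \<subseteq> {..<Suc n} \<Longrightarrow> word_coboundary n (subword_count n) w = 0"
proof (induction n arbitrary: w)
  case 0
  then show ?case by (simp add: word_coboundary_def)
next
  case (Suc n)
  have "subword_count (Suc n) = suspension (subword_count n)" by (rule ext) simp
  then have "word_coboundary (Suc n) (subword_count (Suc n)) w =
      - suspension (word_coboundary n (subword_count n)) w"
    using word_coboundary_suspension Suc.prems by metis
  also have "suspension (word_coboundary n (subword_count n)) w = suspension (\<lambda>w. 0 :: 'a) w"
    using Suc by (intro suspension_cong[of "Suc n"]) auto
  also have "\<dots> = 0" by (induction w) auto
  finally show ?case by simp
qed

text \<open>
  Normalization: the counting cocycle vanishes at words that omit one of the letters, in particular at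
  degenerate words.
\<close>

lemma subword_count_eq_0: "j < n \<Longrightarrow> j \<notin> set w \<Longrightarrow> subword_count n w = 0"
proof (induction n arbitrary: j w)
  case (Suc n)
  show ?case using Suc.prems(2)
  proof (induction w)
    case (Cons c w)
    have "subword_count n (map (merge_at 0) (filter (\<lambda>c. c \<noteq> 0) w)) = (0 :: 'a)" if "c = 0"
    proof (rule Suc.IH[of "j - 1"])
      show "j - 1 < n" "j - 1 \<notin> set (map (merge_at 0) (filter (\<lambda>c. c \<noteq> 0) w))"
        using Cons.prems that Suc.prems(1) by (auto simp: merge_at_def image_iff) (metis Suc_pred)
    qed
    then show ?case using Cons by auto
  qed simp
qed simp

text \<open>
  Only \<open>j = 0\<close> contributes: each \<open>map (skip_at j) w\<close> omits \<open>j\<close>, so by normalization a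
  subword has to start with the letter in front.
\<close>

lemma desuspension_subword_count:
  assumes "set w \<subseteq> {..<n}"
  shows "desuspension n (subword_count (Suc n)) w = subword_count n w"
proof -
  have "map (merge_at 0) (filter (\<lambda>c. c \<noteq> 0) (map (skip_at 0) w)) = w"
    by (induction w) (auto simp: merge_at_def skip_at_def)
  moreover have "suspension (subword_count n) (map (skip_at j) w) = (0::'a)" if "j \<le> n" for j
    using subword_count_eq_0[of j "Suc n" "map (skip_at j) w"] that by (auto simp: skip_at_def)
  ultimately have "(-1) ^ j * subword_count (Suc n) (j # map (skip_at j) w) =
      (if j = 0 then subword_count n w else (0::'a))" if "j \<le> n" for j
    using that by simp
  then have "desuspension n (subword_count (Suc n)) w = (\<Sum>j\<le>n. if j = 0 then subword_count n w else (0::'a))"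
    unfolding desuspension_def by (intro sum.cong) auto
  then show ?thesis by simp
qed

lemma alternation_subword_count: "alternation n (subword_count n) = 1"
proof (induction n)
  case (Suc n)
  have "alternation n (desuspension n (subword_count (Suc n))) =
      alternation n (subword_count n :: _ \<Rightarrow> 'a)"
    by (rule alternation_cong) (rule desuspension_subword_count)
  then show ?case by (simp only: alternation.simps Suc)
qed simp

lemma sum_alternating: "(\<Sum>i\<le>n. (-1) ^ i) = (if even n then 1 else 0 :: 'k::comm_ring_1)"
  by (induction n) auto

text \<open>
  The desuspension of \<open>a\<close> is a cocycle of lower degree, so the induction hypothesis applies to it. By
  \<open>homotopy_identity\<close>, \<open>a\<close> is cohomologous to the sum of the suspension of this desuspension and of the constant \<open>a []\<close>. The constant is a
  coboundary: its coboundary is an alternating sum of equal terms, so that the cocycle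
  condition kills it in odd degrees, and in even degrees it is its own primitive.
\<close>

lemma word_cocycle_decomp:
  assumes "\<And>w. set w \<subseteq> {..<Suc n} \<Longrightarrow> word_coboundary n a w = 0"
  shows "\<exists>b. \<forall>w. set w \<subseteq> {..<n} \<longrightarrow> a w = alternation n a * subword_count n w +
    (case n of 0 \<Rightarrow> 0 | Suc m \<Rightarrow> word_coboundary m b w)"
  using assms
proof (induction n arbitrary: a)
  case 0
  show ?case by (auto simp: lessThan_def)
next
  case (Suc n)
  let ?e = "desuspension n a"
  have "word_coboundary n ?e w = 0" if "set w \<subseteq> {..<Suc n}" for w
  proof -
    have "desuspension (Suc n) (word_coboundary (Suc n) a) w = desuspension (Suc n) (\<lambda>_. 0) w"
      using that by (intro desuspension_cong Suc.prems)
    then show ?thesis using desuspension_coboundary[OF that, of a] by (simp add: desuspension_def)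
  qed
  from Suc.IH[OF this] obtain b where b: "\<And>w. set w \<subseteq> {..<n} \<Longrightarrow> ?e w =
      alternation n ?e * subword_count n w + (case n of 0 \<Rightarrow> 0 | Suc m \<Rightarrow> word_coboundary m b w)"
    by blast
  (* a primitive for the homotopy term, for the constant and for the suspended coboundary *)
  define b' where "b' = (\<lambda>w. homotopy n a w + a [] + (case n of 0 \<Rightarrow> 0 | Suc m \<Rightarrow> - suspension b w))"
  have "a w = alternation (Suc n) a * subword_count (Suc n) w + word_coboundary n b' w"
    if w: "set w \<subseteq> {..<Suc n}" for w
  proof -
    have h0: "homotopy (Suc n) (word_coboundary (Suc n) a) w = 0"
      using w
    proof (induction w)
      case (Cons c w)
      have "word_coboundary (Suc n) a (j # map (skip_at j) w) = 0" if "j \<in> {c<..Suc n}" for j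
        using that Cons.prems by (intro Suc.prems) (auto simp: skip_at_def)
      then show ?case using Cons by simp
    qed simp
    have const: "word_coboundary n (\<lambda>_. a []) w = a []"
    proof -
      have "(\<Sum>i\<le>Suc (Suc n). (-1) ^ i) * a [] = 0"
        using Suc.prems[of "[]"] unfolding word_coboundary_def sum_distrib_right by simp
      then have "(\<Sum>i\<le>Suc n. (-1) ^ i) * a [] = a []"
        unfolding sum_alternating by (auto split: if_splits)
      then show ?thesis unfolding word_coboundary_def sum_distrib_right .
    qed
    have s: "suspension ?e w = alternation (Suc n) a * subword_count (Suc n) w +
      word_coboundary n (\<lambda>w. case n of 0 \<Rightarrow> 0 | Suc m \<Rightarrow> - suspension b w) w"
    proof -
      have "suspension ?e w = suspension (\<lambda>w. (case n of 0 \<Rightarrow> 0 | Suc m \<Rightarrow> word_coboundary m b w) +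
          alternation n ?e * subword_count n w) w"
        using b by (intro suspension_cong[OF _ w]) (simp add: add.commute)
      also have "\<dots> = suspension (\<lambda>w. case n of 0 \<Rightarrow> 0 | Suc m \<Rightarrow> word_coboundary m b w) w +
          alternation (Suc n) a * subword_count (Suc n) w"
        by (simp add: suspension_linear)
      also have "suspension (\<lambda>w. case n of 0 \<Rightarrow> 0 | Suc m \<Rightarrow> word_coboundary m b w) w =
        word_coboundary n (\<lambda>w. case n of 0 \<Rightarrow> 0 | Suc m \<Rightarrow> - suspension b w) w"
      proof (cases n)
        case 0
        have "suspension (\<lambda>w. 0) w = (0::'a)" by (induction w) auto
        then show ?thesis by (simp add: 0 word_coboundary_def)
      next
        case (Suc m)
        have "word_coboundary (Suc m) (\<lambda>w. - suspension b w) w = - word_coboundary (Suc m) (suspension b) w"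
          by (simp add: word_coboundary_def sum_negf)
        then show ?thesis using w by (simp add: Suc word_coboundary_suspension)
      qed
      finally show ?thesis by simp
    qed
    have "word_coboundary n b' w = word_coboundary n (homotopy n a) w + word_coboundary n (\<lambda>_. a []) w +
      word_coboundary n (\<lambda>w. case n of 0 \<Rightarrow> 0 | Suc m \<Rightarrow> - suspension b w) w"
      by (simp add: b'_def word_coboundary_def sum.distrib distrib_left)
    then show ?thesis
      using homotopy_identity[OF w, of a] h0 const s by (simp add: algebra_simps)
  qed
  then show ?case by auto
qed

section \<open>Cup products of word functions\<close>

text \<open>
  The front part consists of the letters below \<open>p\<close>; the back part is relabelled to start at \<open>0\<close>.
\<close>

definition word_cup :: "nat \<Rightarrow> (nat list \<Rightarrow> 'k::comm_ring_1) \<Rightarrow> (nat list \<Rightarrow> 'k) \<Rightarrow> nat list \<Rightarrow> 'k"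
  where "word_cup p a b w = a (filter (\<lambda>c. c < p) w) * b (map (\<lambda>c. c - p) (filter (\<lambda>c. p \<le> c) w))"

text \<open>
  The sum of the signs of all \<open>(p, q)\<close>-shuffles. The two terms of the recursion correspond to the shuffles
  that begin with the first letter of the front part and with that of the back part; the
  latter has to pass all letters of the front part.
\<close>

fun signed_shuffles :: "nat \<Rightarrow> nat \<Rightarrow> int" where
  "signed_shuffles p 0 = 1"
| "signed_shuffles 0 (Suc q) = 1"
| "signed_shuffles (Suc p) (Suc q) =
    signed_shuffles p (Suc q) + (-1) ^ Suc p * signed_shuffles (Suc p) q"

lemma signed_shuffles_0 [simp]: "signed_shuffles 0 q = 1"
  by (cases q) auto

lemma signed_shuffles_eq:
  "signed_shuffles p q =
    (if odd p \<and> odd q then 0 else int ((p div 2 + q div 2) choose (p div 2)))"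
proof (induction p q rule: signed_shuffles.induct)
  case (3 p q)
  consider (ee) a b where "p = 2 * a" "q = 2 * b" | (eo) a b where "p = 2 * a" "q = Suc (2 * b)"
    | (oe) a b where "p = Suc (2 * a)" "q = 2 * b" | (oo) a b where "p = Suc (2 * a)" "q = Suc (2 * b)"
    by (metis oddE evenE Suc_eq_plus1)
  then show ?case
  proof cases
    case oo
    then show ?thesis using 3 by (simp add: add.commute)
  qed (use 3 in auto)
qed auto

lemma alternation_add: "alternation n (\<lambda>w. a w + b w) = alternation n a + alternation n b"
  using alternation_linear[of n a 1 b] by simp

lemma alternation_scale: "alternation n (\<lambda>w. c * a w) = c * alternation n a"
proof -
  have "alternation n (\<lambda>w. 0 :: 'a) = 0"
    using alternation_linear[of n "\<lambda>w. 0" "-1" "\<lambda>w. 0 :: 'a"] by simp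
  then show ?thesis using alternation_linear[of n "\<lambda>w. 0" c a] by simp
qed

lemma atMost_add_Suc: "{..(p :: nat) + Suc q} = {..p} \<union> (\<lambda>i. p + Suc i) ` {..q}"
proof (rule Set.set_eqI)
  fix x
  show "x \<in> {..p + Suc q} \<longleftrightarrow> x \<in> {..p} \<union> (\<lambda>i. p + Suc i) ` {..q}"
  proof (cases "x \<le> p")
    case False
    then obtain d where "x = p + Suc d" using less_imp_Suc_add[of p x] by auto
    then show ?thesis by auto
  qed auto
qed

text \<open>
  A first letter \<open>j \<le> p\<close> goes into the front factor, a first letter \<open>Suc p + j\<close> into the back factor,
  where it becomes \<open>j\<close>; this accounts for the sign.
\<close>

lemma desuspension_word_cup:
  "desuspension (p + Suc q) (word_cup (Suc p) a b) w =
    word_cup p (desuspension p a) b w + (-1) ^ Suc p * word_cup (Suc p) a (desuspension q b) w"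
proof -
  let ?f = "\<lambda>j. (-1) ^ j * word_cup (Suc p) a b (j # map (skip_at j) w)"
  have lo: "?f j = (-1) ^ j * a (j # map (skip_at j) (filter (\<lambda>c. c < p) w)) *
      b (map (\<lambda>c. c - p) (filter (\<lambda>c. p \<le> c) w))" if "j \<le> p" for j
  proof -
    have "map id (filter (\<lambda>c. c < Suc p) (map (skip_at j) w)) =
        map id (map (skip_at j) (filter (\<lambda>c. c < p) w))"
      by (rule map_filter_cong) (use that in \<open>auto simp: skip_at_def\<close>)
    moreover have "map (\<lambda>c. c - Suc p) (filter (\<lambda>c. Suc p \<le> c) (map (skip_at j) w)) =
        map id (map (\<lambda>c. c - p) (filter (\<lambda>c. p \<le> c) w))"
      by (rule map_filter_cong) (use that in \<open>auto simp: skip_at_def\<close>)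
    ultimately show ?thesis using that by (simp add: word_cup_def mult.assoc)
  qed
  have hi: "?f (Suc p + j) = (-1) ^ Suc p * (a (filter (\<lambda>c. c < Suc p) w) *
      ((-1) ^ j * b (j # map (skip_at j) (map (\<lambda>c. c - Suc p) (filter (\<lambda>c. Suc p \<le> c) w)))))" for j
  proof -
    have "map id (filter (\<lambda>c. c < Suc p) (map (skip_at (Suc p + j)) w)) =
        map id (map id (filter (\<lambda>c. c < Suc p) w))"
      by (rule map_filter_cong) (auto simp: skip_at_def)
    moreover have "map (\<lambda>c. c - Suc p) (filter (\<lambda>c. Suc p \<le> c) (map (skip_at (Suc p + j)) w)) =
        map (skip_at j) (map (\<lambda>c. c - Suc p) (filter (\<lambda>c. Suc p \<le> c) w))"
      by (rule map_filter_cong) (auto simp: skip_at_def)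
    ultimately have "word_cup (Suc p) a b ((Suc p + j) # map (skip_at (Suc p + j)) w) =
      a (filter (\<lambda>c. c < Suc p) w) *
      b (j # map (skip_at j) (map (\<lambda>c. c - Suc p) (filter (\<lambda>c. Suc p \<le> c) w)))"
      by (simp add: word_cup_def)
    then show ?thesis unfolding power_add by (simp only: mult_ac)
  qed
  have "desuspension (p + Suc q) (word_cup (Suc p) a b) w =
      (\<Sum>j\<in>{..p} \<union> (\<lambda>j. p + Suc j) ` {..q}. ?f j)"
    unfolding desuspension_def atMost_add_Suc[symmetric] ..
  also have "\<dots> = (\<Sum>j\<le>p. ?f j) + (\<Sum>j\<le>q. ?f (Suc p + j))"
    by (subst sum.union_disjoint) (auto simp: sum.reindex o_def inj_on_def)
  also have "(\<Sum>j\<le>p. ?f j) = word_cup p (desuspension p a) b w"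
    unfolding word_cup_def[of p] desuspension_def sum_distrib_right
    by (intro sum.cong refl lo) simp
  also have "(\<Sum>j\<le>q. ?f (Suc p + j)) = (-1) ^ Suc p * word_cup (Suc p) a (desuspension q b) w"
    unfolding word_cup_def[of _ _ _ w] desuspension_def sum_distrib_left by (intro sum.cong refl hi)
  finally show ?thesis .
qed

text \<open>
  Both sides obey the recursion of \<open>signed_shuffles\<close>: on the left this is the graded Leibniz rule for
  \<open>desuspension\<close>.
\<close>

lemma alternation_word_cup:
  "alternation (p + q) (word_cup p a b) =
    of_int (signed_shuffles p q) * (alternation p a * alternation q b)"
proof (induction p q arbitrary: a b rule: signed_shuffles.induct)
  case (1 p)
  have "word_cup p a b w = b [] * a w" if "set w \<subseteq> {..<p}" for w
  proof -
    have "filter (\<lambda>c. c < p) w = w" "filter (\<lambda>c. p \<le> c) w = []"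
      using that by (auto simp: filter_id_conv filter_empty_conv)
    then show ?thesis by (simp add: word_cup_def mult.commute)
  qed
  then have "alternation p (word_cup p a b) = alternation p (\<lambda>w. b [] * a w)"
    by (rule alternation_cong)
  then show ?case by (simp only: alternation_scale) (simp add: mult.commute)
next
  case (2 q)
  have "alternation (Suc q) (word_cup 0 a b) = alternation (Suc q) (\<lambda>w. a [] * b w)"
    by (rule alternation_cong) (simp add: word_cup_def)
  then show ?case by (simp only: alternation_scale) simp
next
  case (3 p q)
  have "alternation (Suc p + Suc q) (word_cup (Suc p) a b) =
      alternation (p + Suc q) (\<lambda>w. word_cup p (desuspension p a) b w +
        (-1) ^ Suc p * word_cup (Suc p) a (desuspension q b) w)"
    unfolding add_Suc alternation.simps by (rule alternation_cong) (rule desuspension_word_cup)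
  also have "\<dots> = alternation (p + Suc q) (word_cup p (desuspension p a) b) +
      (-1) ^ Suc p * alternation (Suc p + q) (word_cup (Suc p) a (desuspension q b))"
    unfolding alternation_add alternation_scale by simp
  also have "\<dots> = of_int (signed_shuffles (Suc p) (Suc q)) * (alternation (Suc p) a * alternation (Suc q) b)"
    unfolding 3 by (simp add: algebra_simps)
  finally show ?case .
qed

text \<open>
  The last face of the front part and the first face of the back part both delete the letter
  \<open>p\<close>, and they cancel.
\<close>

lemma word_coboundary_word_cup:
  assumes w: "set w \<subseteq> {..<Suc (p + q)}"
  shows "word_coboundary (p + q) (word_cup p a b) w =
    word_cup (Suc p) (word_coboundary p a) b w + (-1) ^ p * word_cup p a (word_coboundary q b) w"
proof -
  let ?N = "Suc (p + q)"
  let ?f = "\<lambda>i. (-1) ^ i * word_cup p a b (word_face ?N i w)"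
  let ?sh = "\<lambda>p. map (\<lambda>c. c - p) (filter (\<lambda>c. p \<le> c) w)"
  let ?lo = "\<lambda>p. filter (\<lambda>c. c < p) w"
  have lo: "?f i = (-1) ^ i * a (word_face (Suc p) i (?lo (Suc p))) * b (?sh (Suc p))" if "i \<le> p" for i
  proof -
    have "filter (\<lambda>c. c < p) (word_face ?N i w) = word_face (Suc p) i (?lo (Suc p))"
      using that by (induction w) (auto simp: word_face_Cons survives_def merge_at_def split: if_splits)
    moreover have "map (\<lambda>c. c - p) (filter (\<lambda>c. p \<le> c) (word_face ?N i w)) = ?sh (Suc p)"
      using w that by (induction w) (auto simp: word_face_Cons survives_def merge_at_def split: if_splits)
    ultimately show ?thesis by (simp add: word_cup_def mult.assoc)
  qed
  have hi: "?f (p + i) = (-1) ^ p * (a (?lo p) * ((-1) ^ i * b (word_face (Suc q) i (?sh p))))"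
    if "i \<noteq> 0" "i \<le> Suc q" for i
  proof -
    have "filter (\<lambda>c. c < p) (word_face ?N (p + i) w) = ?lo p"
      using w that by (induction w) (auto simp: word_face_Cons survives_def merge_at_def split: if_splits)
    moreover have "map (\<lambda>c. c - p) (filter (\<lambda>c. p \<le> c) (word_face ?N (p + i) w)) = word_face (Suc q) i (?sh p)"
      using w that by (induction w) (auto simp: word_face_Cons survives_def merge_at_def split: if_splits)
    ultimately show ?thesis by (simp add: word_cup_def power_add mult_ac)
  qed
  have mid: "word_face (Suc p) (Suc p) (?lo (Suc p)) = ?lo p"
    using w by (induction w) (auto simp: word_face_Cons survives_def merge_at_def split: if_splits)
  have mid': "word_face (Suc q) 0 (?sh p) = ?sh (Suc p)"
    using w by (induction w) (auto simp: word_face_Cons survives_def merge_at_def split: if_splits)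
  have "word_coboundary (p + q) (word_cup p a b) w =
      (\<Sum>i\<in>{..p} \<union> (\<lambda>i. p + Suc i) ` {..q}. ?f i)"
    unfolding word_coboundary_def atMost_add_Suc[symmetric] by simp
  also have "\<dots> = (\<Sum>i\<le>p. ?f i) + (\<Sum>i\<le>q. ?f (p + Suc i))"
    by (subst sum.union_disjoint) (auto simp: sum.reindex o_def inj_on_def)
  also have "(\<Sum>i\<le>p. ?f i) = word_cup (Suc p) (word_coboundary p a) b w - (-1) ^ Suc p * (a (?lo p) * b (?sh (Suc p)))"
  proof -
    have "(\<Sum>i\<le>p. ?f i) = (\<Sum>i\<le>p. (-1) ^ i * a (word_face (Suc p) i (?lo (Suc p)))) * b (?sh (Suc p))"
      unfolding sum_distrib_right by (intro sum.cong refl lo) simp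
    then show ?thesis by (simp add: word_cup_def word_coboundary_def mid algebra_simps)
  qed
  also have "(\<Sum>i\<le>q. ?f (p + Suc i)) =
      (-1) ^ p * (word_cup p a (word_coboundary q b) w - a (?lo p) * b (?sh (Suc p)))"
  proof -
    have "(\<Sum>i\<le>q. ?f (p + Suc i)) =
        (\<Sum>i\<le>q. (-1) ^ p * (a (?lo p) * ((-1) ^ Suc i * b (word_face (Suc q) (Suc i) (?sh p)))))"
      by (intro sum.cong refl hi) auto
    also have "\<dots> = (-1) ^ p * (a (?lo p) * (word_coboundary q b (?sh p) - b (word_face (Suc q) 0 (?sh p))))"
      unfolding word_coboundary_def sum_distrib_left[symmetric] sum.atMost_Suc_shift[of _ q] by simp
    finally show ?thesis unfolding mid' by (simp add: word_cup_def right_diff_distrib)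
  qed
  finally show ?thesis by (simp add: algebra_simps)
qed

section \<open>Linear functionals on free modules\<close>

abbreviation (input) single :: "'b \<Rightarrow> 'k::zero \<Rightarrow> ('b \<Rightarrow>\<^sub>0 'k)"
  where "single \<equiv> Poly_Mapping.single"

lemma keys_scale_fm: "keys (scale_fm c v) \<subseteq> keys v"
  by (auto simp: in_keys_iff lookup_scale_fm)

lemma lin_ext_eq_sum:
  assumes "finite A" "keys v \<subseteq> A" "A \<subseteq> B"
  shows "lin_ext B \<phi> v = (\<Sum>z\<in>A. lookup v z * \<phi> z)"
proof -
  have "(\<Sum>z\<in>keys v. lookup v z * \<phi> z) = (\<Sum>z\<in>A. lookup v z * \<phi> z)"
    using assms by (intro sum.mono_neutral_left) (auto simp: in_keys_iff)
  then show ?thesis using assms by (auto simp: lin_ext_def)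
qed

lemma lin_ext_in_functionals: "lin_ext B \<phi> \<in> functionals B"
proof -
  have "lin_ext B \<phi> (v + w) = lin_ext B \<phi> v + lin_ext B \<phi> w" if "keys v \<subseteq> B" "keys w \<subseteq> B" for v w
  proof -
    have "keys (v + w) \<subseteq> keys v \<union> keys w" by (rule Poly_Mapping.keys_add)
    then show ?thesis using that
      by (simp add: lin_ext_eq_sum[of "keys v \<union> keys w"] lookup_add distrib_right sum.distrib)
  qed
  moreover have "lin_ext B \<phi> (scale_fm c v) = c * lin_ext B \<phi> v" if "keys v \<subseteq> B" for c v
    using that keys_scale_fm[of c v]
    by (simp add: lin_ext_eq_sum[of "keys v"] lookup_scale_fm sum_distrib_left mult.assoc)
  ultimately show ?thesis by (auto simp: functionals_def lin_ext_def[of B \<phi>])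
qed

lemma lin_ext_single: "z \<in> B \<Longrightarrow> lin_ext B \<phi> (single z 1) = (\<phi> z :: 'k::comm_ring_1)"
  by (simp add: lin_ext_def)

lemma lin_ext_cong: "(\<And>z. z \<in> B \<Longrightarrow> \<phi> z = \<psi> z) \<Longrightarrow> lin_ext B \<phi> = lin_ext B \<psi>"
  by (rule ext) (auto simp: lin_ext_def intro!: sum.cong)

lemma lin_ext_linear: "lin_ext B (\<lambda>z. \<phi> z + c * \<psi> z) v = lin_ext B \<phi> v + c * lin_ext B \<psi> v"
  by (simp add: lin_ext_def sum.distrib sum_distrib_left algebra_simps)

lemma lin_ext_zero: "lin_ext B (\<lambda>z. 0) = (\<lambda>v. 0)"
  by (simp add: lin_ext_def fun_eq_iff)

lemma lin_ext_sum:
  "finite A \<Longrightarrow> lin_ext B (\<lambda>z. \<Sum>i\<in>A. c i * \<phi> i z) v = (\<Sum>i\<in>A. c i * lin_ext B (\<phi> i) v)"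
proof (induction A rule: finite_induct)
  case (insert x F)
  then have "lin_ext B (\<lambda>z. \<Sum>i\<in>insert x F. c i * \<phi> i z) v =
      lin_ext B (\<lambda>z. (\<Sum>i\<in>F. c i * \<phi> i z) + c x * \<phi> x z) v"
    by (simp add: add.commute)
  then show ?case unfolding lin_ext_linear using insert by (simp add: add.commute)
qed (simp add: lin_ext_zero)

lemma functionals_add: "f \<in> functionals B \<Longrightarrow> keys v \<subseteq> B \<Longrightarrow> keys w \<subseteq> B \<Longrightarrow> f (v + w) = f v + f w"
  and functionals_scale: "f \<in> functionals B \<Longrightarrow> keys v \<subseteq> B \<Longrightarrow> f (scale_fm c v) = c * f v"
  and functionals_outside: "f \<in> functionals B \<Longrightarrow> \<not> keys v \<subseteq> B \<Longrightarrow> f v = 0"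
  unfolding functionals_def by blast+

lemma functional_sum:
  assumes "f \<in> functionals B" "finite A" "\<And>x. x \<in> A \<Longrightarrow> keys (g x) \<subseteq> B"
  shows "f (sum g A) = (\<Sum>x\<in>A. f (g x))"
  using assms(2,3)
proof (induction A rule: finite_induct)
  case empty
  show ?case using functionals_scale[OF assms(1), of 0 0] by (simp add: fm.scale_zero_right)
next
  case (insert x F)
  have "keys (sum g F) \<subseteq> B" using keys_sum[of g F] insert.prems by fastforce
  then show ?case using insert functionals_add[OF assms(1), of "g x" "sum g F"] by simp
qed

lemma functional_single:
  assumes "f \<in> functionals B" "z \<in> B"
  shows "f (single z c) = c * f (single z 1)"
proof -
  have "scale_fm c (single z 1) = single z c"
    by (rule poly_mapping_eqI) (simp add: lookup_scale_fm lookup_single when_def)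
  moreover have "f (scale_fm c (single z 1)) = c * f (single z 1)"
    by (rule functionals_scale[OF assms(1)]) (use assms(2) in simp)
  ultimately show ?thesis by simp
qed

text \<open>
  A functional pulled back along a map of bases, in coordinates; restrictions and relabellings of
  species act through such maps.
\<close>

lemma functional_push_fm:
  assumes "f \<in> functionals B" "\<psi> ` A \<subseteq> B" "keys v \<subseteq> A"
  shows "f (push_fm \<psi> v) = lin_ext A (\<lambda>z. f (single (\<psi> z) 1)) v"
proof -
  have B: "\<psi> z \<in> B" if "z \<in> keys v" for z using assms that by auto
  have "f (push_fm \<psi> v) = (\<Sum>z\<in>keys v. f (single (\<psi> z) (lookup v z)))"
    unfolding push_fm_def using B by (intro functional_sum[OF assms(1)]) auto
  also have "\<dots> = (\<Sum>z\<in>keys v. lookup v z * f (single (\<psi> z) 1))"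
    using B by (intro sum.cong refl functional_single[OF assms(1)]) auto
  finally show ?thesis using assms(3) by (simp add: lin_ext_def)
qed

lemma push_fm_id: "push_fm (\<lambda>z. z) v = v"
  by (rule poly_mapping_eqI)
    (simp add: push_fm_def lookup_sum lookup_single when_def in_keys_iff)

lemma functional_eq_lin_ext:
  assumes "f \<in> functionals B"
  shows "f = lin_ext B (\<lambda>z. f (single z 1))"
proof
  fix v
  show "f v = lin_ext B (\<lambda>z. f (single z 1)) v"
    using functional_push_fm[OF assms, of "\<lambda>z. z" B v] assms
    by (cases "keys v \<subseteq> B") (auto simp: push_fm_id lin_ext_def functionals_outside)
qed

lemma functionals_eqI:
  assumes "f \<in> functionals B" "g \<in> functionals B"
    and "\<And>z. z \<in> B \<Longrightarrow> f (single z 1) = g (single z 1)"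
  shows "f = g"
  using functional_eq_lin_ext[OF assms(1)] functional_eq_lin_ext[OF assms(2)]
    lin_ext_cong[of B, OF assms(3)] by simp

lemma push_fm_single: "push_fm \<psi> (single z (1 :: 'k::comm_ring_1)) = single (\<psi> z) 1"
  by (simp add: push_fm_def)

section \<open>Cochains of linear orders as functions on words\<close>

lemma linear_orders_simps [simp]:
  "sp_basis linear_orders = permutations_of_set" "sp_map linear_orders = map"
  "sp_restr linear_orders S = filter (\<lambda>s. s \<in> S)"
  by (simp_all add: linear_orders_def)

abbreviation (input) orders :: "nat set list \<Rightarrow> nat list set"
  where "orders F \<equiv> permutations_of_set (\<Union>(set F))"

text \<open>
  For a decomposition \<open>F\<close> this is the index of the block that contains \<open>s\<close>, so
  \<open>map (position F) z\<close> is the word of the order \<open>z\<close>.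
\<close>

definition position :: "nat set list \<Rightarrow> nat \<Rightarrow> nat"
  where "position F s = (THE i. i < length F \<and> s \<in> F ! i)"

definition cochain_of :: "nat \<Rightarrow> (nat list \<Rightarrow> 'k::comm_ring_1) \<Rightarrow> nat set list \<Rightarrow> (nat list \<Rightarrow>\<^sub>0 'k) \<Rightarrow> 'k"
  where "cochain_of n a F = (if F \<in> decompositions n
    then lin_ext (orders F) (\<lambda>z. a (map (position F) z)) else 0)"

definition blocks :: "nat \<Rightarrow> nat list \<Rightarrow> nat set list"
  where "blocks n w = map (\<lambda>i. {k. k < length w \<and> w ! k = i}) [0..<n]"

text \<open>
  The inverse of \<open>cochain_of\<close>: evaluation at the standard order, for the decomposition that has
  \<open>w\<close> as its word.
\<close>

definition word_function :: "nat \<Rightarrow> (nat set list \<Rightarrow> (nat list \<Rightarrow>\<^sub>0 'k::comm_ring_1) \<Rightarrow> 'k) \<Rightarrow> nat list \<Rightarrow> 'k"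
  where "word_function n \<alpha> w = \<alpha> (blocks n w) (single [0..<length w] 1)"

lemma decompositionsD:
  assumes "F \<in> decompositions n"
  shows "length F = n" "finite (\<Union>(set F))" "i < n \<Longrightarrow> j < n \<Longrightarrow> s \<in> F ! i \<Longrightarrow> s \<in> F ! j \<Longrightarrow> i = j"
  using assms by (auto simp: decompositions_def)

lemma position_eq: "F \<in> decompositions n \<Longrightarrow> i < n \<Longrightarrow> s \<in> F ! i \<Longrightarrow> position F s = i"
  unfolding position_def by (rule the_equality) (auto dest: decompositionsD)

lemma position_less:
  assumes "F \<in> decompositions n" "s \<in> \<Union>(set F)"
  shows "position F s < n" "s \<in> F ! position F s"
proof -
  from assms obtain i where "i < n" "s \<in> F ! i"
    using decompositionsD(1)[OF assms(1)] by (auto simp: in_set_conv_nth)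
  then show "position F s < n" "s \<in> F ! position F s"
    using position_eq[OF assms(1)] by auto
qed

lemma set_map_position:
  "F \<in> decompositions n \<Longrightarrow> set z \<subseteq> \<Union>(set F) \<Longrightarrow> set (map (position F) z) \<subseteq> {..<n}"
  using position_less(1) by fastforce

lemma Union_blocks: "set w \<subseteq> {..<n} \<Longrightarrow> \<Union>(set (blocks n w)) = {..<length w}"
  by (force simp: blocks_def)

lemma blocks_decomposition: "set w \<subseteq> {..<n} \<Longrightarrow> blocks n w \<in> decompositions n"
  unfolding decompositions_def using Union_blocks[of w n] by (auto simp: blocks_def)

lemma map_position_blocks:
  assumes "set w \<subseteq> {..<n}"
  shows "map (position (blocks n w)) [0..<length w] = w"
proof (rule nth_equalityI)
  fix k assume "k < length (map (position (blocks n w)) [0..<length w])"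
  then have k: "k < length w" by simp
  then have "w ! k < n" using assms nth_mem by blast
  then have "position (blocks n w) k = w ! k"
    using k by (intro position_eq[OF blocks_decomposition[OF assms]]) (auto simp: blocks_def)
  then show "map (position (blocks n w)) [0..<length w] ! k = w ! k" using k by simp
qed simp

lemma set_in_permutations: "z \<in> permutations_of_set A \<Longrightarrow> set z = A"
  by (simp add: permutations_of_set_def)

lemma map_image_decomposition:
  assumes F: "F \<in> decompositions n" and inj: "inj_on \<sigma> (\<Union>(set F))"
  shows "map ((`) \<sigma>) F \<in> decompositions n" "\<And>s. s \<in> \<Union>(set F) \<Longrightarrow> position (map ((`) \<sigma>) F) (\<sigma> s) = position F s"
proof -
  have sub: "F ! i \<subseteq> \<Union>(set F)" if "i < n" for i
    using that decompositionsD(1)[OF F] by force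
  show *: "map ((`) \<sigma>) F \<in> decompositions n"
    unfolding decompositions_def
  proof (intro CollectI conjI allI impI)
    show "length (map ((`) \<sigma>) F) = n" using decompositionsD(1)[OF F] by simp
    have "\<Union>(set (map ((`) \<sigma>) F)) = \<sigma> ` \<Union>(set F)" by auto
    then show "finite (\<Union>(set (map ((`) \<sigma>) F)))" using decompositionsD(2)[OF F] by simp
    fix i j assume "i < n" "j < n" "i \<noteq> j"
    moreover then have "F ! i \<inter> F ! j = {}" using F by (auto simp: decompositions_def)
    ultimately show "map ((`) \<sigma>) F ! i \<inter> map ((`) \<sigma>) F ! j = {}"
      using inj_on_image_Int[OF inj sub[of i] sub[of j]] decompositionsD(1)[OF F] by simp
  qed
  fix s assume "s \<in> \<Union>(set F)"
  then show "position (map ((`) \<sigma>) F) (\<sigma> s) = position F s"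
    using position_less[OF F] decompositionsD(1)[OF F] by (intro position_eq[OF *]) auto
qed

lemma cochain_of_in_cochains: "cochain_of n a \<in> cochains linear_orders n"
  unfolding cochains_def
proof (intro CollectI conjI ballI allI impI)
  fix F assume F: "F \<in> decompositions n"
  show "cochain_of n a F \<in> functionals (sp_basis linear_orders (\<Union>(set F)))"
    using F by (simp add: cochain_of_def lin_ext_in_functionals)
  fix \<sigma> :: "nat \<Rightarrow> nat" and v :: "nat list \<Rightarrow>\<^sub>0 'a"
  assume inj: "inj_on \<sigma> (\<Union>(set F))" and v: "keys v \<subseteq> sp_basis linear_orders (\<Union>(set F))"
  let ?F = "map ((`) \<sigma>) F"
  have U: "\<Union>(set ?F) = \<sigma> ` \<Union>(set F)" by auto
  have im: "map \<sigma> ` orders F \<subseteq> permutations_of_set (\<Union>(set ?F))"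
    using inj unfolding U by (intro image_subsetI) (simp add: permutations_of_set_def distinct_map)
  have "cochain_of n a ?F (push_fm (map \<sigma>) v) =
      lin_ext (orders F) (\<lambda>z. cochain_of n a ?F (single (map \<sigma> z) 1)) v"
    using v im by (intro functional_push_fm[of _ "permutations_of_set (\<Union>(set ?F))"])
      (auto simp: cochain_of_def map_image_decomposition[OF F inj] lin_ext_in_functionals)
  also have "lin_ext (orders F) (\<lambda>z. cochain_of n a ?F (single (map \<sigma> z) 1)) =
      cochain_of n a F"
    unfolding cochain_of_def if_P[OF F] if_P[OF map_image_decomposition(1)[OF F inj]]
  proof (rule lin_ext_cong)
    fix z assume z: "z \<in> orders F"
    have "map (position ?F) (map \<sigma> z) = map (position F) z"
      using set_in_permutations[OF z] map_image_decomposition(2)[OF F inj] by auto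
    then show "lin_ext (permutations_of_set (\<Union>(set ?F))) (\<lambda>z. a (map (position ?F) z))
        (single (map \<sigma> z) 1) = a (map (position F) z)"
      using im z lin_ext_single[of "map \<sigma> z"] by (metis image_subset_iff)
  qed
  finally show "cochain_of n a ?F (push_fm (sp_map linear_orders \<sigma>) v) = cochain_of n a F v" by simp
qed (simp add: cochain_of_def)

lemma upt_in_permutations: "[0..<m] \<in> permutations_of_set {..<m}"
  by (auto simp: permutations_of_set_def)

lemma word_function_cochain_of:
  assumes "set w \<subseteq> {..<n}"
  shows "word_function n (cochain_of n a) w = a w"
  using upt_in_permutations[of "length w"]
  by (simp add: word_function_def cochain_of_def blocks_decomposition[OF assms] Union_blocks[OF assms]
    lin_ext_single map_position_blocks[OF assms])

text \<open>
  Every order \<open>z\<close> is the image of the standard order of the same length under \<open>k \<mapsto> z ! k\<close>, and this bijection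
  carries the blocks of the word of \<open>z\<close> to the given decomposition. So naturality determines a
  cochain by its values at standard orders.
\<close>

lemma cochain_of_word_function:
  assumes \<alpha>: "\<alpha> \<in> cochains linear_orders n"
  shows "cochain_of n (word_function n \<alpha>) = \<alpha>"
proof
  fix F
  show "cochain_of n (word_function n \<alpha>) F = \<alpha> F"
  proof (cases "F \<in> decompositions n")
    case False
    then show ?thesis using \<alpha> by (simp add: cochains_def cochain_of_def)
  next
    case F: True
    let ?B = "orders F"
    have func: "\<alpha> F \<in> functionals ?B" using \<alpha> F by (auto simp: cochains_def)
    have "cochain_of n (word_function n \<alpha>) F = lin_ext ?B (\<lambda>z. \<alpha> F (single z 1))"
      unfolding cochain_of_def if_P[OF F]
    proof (rule lin_ext_cong)
      fix z assume z: "z \<in> ?B"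
      let ?w = "map (position F) z" and ?\<sigma> = "(!) z"
      have w: "set ?w \<subseteq> {..<n}"
        using set_in_permutations[OF z] by (intro set_map_position[OF F]) auto
      have inj: "inj_on ?\<sigma> (\<Union>(set (blocks n ?w)))"
        unfolding Union_blocks[OF w] using z
        by (auto simp: permutations_of_set_def intro!: inj_on_nth)
      have "map ((`) ?\<sigma>) (blocks n ?w) = F"
      proof (rule nth_equalityI)
        show "length (map ((`) ?\<sigma>) (blocks n ?w)) = length F"
          using decompositionsD(1)[OF F] by (simp add: blocks_def)
        fix i assume "i < length (map ((`) ?\<sigma>) (blocks n ?w))"
        then have i: "i < n" by (simp add: blocks_def)
        have "?\<sigma> ` {k. k < length z \<and> position F (z ! k) = i} = {s \<in> set z. position F s = i}"
          by (auto simp: in_set_conv_nth)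
        also have "\<dots> = F ! i"
          unfolding set_in_permutations[OF z]
          using position_eq[OF F i] position_less(2)[OF F] i decompositionsD(1)[OF F]
          by (auto intro: nth_mem)
        finally show "map ((`) ?\<sigma>) (blocks n ?w) ! i = F ! i"
          using i by (simp add: blocks_def cong: conj_cong)
      qed
      moreover have "map ?\<sigma> [0..<length z] = z" by (rule map_nth)
      moreover have "\<alpha> (map ((`) ?\<sigma>) (blocks n ?w)) (push_fm (map ?\<sigma>) (single [0..<length z] 1)) =
          \<alpha> (blocks n ?w) (single [0..<length z] 1)"
        using \<alpha> blocks_decomposition[OF w] inj upt_in_permutations[of "length z"]
        unfolding cochains_def by (auto simp: Union_blocks[OF w])
      ultimately show "word_function n \<alpha> ?w = \<alpha> F (single z 1)"
        by (simp add: word_function_def push_fm_single)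
    qed
    then show ?thesis using functional_eq_lin_ext[OF func] by simp
  qed
qed

lemma cochain_of_cong:
  assumes "\<And>w. set w \<subseteq> {..<n} \<Longrightarrow> a w = b w"
  shows "cochain_of n a = cochain_of n b"
proof
  fix F
  show "cochain_of n a F = cochain_of n b F"
  proof (cases "F \<in> decompositions n")
    case True
    then have "set (map (position F) z) \<subseteq> {..<n}" if "z \<in> orders F" for z
      using that by (intro set_map_position) (auto dest: set_in_permutations)
    then show ?thesis unfolding cochain_of_def if_P[OF True]
      by (intro lin_ext_cong assms)
  qed (simp add: cochain_of_def)
qed

lemma cochain_of_linear:
  "cochain_of n (\<lambda>w. a w + c * b w) F v = cochain_of n a F v + c * cochain_of n b F v"
  by (simp add: cochain_of_def lin_ext_linear)

text \<open>
  All three kinds of cofaces replace \<open>F\<close> by a list of blocks \<open>G\<close> of the following form: block \<open>k\<close> of \<open>G\<close> is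
  the union of the blocks of \<open>F\<close> whose index survives and is sent to \<open>k\<close>. This treats the
  cofaces uniformly.
\<close>

lemma face_decomposition:
  assumes F: "F \<in> decompositions (Suc n)" and len: "length G = n" and i: "i \<le> Suc n"
    and G: "\<forall>k<n. G ! k = (\<Union>c\<in>{c. c < Suc n \<and> survives (Suc n) i c \<and> merge_at i c = k}. F ! c)"
  shows "G \<in> decompositions n"
    and "\<Union>(set G) = {s \<in> \<Union>(set F). survives (Suc n) i (position F s)}"
    and "s \<in> \<Union>(set G) \<Longrightarrow> position G s = merge_at i (position F s)"
proof -
  have lt: "merge_at i c < n" if "c < Suc n" "survives (Suc n) i c" for c
    using that i by (auto simp: merge_at_def survives_def split: if_splits)
  have mem: "s \<in> G ! k \<longleftrightarrow> s \<in> \<Union>(set F) \<and> survives (Suc n) i (position F s) \<and> merge_at i (position F s) = k"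
    if "k < n" for k s
    unfolding G[rule_format, OF that] using position_eq[OF F] position_less[OF F] decompositionsD(1)[OF F] by fastforce
  show U: "\<Union>(set G) = {s \<in> \<Union>(set F). survives (Suc n) i (position F s)}"
  proof (rule Set.set_eqI)
    fix s
    have "s \<in> \<Union>(set G) \<longleftrightarrow> (\<exists>k<n. s \<in> G ! k)"
      using len by (metis UnionE UnionI in_set_conv_nth)
    also have "\<dots> \<longleftrightarrow> s \<in> \<Union>(set F) \<and> survives (Suc n) i (position F s)"
      using mem lt position_less(1)[OF F] by metis
    finally show "s \<in> \<Union>(set G) \<longleftrightarrow> s \<in> {s \<in> \<Union>(set F). survives (Suc n) i (position F s)}" by simp
  qed
  show D: "G \<in> decompositions n"
    unfolding decompositions_def
  proof (intro CollectI conjI allI impI)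
    show "finite (\<Union>(set G))"
      unfolding U by (rule finite_subset[OF _ decompositionsD(2)[OF F]]) auto
    show "\<And>k l. k < n \<Longrightarrow> l < n \<Longrightarrow> k \<noteq> l \<Longrightarrow> G ! k \<inter> G ! l = {}" by (auto simp: mem)
  qed (rule len)
  assume "s \<in> \<Union>(set G)"
  then show "position G s = merge_at i (position F s)"
    unfolding U using lt position_less(1)[OF F] by (intro position_eq[OF D]) (auto simp: mem)
qed

lemma word_face_position:
  assumes F: "F \<in> decompositions (Suc n)" and len: "length G = n" and i: "i \<le> Suc n"
    and G: "\<forall>k<n. G ! k = (\<Union>c\<in>{c. c < Suc n \<and> survives (Suc n) i c \<and> merge_at i c = k}. F ! c)"
    and z: "set z \<subseteq> \<Union>(set F)"
  shows "map (position G) (filter (\<lambda>s. s \<in> \<Union>(set G)) z) = word_face (Suc n) i (map (position F) z)"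
proof -
  note fd = face_decomposition[OF F len i G]
  have "filter (\<lambda>s. s \<in> \<Union>(set G)) z = filter (\<lambda>s. survives (Suc n) i (position F s)) z"
    unfolding fd(2) using z by (intro filter_cong) auto
  moreover have "map (position G) (filter (\<lambda>s. s \<in> \<Union>(set G)) z) =
      map (\<lambda>s. merge_at i (position F s)) (filter (\<lambda>s. s \<in> \<Union>(set G)) z)"
    using fd(3) by simp
  ultimately show ?thesis by (simp add: word_face_def filter_map o_def)
qed

lemma tl_decomposition:
  assumes F: "F \<in> decompositions (Suc n)" and "k < n"
  shows "tl F ! k = (\<Union>c\<in>{c. c < Suc n \<and> survives (Suc n) 0 c \<and> merge_at 0 c = k}. F ! c)"
proof -
  have "{c. c < Suc n \<and> survives (Suc n) 0 c \<and> merge_at 0 c = k} = {Suc k}"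
    using assms(2) by (auto simp: survives_def merge_at_def)
  then show ?thesis using assms(2) decompositionsD(1)[OF F] by (simp add: nth_tl)
qed

lemma butlast_decomposition:
  assumes F: "F \<in> decompositions (Suc n)" and "k < n"
  shows "butlast F ! k = (\<Union>c\<in>{c. c < Suc n \<and> survives (Suc n) (Suc n) c \<and> merge_at (Suc n) c = k}. F ! c)"
proof -
  have "{c. c < Suc n \<and> survives (Suc n) (Suc n) c \<and> merge_at (Suc n) c = k} = {k}"
    using assms(2) by (auto simp: survives_def merge_at_def)
  then show ?thesis using assms(2) decompositionsD(1)[OF F] by (simp add: nth_butlast)
qed

lemma merge_decomposition:
  assumes F: "F \<in> decompositions (Suc n)" and "k < n" and i: "i \<noteq> 0" "i \<le> n"
  shows "(take (i - 1) F @ (F ! (i - 1) \<union> F ! i) # drop (i + 1) F) ! k =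
    (\<Union>c\<in>{c. c < Suc n \<and> survives (Suc n) i c \<and> merge_at i c = k}. F ! c)"
proof -
  have "{c. c < Suc n \<and> survives (Suc n) i c \<and> merge_at i c = k} =
      (if k < i - 1 then {k} else if k = i - 1 then {i - 1, i} else {Suc k})"
    using assms(2) i by (auto simp: survives_def merge_at_def)
  moreover have "(take (i - 1) F @ (F ! (i - 1) \<union> F ! i) # drop (i + 1) F) ! k =
      (if k < i - 1 then F ! k else if k = i - 1 then F ! (i - 1) \<union> F ! i else F ! Suc k)"
    using assms(2) i decompositionsD(1)[OF F] by (auto simp: nth_append nth_Cons' Suc_diff_Suc)
  ultimately show ?thesis by auto
qed

lemma Union_tl:
  assumes F: "F \<in> decompositions (Suc n)"
  shows "\<Union>(set F) - hd F = \<Union>(set (tl F))"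
proof -
  obtain A G where AG: "F = A # G" using decompositionsD(1)[OF F] by (cases F) auto
  have "A \<inter> B = {}" if "B \<in> set G" for B
  proof -
    from that obtain i where "i < length G" "B = G ! i" by (auto simp: in_set_conv_nth)
    then show ?thesis using decompositionsD(1)[OF F] decompositionsD(3)[OF F, of 0 "Suc i"] unfolding AG by auto
  qed
  then show ?thesis unfolding AG by auto
qed

lemma Union_butlast:
  assumes F: "F \<in> decompositions (Suc n)"
  shows "\<Union>(set F) - last F = \<Union>(set (butlast F))"
proof -
  have ne: "F \<noteq> []" using decompositionsD(1)[OF F] by auto
  have "last F \<inter> B = {}" if "B \<in> set (butlast F)" for B
  proof -
    from that obtain i where "i < n" "B = F ! i"
      using decompositionsD(1)[OF F] by (auto simp: in_set_conv_nth nth_butlast)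
    then show ?thesis using decompositionsD(1)[OF F] decompositionsD(3)[OF F, of i n] ne by (auto simp: last_conv_nth)
  qed
  moreover have "set F = insert (last F) (set (butlast F))"
    using ne by (metis append_butlast_last_id list.simps(15) rotate1.simps(2) set_rotate1)
  ultimately show ?thesis by auto
qed

lemma filter_in_permutations:
  "z \<in> permutations_of_set A \<Longrightarrow> S \<subseteq> A \<Longrightarrow> filter (\<lambda>s. s \<in> S) z \<in> permutations_of_set S"
  by (auto simp: permutations_of_set_def)

lemma cochain_of_restriction:
  assumes G: "G \<in> decompositions n" "\<Union>(set G) \<subseteq> A" and v: "keys v \<subseteq> permutations_of_set A"
  shows "cochain_of n a G (push_fm (filter (\<lambda>s. s \<in> \<Union>(set G))) v) =
    lin_ext (permutations_of_set A) (\<lambda>z. a (map (position G) (filter (\<lambda>s. s \<in> \<Union>(set G)) z))) v"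
proof -
  have in_perm: "filter (\<lambda>s. s \<in> \<Union>(set G)) z \<in> permutations_of_set (\<Union>(set G))"
    if "z \<in> permutations_of_set A" for z
    using that G(2) by (rule filter_in_permutations)
  have "cochain_of n a G (push_fm (filter (\<lambda>s. s \<in> \<Union>(set G))) v) = lin_ext (permutations_of_set A)
      (\<lambda>z. cochain_of n a G (single (filter (\<lambda>s. s \<in> \<Union>(set G)) z) 1)) v"
    using in_perm v by (intro functional_push_fm[of _ "permutations_of_set (\<Union>(set G))"])
      (auto simp: cochain_of_def G(1) lin_ext_in_functionals simp del: Union_iff)
  also have "lin_ext (permutations_of_set A)
      (\<lambda>z. cochain_of n a G (single (filter (\<lambda>s. s \<in> \<Union>(set G)) z) 1)) =
      lin_ext (permutations_of_set A) (\<lambda>z. a (map (position G) (filter (\<lambda>s. s \<in> \<Union>(set G)) z)))"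
    using in_perm by (intro lin_ext_cong) (simp add: cochain_of_def G(1) lin_ext_single del: Union_iff)
  finally show ?thesis .
qed

text \<open>
  For the outer cofaces \<open>v\<close> is restricted to the union of the remaining blocks; for the inner ones this
  restriction is the identity, which lets both cases go through the same formula.
\<close>

lemma coface_cochain_of:
  assumes F: "F \<in> decompositions (Suc n)" and v: "keys v \<subseteq> orders F"
    and i: "i \<le> Suc n"
  shows "coface linear_orders n i (cochain_of n a) F v =
    lin_ext (orders F) (\<lambda>z. a (word_face (Suc n) i (map (position F) z))) v"
proof -
  define G where "G = (if i = 0 then tl F
    else if i \<le> n then take (i - 1) F @ (F ! (i - 1) \<union> F ! i) # drop (i + 1) F else butlast F)"
  have len: "length G = n" using decompositionsD(1)[OF F] by (auto simp: G_def)
  have nth: "\<forall>k<n. G ! k = (\<Union>c\<in>{c. c < Suc n \<and> survives (Suc n) i c \<and> merge_at i c = k}. F ! c)"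
  proof (intro allI impI)
    fix k assume that: "k < n"
    consider "i = 0" | "i \<noteq> 0" "i \<le> n" | "i = Suc n" using i by linarith
    then show "G ! k = (\<Union>c\<in>{c. c < Suc n \<and> survives (Suc n) i c \<and> merge_at i c = k}. F ! c)"
    proof cases
      case 1
      then show ?thesis using tl_decomposition[OF F that] by (simp add: G_def)
    next
      case 2
      then show ?thesis using merge_decomposition[OF F that 2] by (simp add: G_def)
    next
      case 3
      then show ?thesis using butlast_decomposition[OF F that] by (simp add: G_def)
    qed
  qed
  note G = face_decomposition[OF F len i nth]
  have "coface linear_orders n i (cochain_of n a) F v =
      cochain_of n a G (push_fm (filter (\<lambda>s. s \<in> \<Union>(set G))) v)"
  proof (cases "i = 0 \<or> \<not> i \<le> n")
    case True
    then show ?thesis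
      by (auto simp: coface_def G_def Union_tl[OF F] Union_butlast[OF F] simp del: Union_iff)
  next
    case False
    then have surv: "survives (Suc n) i c" for c by (auto simp: survives_def)
    have U: "\<Union>(set G) = \<Union>(set F)"  unfolding G(2) using surv by blast
    have "push_fm (filter (\<lambda>s. s \<in> \<Union>(set G))) v = push_fm (\<lambda>z. z) v"
      unfolding push_fm_def
    proof (intro sum.cong refl arg_cong2[where f = single])
      fix z assume "z \<in> keys v"
      then have "set z = \<Union>(set G)" unfolding U using v set_in_permutations by blast
      then show "filter (\<lambda>s. s \<in> \<Union>(set G)) z = z" by (simp add: filter_id_conv del: Union_iff)
    qed
    then show ?thesis using False by (simp only: push_fm_id) (simp add: coface_def G_def)
  qed
  also have "\<dots> = lin_ext (orders F)
      (\<lambda>z. a (map (position G) (filter (\<lambda>s. s \<in> \<Union>(set G)) z))) v"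
    using G(1) v by (intro cochain_of_restriction) (auto simp: G(2) simp del: Union_iff)
  also have "lin_ext (orders F)
      (\<lambda>z. a (map (position G) (filter (\<lambda>s. s \<in> \<Union>(set G)) z))) =
    lin_ext (orders F) (\<lambda>z. a (word_face (Suc n) i (map (position F) z)))"
    using word_face_position[OF F len i nth] by (intro lin_ext_cong) (simp add: set_in_permutations del: Union_iff)
  finally show ?thesis .
qed

lemma coboundary_cochain_of:
  "coboundary linear_orders n (cochain_of n a) = cochain_of (Suc n) (word_coboundary n a)"
proof (intro ext)
  fix F and v :: "nat list \<Rightarrow>\<^sub>0 'a"
  consider (out) "F \<notin> decompositions (Suc n)"
    | (keys) "F \<in> decompositions (Suc n)" "\<not> keys v \<subseteq> orders F"
    | (inside) "F \<in> decompositions (Suc n)" "keys v \<subseteq> orders F"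
    by blast
  then show "coboundary linear_orders n (cochain_of n a) F v = cochain_of (Suc n) (word_coboundary n a) F v"
  proof cases
    case inside
    have "coboundary linear_orders n (cochain_of n a) F v =
        (\<Sum>i\<le>Suc n. (-1) ^ i * lin_ext (orders F)
          (\<lambda>z. a (word_face (Suc n) i (map (position F) z))) v)"
      using inside by (simp add: coboundary_def coface_cochain_of)
    also have "\<dots> = cochain_of (Suc n) (word_coboundary n a) F v"
      by (subst lin_ext_sum[symmetric]) (simp_all only: cochain_of_def word_coboundary_def inside if_True finite_atMost)
    finally show ?thesis .
  qed (auto simp: coboundary_def cochain_of_def lin_ext_def)
qed

lemma mem_Union_set_nth: "s \<in> \<Union>(set F) \<longleftrightarrow> (\<exists>i<length F. s \<in> F ! i)"
  by (metis UnionE UnionI in_set_conv_nth)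

lemma take_drop_decomposition:
  assumes F: "F \<in> decompositions (p + q)"
  shows "take p F \<in> decompositions p" "drop p F \<in> decompositions q"
    "s \<in> \<Union>(set F) \<Longrightarrow> s \<in> \<Union>(set (take p F)) \<longleftrightarrow> position F s < p"
    "s \<in> \<Union>(set F) \<Longrightarrow> s \<in> \<Union>(set (drop p F)) \<longleftrightarrow> p \<le> position F s"
    "s \<in> \<Union>(set (take p F)) \<Longrightarrow> position (take p F) s = position F s"
    "s \<in> \<Union>(set (drop p F)) \<Longrightarrow> position (drop p F) s = position F s - p"
proof -
  note len = decompositionsD(1)[OF F]
  have sub: "\<Union>(set (take p F)) \<subseteq> \<Union>(set F)" "\<Union>(set (drop p F)) \<subseteq> \<Union>(set F)"
    by (auto dest: in_set_takeD in_set_dropD)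
  have disj: "\<forall>i<p + q. \<forall>j<p + q. i \<noteq> j \<longrightarrow> F ! i \<inter> F ! j = {}" using F by (simp add: decompositions_def)
  have fin: "finite (\<Union>(set (take p F)))" "finite (\<Union>(set (drop p F)))"
    using sub decompositionsD(2)[OF F] by (blast intro: finite_subset)+
  show t: "take p F \<in> decompositions p"
    unfolding decompositions_def using len fin(1) disj by (simp del: Union_iff)
  show d: "drop p F \<in> decompositions q"
    unfolding decompositions_def using len fin(2) disj by (simp del: Union_iff)
  have memt: "s \<in> \<Union>(set (take p F)) \<longleftrightarrow> (\<exists>i<p. s \<in> F ! i)" for s
    unfolding mem_Union_set_nth using len by auto
  have memd: "s \<in> \<Union>(set (drop p F)) \<longleftrightarrow> (\<exists>i<q. s \<in> F ! (p + i))" for s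
    unfolding mem_Union_set_nth using len by auto
  show "position (take p F) s = position F s" if "s \<in> \<Union>(set (take p F))" for s
    using that position_eq[OF F] position_eq[OF t] unfolding memt by (metis nth_take trans_less_add1)
  show "position (drop p F) s = position F s - p" if "s \<in> \<Union>(set (drop p F))" for s
  proof -
    from that obtain i where i: "i < q" "s \<in> F ! (p + i)" unfolding memd by blast
    then have "position F s = p + i" by (intro position_eq[OF F]) auto
    moreover have "position (drop p F) s = i" using i len by (intro position_eq[OF d]) auto
    ultimately show ?thesis by simp
  qed
  show "s \<in> \<Union>(set (take p F)) \<longleftrightarrow> position F s < p" if "s \<in> \<Union>(set F)" for s
  proof
    assume "s \<in> \<Union>(set (take p F))"
    then obtain i where i: "i < p" "s \<in> F ! i" unfolding memt by blast
    then have "position F s = i" by (intro position_eq[OF F]) auto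
    then show "position F s < p" using i by simp
  next
    assume "position F s < p"
    then show "s \<in> \<Union>(set (take p F))" unfolding memt using position_less[OF F that] by blast
  qed
  show "s \<in> \<Union>(set (drop p F)) \<longleftrightarrow> p \<le> position F s" if "s \<in> \<Union>(set F)" for s
  proof
    assume "s \<in> \<Union>(set (drop p F))"
    then obtain i where i: "i < q" "s \<in> F ! (p + i)" unfolding memd by blast
    then have "position F s = p + i" by (intro position_eq[OF F]) auto
    then show "p \<le> position F s" by simp
  next
    assume "p \<le> position F s"
    then obtain i where "position F s = p + i" by (rule le_Suc_ex[THEN exE])
    then show "s \<in> \<Union>(set (drop p F))" unfolding memd using position_less[OF F that] by auto
  qed
qed

lemma cup_cochain_of:
  "cup linear_orders p q (cochain_of p a) (cochain_of q b) = cochain_of (p + q) (word_cup p a b)"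
proof
  fix F
  show "cup linear_orders p q (cochain_of p a) (cochain_of q b) F = cochain_of (p + q) (word_cup p a b) F"
  proof (cases "F \<in> decompositions (p + q)")
    case F: True
    note td = take_drop_decomposition[OF F]
    have sub: "\<Union>(set (take p F)) \<subseteq> \<Union>(set F)" "\<Union>(set (drop p F)) \<subseteq> \<Union>(set F)"
      by (auto dest: in_set_takeD in_set_dropD)
    show ?thesis
      unfolding cup_def cochain_of_def[of "p + q"] if_P[OF F] linear_orders_simps
    proof (rule lin_ext_cong)
      fix z assume z: "z \<in> orders F"
      let ?front = "filter (\<lambda>s. s \<in> \<Union>(set (take p F))) z"
      let ?back = "filter (\<lambda>s. s \<in> \<Union>(set (drop p F))) z"
      note zs = set_in_permutations[OF z]
      have "cochain_of p a (take p F) (single ?front 1) =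
          a (map (position (take p F)) ?front)"
        unfolding cochain_of_def if_P[OF td(1)]
        by (rule lin_ext_single[OF filter_in_permutations[OF z sub(1)]])
      also have "map (position (take p F)) ?front =
          map (position F) (filter (\<lambda>s. position F s < p) z)"
        using td(3,5) unfolding zs[symmetric] by (induction z) auto
      finally have 1: "cochain_of p a (take p F) (single ?front 1) =
          a (filter (\<lambda>c. c < p) (map (position F) z))"
        by (simp add: filter_map o_def)
      have "cochain_of q b (drop p F) (single ?back 1) =
          b (map (position (drop p F)) ?back)"
        unfolding cochain_of_def if_P[OF td(2)]
        by (rule lin_ext_single[OF filter_in_permutations[OF z sub(2)]])
      also have "map (position (drop p F)) ?back =
          map (\<lambda>s. position F s - p) (filter (\<lambda>s. p \<le> position F s) z)"
        using td(4,6) unfolding zs[symmetric] by (induction z) auto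
      finally have 2: "cochain_of q b (drop p F) (single ?back 1) =
          b (map (\<lambda>c. c - p) (filter (\<lambda>c. p \<le> c) (map (position F) z)))"
        by (simp add: filter_map o_def)
      show "cochain_of p a (take p F) (single ?front 1) *
          cochain_of q b (drop p F) (single ?back 1) =
        word_cup p a b (map (position F) z)"
        unfolding 1 2 word_cup_def ..
    qed
  qed (simp add: cup_def cochain_of_def)
qed

section \<open>Signs of linear orders\<close>

text \<open>
  The sign of an order in terms of inversions. Unlike \<open>sign\<close>, it makes sense for orders of arbitrary
  finite sets, and it is invariant under monotone relabelling; so it can be restricted to
  the two parts of a splitting.
\<close>

fun inversion_sign :: "nat list \<Rightarrow> int" where
  "inversion_sign [] = 1"
| "inversion_sign (x # xs) = (-1) ^ length (filter (\<lambda>y. y < x) xs) * inversion_sign xs"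

lemma inversion_sign_adjacent:
  "x \<noteq> y \<Longrightarrow> inversion_sign (xs @ x # y # ys) = - inversion_sign (xs @ y # x # ys)"
  by (induction xs) auto

lemma inversion_sign_move:
  "x \<notin> set us \<Longrightarrow> inversion_sign (xs @ x # us @ ys) = (-1) ^ length us * inversion_sign (xs @ us @ x # ys)"
proof (induction us arbitrary: xs)
  case (Cons u us)
  then have "inversion_sign (xs @ x # u # us @ ys) = - inversion_sign ((xs @ [u]) @ x # us @ ys)"
    using inversion_sign_adjacent[of x u xs "us @ ys"] by simp
  also have "\<dots> = - ((-1) ^ length us * inversion_sign ((xs @ [u]) @ us @ x # ys))"
    using Cons by (subst Cons.IH) auto
  finally show ?case by simp
qed simp

lemma inversion_sign_swap:
  assumes "distinct (xs @ x # us @ y # vs)"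
  shows "inversion_sign (xs @ y # us @ x # vs) = - inversion_sign (xs @ x # us @ y # vs)"
proof -
  have "inversion_sign (xs @ x # us @ y # vs) = (-1) ^ length us * inversion_sign ((xs @ us) @ x # y # vs)"
    using assms by (simp add: inversion_sign_move)
  also have "\<dots> = - ((-1) ^ length us * inversion_sign ((xs @ us) @ y # x # vs))"
    using assms by (subst inversion_sign_adjacent) auto
  also have "(-1) ^ length us * inversion_sign ((xs @ us) @ y # x # vs) = inversion_sign (xs @ y # us @ x # vs)"
    using assms by (simp add: inversion_sign_move)
  finally show ?thesis by simp
qed

lemma inversion_sign_sorted: "sorted_wrt (<) xs \<Longrightarrow> inversion_sign xs = 1"
proof (induction xs)
  case (Cons x xs)
  then have "filter (\<lambda>y. y < x) xs = []" by (auto simp: filter_empty_conv)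
  then show ?case using Cons by simp
qed simp

lemma inversion_sign_map_mono:
  "strict_mono_on A f \<Longrightarrow> set xs \<subseteq> A \<Longrightarrow> inversion_sign (map f xs) = inversion_sign xs"
proof (induction xs)
  case (Cons x xs)
  have "filter ((\<lambda>y. y < f x) \<circ> f) xs = filter (\<lambda>y. y < x) xs"
    using Cons.prems by (intro filter_cong) (auto simp: strict_mono_on_less)
  then show ?case using Cons by (simp add: filter_map)
qed simp

text \<open>
  Both sides change sign when two entries are exchanged: the left side by multiplicativity, the right side
  by moving entries past each other one at a time.
\<close>

lemma sign_eq_inversion_sign:
  assumes "\<sigma> permutes {1..n}"
  shows "sign \<sigma> = inversion_sign (map \<sigma> [1..<n + 1])"
  using finite_atLeastAtMost assms
proof (induction rule: permutes_rev_induct)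
  case id
  show ?case by (simp add: inversion_sign_sorted del: upt_Suc)
next
  case (swap a b p)
  have *: "inversion_sign (map (p \<circ> Transposition.transpose a b) [1..<n + 1]) = - inversion_sign (map p [1..<n + 1])"
    if ab: "a \<in> {1..n}" "b \<in> {1..n}" "a < b" for a b
  proof -
    obtain xs ys where 1: "[1..<n + 1] = xs @ a # ys"
      using ab split_list[of a "[1..<n + 1]"] by auto
    have sorted: "sorted_wrt (<) (xs @ a # ys)" unfolding 1[symmetric] by (simp del: upt_Suc)
    moreover have "b \<in> set (xs @ a # ys)" unfolding 1[symmetric] using ab by (simp del: upt_Suc)
    ultimately have "b \<in> set ys" using ab by (auto simp: sorted_wrt_append)
    then obtain us vs where 2: "ys = us @ b # vs" using split_list by metis
    have dist: "distinct (xs @ a # us @ b # vs)" using 1 2 distinct_upt[of 1 "n + 1"] by simp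
    have eq: "map (p \<circ> Transposition.transpose a b) zs = map p zs" if "a \<notin> set zs" "b \<notin> set zs" for zs
      using that by (auto simp: Transposition.transpose_def)
    have "inj_on p (set (xs @ a # us @ b # vs))"
      using permutes_inj[OF \<open>p permutes {1..n}\<close>] by (rule inj_on_subset) simp
    then have "distinct (map p (xs @ a # us @ b # vs))" using dist by (simp only: distinct_map simp_thms)
    then show ?thesis
      using inversion_sign_swap[of "map p xs" "p a" "map p us" "p b" "map p vs"] dist
      unfolding 1 2 by (simp add: eq del: map_map)
  qed
  have "inversion_sign (map (p \<circ> Transposition.transpose a b) [1..<n + 1]) = - inversion_sign (map p [1..<n + 1])"
    using *[of a b] *[of b a] swap.hyps by (cases "a < b") (auto simp: transpose_commute simp del: upt_Suc)
  moreover have "sign (p \<circ> Transposition.transpose a b) = - sign p"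
    using swap.hyps permutation_permutes[of p]
    by (subst sign_compose) (auto simp: sign_swap_id permutation_swap_id intro: exI[of _ "{1..n}"])
  ultimately show ?case by (simp only: swap.IH)
qed

lemma perm_of_order_permutes:
  assumes "z \<in> permutations_of_set {1..n}"
  shows "perm_of_order z permutes {1..n}" "map (perm_of_order z) [1..<n + 1] = z"
proof -
  have z: "set z = {1..n}" "distinct z" using assms by (auto simp: permutations_of_set_def)
  then have len: "length z = n" using distinct_card by fastforce
  show *: "map (perm_of_order z) [1..<n + 1] = z"
    by (rule nth_equalityI) (auto simp: len perm_of_order_def simp del: upt_Suc)
  have "bij_betw (perm_of_order z) {1..n} {1..n}"
  proof (rule bij_betw_imageI)
    have "set (map (perm_of_order z) [1..<n + 1]) = {1..n}" "distinct (map (perm_of_order z) [1..<n + 1])"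
      unfolding * by (rule z)+
    then show "inj_on (perm_of_order z) {1..n}" "perm_of_order z ` {1..n} = {1..n}"
      by (auto simp: distinct_map atLeastLessThanSuc_atLeastAtMost simp del: upt_Suc)
  qed
  then show "perm_of_order z permutes {1..n}"
    by (rule bij_imp_permutes) (auto simp: perm_of_order_def len)
qed

lemma sign_perm_of_order:
  "z \<in> permutations_of_set {1..n} \<Longrightarrow> sign (perm_of_order z) = inversion_sign z"
  using sign_eq_inversion_sign perm_of_order_permutes by metis

lemma inversion_sign_map_permutation:
  assumes "\<pi> permutes {1..n}" "z \<in> permutations_of_set {1..n}"
  shows "inversion_sign (map \<pi> z) = sign \<pi> * inversion_sign z"
proof -
  note p = perm_of_order_permutes[OF assms(2)]
  have "map \<pi> z = map (\<pi> \<circ> perm_of_order z) [1..<n + 1]" using p(2) by (metis map_map)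
  then have "inversion_sign (map \<pi> z) = sign (\<pi> \<circ> perm_of_order z)"
    using permutes_compose[OF p(1) assms(1)] by (simp only: sign_eq_inversion_sign)
  also have "\<dots> = sign \<pi> * sign (perm_of_order z)"
    using assms(1) p(1) by (intro sign_compose) (auto simp: permutation_permutes)
  finally show ?thesis by (simp add: sign_perm_of_order[OF assms(2)])
qed

section \<open>Splittings of a linear order\<close>

definition splittings :: "nat set \<Rightarrow> nat \<Rightarrow> nat \<Rightarrow> (nat set \<times> nat set) set"
  where "splittings A p q = {(S, T). S \<union> T = A \<and> S \<inter> T = {} \<and> card S = p \<and> card T = q}"

lemma finite_splittings: "finite A \<Longrightarrow> finite (splittings A p q)"
  by (rule finite_subset[of _ "Pow A \<times> Pow A"]) (auto simp: splittings_def)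

lemma splittings_insert:
  assumes "finite A" "x \<notin> A"
  shows "splittings (insert x A) p q =
    (case p of 0 \<Rightarrow> {} | Suc p' \<Rightarrow> (\<lambda>(S, T). (insert x S, T)) ` splittings A p' q) \<union>
    (case q of 0 \<Rightarrow> {} | Suc q' \<Rightarrow> (\<lambda>(S, T). (S, insert x T)) ` splittings A p q')" (is "_ = ?L \<union> ?R")
proof (intro equalityI subsetI)
  fix ST assume ST: "ST \<in> splittings (insert x A) p q"
  obtain S T where [simp]: "ST = (S, T)" by fastforce
  have fin: "finite S" "finite T" using ST assms by (auto simp: splittings_def intro: finite_subset[of _ "insert x A"])
  have h: "S \<union> T = insert x A" "S \<inter> T = {}" "card S = p" "card T = q" using ST by (auto simp: splittings_def)
  show "ST \<in> ?L \<union> ?R"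
  proof (cases "x \<in> S")
    case True
    then obtain p' where p': "p = Suc p'" using h fin by (metis card_gt_0_iff empty_iff gr0_implies_Suc)
    have "(S - {x}, T) \<in> splittings A p' q" using h True assms p' fin by (auto simp: splittings_def)
    moreover have "ST = (\<lambda>(S, T). (insert x S, T)) (S - {x}, T)" using True by auto
    ultimately show ?thesis unfolding p' by (simp only: nat.case) blast
  next
    case False
    then have T: "x \<in> T" using h by auto
    then obtain q' where q': "q = Suc q'" using h fin by (metis card_gt_0_iff empty_iff gr0_implies_Suc)
    have "(S, T - {x}) \<in> splittings A p q'" using h T False assms q' fin by (auto simp: splittings_def)
    moreover have "ST = (\<lambda>(S, T). (S, insert x T)) (S, T - {x})" using T by auto
    ultimately show ?thesis unfolding q' by (simp only: nat.case) blast
  qed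
next
  fix ST assume "ST \<in> ?L \<union> ?R"
  then show "ST \<in> splittings (insert x A) p q"
  proof
    assume "ST \<in> ?L"
    then obtain p' S T where p': "p = Suc p'" "ST = (insert x S, T)" "(S, T) \<in> splittings A p' q"
      by (auto split: nat.splits)
    then have "finite S" "x \<notin> S" "x \<notin> T" using assms by (auto simp: splittings_def intro: finite_subset)
    then show ?thesis using p' by (auto simp: splittings_def)
  next
    assume "ST \<in> ?R"
    then obtain q' S T where q': "q = Suc q'" "ST = (S, insert x T)" "(S, T) \<in> splittings A p q'"
      by (auto split: nat.splits)
    then have "finite T" "x \<notin> S" "x \<notin> T" using assms by (auto simp: splittings_def intro: finite_subset)
    then show ?thesis using q' by (auto simp: splittings_def)
  qed
qed

lemma sch_insert_left:
  assumes "finite S" "finite T" "x \<notin> S"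
  shows "sch (insert x S) T = sch S T + card {t \<in> T. t < x}"
proof -
  have *: "{(s, t) \<in> insert x S \<times> T. s > t} = {(s, t) \<in> S \<times> T. s > t} \<union> Pair x ` {t \<in> T. t < x}" by auto
  have "finite {(s, t) \<in> S \<times> T. s > t}"
    by (rule finite_subset[of _ "S \<times> T"]) (use assms in auto)
  then show ?thesis unfolding sch_def *
    using assms by (subst card_Un_disjoint) (auto simp: card_image inj_on_def)
qed

lemma sch_insert_right:
  assumes "finite S" "finite T" "x \<notin> T"
  shows "sch S (insert x T) = sch S T + card {s \<in> S. x < s}"
proof -
  have *: "{(s, t) \<in> S \<times> insert x T. s > t} = {(s, t) \<in> S \<times> T. s > t} \<union> (\<lambda>s. (s, x)) ` {s \<in> S. x < s}" by auto
  have "finite {(s, t) \<in> S \<times> T. s > t}"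
    by (rule finite_subset[of _ "S \<times> T"]) (use assms in auto)
  then show ?thesis unfolding sch_def *
    using assms by (subst card_Un_disjoint) (auto simp: card_image inj_on_def)
qed

lemma inversion_sign_Cons_filter:
  assumes "distinct (x # xs)" "S \<subseteq> set xs"
  shows "inversion_sign (filter (\<lambda>s. s \<in> insert x S) (x # xs)) =
    (-1) ^ card {s \<in> S. s < x} * inversion_sign (filter (\<lambda>s. s \<in> S) xs)"
proof -
  have "filter (\<lambda>s. s = x \<or> s \<in> S) xs = filter (\<lambda>s. s \<in> S) xs"
    using assms(1) by (intro filter_cong) auto
  moreover have "length (filter (\<lambda>s. s < x) (filter (\<lambda>s. s \<in> S) xs)) = card {s \<in> S. s < x}"
    using assms by (subst distinct_card[symmetric]) (auto intro!: arg_cong[where f = card])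
  ultimately show ?thesis by simp
qed

lemma signed_shuffles_rec:
  "p + q > 0 \<Longrightarrow> signed_shuffles p q =
    (case p of 0 \<Rightarrow> 0 | Suc p' \<Rightarrow> signed_shuffles p' q) +
    (-1) ^ p * (case q of 0 \<Rightarrow> 0 | Suc q' \<Rightarrow> signed_shuffles p q')"
  by (cases p; cases q) auto

text \<open>
  Induction on the order. The first element \<open>x\<close> belongs either to \<open>S\<close> or to \<open>T\<close>. If \<open>x \<in> S\<close>, the new
  inversions are those of \<open>x\<close> with smaller elements of \<open>S\<close>, from the sign of the restriction, and with smaller elements of
  \<open>T\<close>, from \<open>sch\<close>: together they give the sign of \<open>x\<close> in the whole order. If \<open>x \<in> T\<close>, then
  \<open>sch\<close> counts the larger elements of \<open>S\<close> instead of the smaller ones, and the discrepancy is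
  \<open>(-1) ^ card S\<close>, as in the recursion of \<open>signed_shuffles\<close>.
\<close>

lemma sum_splittings:
  assumes "distinct z" "length z = p + q"
  shows "(\<Sum>(S, T)\<in>splittings (set z) p q. (-1) ^ sch S T *
      inversion_sign (filter (\<lambda>s. s \<in> S) z) * inversion_sign (filter (\<lambda>s. s \<in> T) z)) =
    signed_shuffles p q * inversion_sign z"
  using assms
proof (induction z arbitrary: p q)
  case Nil
  have "splittings {} 0 0 = {({}, {})}" by (auto simp: splittings_def)
  then show ?case using Nil by (simp add: sch_def)
next
  case (Cons x z)
  let ?g = "\<lambda>z (S, T). (-1) ^ sch S T *
      inversion_sign (filter (\<lambda>s. s \<in> S) z) * inversion_sign (filter (\<lambda>s. s \<in> T) z)"
  let ?A = "set z" and ?e = "(-1) ^ card {s \<in> set z. s < x} :: int"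
  have x: "x \<notin> ?A" and dist: "distinct z" using Cons.prems by auto
  have e: "inversion_sign (x # z) = ?e * inversion_sign z"
    using dist by (simp add: distinct_card[symmetric])
  have out: "filter (\<lambda>s. s \<in> S) (x # z) = filter (\<lambda>s. s \<in> S) z" if "S \<subseteq> ?A" for S
    using that x by auto
  have e_split: "card {s \<in> S. s < x} + card {t \<in> T. t < x} = card {s \<in> ?A. s < x}"
    if "(S, T) \<in> splittings ?A p q" for S T p q
  proof -
    have "{s \<in> ?A. s < x} = {s \<in> S. s < x} \<union> {t \<in> T. t < x}" using that by (auto simp: splittings_def)
    moreover have "finite S" "finite T" using that by (auto simp: splittings_def intro: finite_subset[of _ ?A])
    ultimately show ?thesis using that by (auto simp: splittings_def intro!: card_Un_disjoint[symmetric])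
  qed
  have sub: "S \<subseteq> ?A" "T \<subseteq> ?A" "x \<notin> S" "x \<notin> T" "finite S" "finite T" if "(S, T) \<in> splittings ?A p q" for S T p q
    using that x by (auto simp: splittings_def intro: finite_subset[of _ ?A])
  have left: "?g (x # z) (insert x S, T) = ?e * ?g z (S, T)" if "(S, T) \<in> splittings ?A p' q'" for S T p' q'
  proof -
    note s = sub[OF that]
    have "?g (x # z) (insert x S, T) = (-1) ^ (card {s \<in> S. s < x} + card {t \<in> T. t < x}) * ?g z (S, T)"
      using inversion_sign_Cons_filter[OF Cons.prems(1) s(1)] sch_insert_left[OF s(5,6,3)] out[OF s(2)]
      by (simp add: power_add del: filter.simps)
    then show ?thesis unfolding e_split[OF that] .
  qed
  have right: "?g (x # z) (S, insert x T) = (-1) ^ p' * (?e * ?g z (S, T))" if "(S, T) \<in> splittings ?A p' q'" for S T p' q'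
  proof -
    note s = sub[OF that]
    have "S = {s \<in> S. s < x} \<union> {s \<in> S. x < s}" using s(3) by auto (metis nat_neq_iff)
    then have "card S = card {s \<in> S. s < x} + card {s \<in> S. x < s}"
      using s(5) by (metis (no_types, lifting) card_Un_disjoint disjoint_iff finite_Un mem_Collect_eq not_less_iff_gr_or_eq)
    then have p': "(-1) ^ p' * (-1) ^ card {s \<in> S. s < x} = ((-1) ^ card {s \<in> S. x < s} :: int)"
    proof -
      have "(-1) ^ (a + b) * (-1) ^ a = ((-1) ^ b :: int)" for a b :: nat
        by (simp add: power_add mult.commute mult.left_commute)
      moreover have "p' = card S" using that by (simp add: splittings_def)
      ultimately show ?thesis using \<open>card S = _\<close> by metis
    qed
    have "?g (x # z) (S, insert x T) = (-1) ^ card {s \<in> S. x < s} * ((-1) ^ card {t \<in> T. t < x} * ?g z (S, T))"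
      using inversion_sign_Cons_filter[OF Cons.prems(1) s(2)] sch_insert_right[OF s(5,6,4)] out[OF s(1)]
      by (simp add: power_add del: filter.simps)
    then show ?thesis unfolding p'[symmetric] e_split[OF that, symmetric] power_add by simp
  qed
  have "sum (?g (x # z)) (splittings (set (x # z)) p q) =
      (case p of 0 \<Rightarrow> 0 | Suc p' \<Rightarrow> ?e * sum (?g z) (splittings ?A p' q)) +
      (-1) ^ p * (case q of 0 \<Rightarrow> 0 | Suc q' \<Rightarrow> ?e * sum (?g z) (splittings ?A p q'))"
  proof -
    let ?L = "case p of 0 \<Rightarrow> {} | Suc p' \<Rightarrow> (\<lambda>(S, T). (insert x S, T)) ` splittings ?A p' q"
    let ?R = "case q of 0 \<Rightarrow> {} | Suc q' \<Rightarrow> (\<lambda>(S, T). (S, insert x T)) ` splittings ?A p q'"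
    have "sum (?g (x # z)) (splittings (set (x # z)) p q) = sum (?g (x # z)) ?L + sum (?g (x # z)) ?R"
      unfolding list.set splittings_insert[OF finite_set x]
      using sub by (intro sum.union_disjoint) (auto simp: finite_splittings split: nat.split dest: sub(3,4))
    also have "sum (?g (x # z)) ?L = (case p of 0 \<Rightarrow> 0 | Suc p' \<Rightarrow> ?e * sum (?g z) (splittings ?A p' q))"
    proof (cases p)
      case (Suc p')
      have "inj_on (\<lambda>(S, T). (insert x S, T)) (splittings ?A p' q)"
        by (rule inj_onI) (clarsimp, metis insert_ident sub(3))
      then have "sum (?g (x # z)) ((\<lambda>(S, T). (insert x S, T)) ` splittings ?A p' q) =
          (\<Sum>ST\<in>splittings ?A p' q. ?e * ?g z ST)"
        using left by (subst sum.reindex) (auto intro!: sum.cong)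
      then show ?thesis using Suc by (simp add: sum_distrib_left)
    qed simp
    also have "sum (?g (x # z)) ?R = (-1) ^ p * (case q of 0 \<Rightarrow> 0 | Suc q' \<Rightarrow> ?e * sum (?g z) (splittings ?A p q'))"
    proof (cases q)
      case (Suc q')
      have "inj_on (\<lambda>(S, T). (S, insert x T)) (splittings ?A p q')"
        by (rule inj_onI) (clarsimp, metis insert_ident sub(4))
      then have "sum (?g (x # z)) ((\<lambda>(S, T). (S, insert x T)) ` splittings ?A p q') =
          (\<Sum>ST\<in>splittings ?A p q'. (-1) ^ p * (?e * ?g z ST))"
        using right by (subst sum.reindex) (auto intro!: sum.cong)
      then show ?thesis using Suc by (simp add: sum_distrib_left)
    qed simp
    finally show ?thesis .
  qed
  also have "\<dots> = ?e * inversion_sign z * ((case p of 0 \<Rightarrow> 0 | Suc p' \<Rightarrow> signed_shuffles p' q) +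
      (-1) ^ p * (case q of 0 \<Rightarrow> 0 | Suc q' \<Rightarrow> signed_shuffles p q'))"
    using Cons.IH[OF dist] Cons.prems(2) by (auto simp: algebra_simps split: nat.split)
  also have "\<dots> = signed_shuffles p q * inversion_sign (x # z)"
  proof -
    have "0 < length (x # z)" by simp
    then have "p + q > 0" unfolding Cons.prems(2) .
    then show ?thesis unfolding e by (simp only: signed_shuffles_rec mult_ac)
  qed
  finally show ?case .
qed

section \<open>The Koszul complex of linear orders\<close>

definition sign_functional :: "nat \<Rightarrow> (nat list \<Rightarrow>\<^sub>0 'k::comm_ring_1) \<Rightarrow> 'k"
  where "sign_functional p = lin_ext (permutations_of_set {1..p}) (\<lambda>z. of_int (inversion_sign z))"

lemma koszul_gen_eq: "koszul_gen j n = (if n = j then sign_functional j else 0)"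
  using sign_perm_of_order
  by (auto simp: koszul_gen_def sign_functional_def intro: lin_ext_cong)

lemma sign_functional_single:
  "z \<in> permutations_of_set {1..p} \<Longrightarrow>
    sign_functional p (single z 1) = (of_int (inversion_sign z) :: 'k::comm_ring_1)"
  by (simp add: sign_functional_def lin_ext_single)

lemma standard_order: "[1..<p + 1] \<in> permutations_of_set {1..p}"
  by (auto simp: permutations_of_set_def)

lemma sign_functional_standard:
  "sign_functional p (single [1..<p + 1] 1) = (1 :: 'k::comm_ring_1)"
  by (subst sign_functional_single[OF standard_order]) (simp add: inversion_sign_sorted del: upt_Suc)

lemma lin_ext_scale: "lin_ext B (\<lambda>z. c * \<phi> z) v = c * lin_ext B \<phi> v"
  using lin_ext_linear[of B "\<lambda>z. 0" c \<phi> v] by (simp add: lin_ext_zero)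

text \<open>
  Orders form a regular representation: \<open>z\<close> is the image of the standard order under its own
  permutation, so an equivariant functional is determined by its value at the standard order.
\<close>

lemma koszul_eq: "koszul linear_orders p = range (\<lambda>c v. c * sign_functional p v)"
proof (intro equalityI subsetI)
  let ?B = "permutations_of_set {1..p}"
  fix f :: "(nat list \<Rightarrow>\<^sub>0 'a) \<Rightarrow> 'a" assume "f \<in> koszul linear_orders p"
  then have f: "f \<in> functionals ?B" and equi: "\<And>\<pi> v. \<pi> permutes {1..p} \<Longrightarrow> keys v \<subseteq> ?B \<Longrightarrow>
      f (push_fm (map \<pi>) v) = of_int (sign \<pi>) * f v"
    by (auto simp: koszul_def)
  let ?c = "f (single [1..<p + 1] 1)"
  have "f = lin_ext ?B (\<lambda>z. ?c * of_int (inversion_sign z))"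
  proof (rule functionals_eqI[OF f lin_ext_in_functionals])
    fix z assume z: "z \<in> ?B"
    have "f (push_fm (map (perm_of_order z)) (single [1..<p + 1] 1)) =
        of_int (sign (perm_of_order z)) * ?c"
      using standard_order by (intro equi perm_of_order_permutes(1)[OF z]) auto
    then show "f (single z 1) =
        lin_ext ?B (\<lambda>z. ?c * of_int (inversion_sign z)) (single z 1)"
      by (simp only: push_fm_single perm_of_order_permutes(2)[OF z] lin_ext_single[OF z]
        sign_perm_of_order[OF z] mult.commute)
  qed
  then have "f = (\<lambda>v. ?c * sign_functional p v)"
    by (simp only: sign_functional_def lin_ext_scale[abs_def])
  then show "f \<in> range (\<lambda>c v. c * sign_functional p v)" by blast
next
  let ?B = "permutations_of_set {1..p}"
  fix f :: "(nat list \<Rightarrow>\<^sub>0 'a) \<Rightarrow> 'a" assume "f \<in> range (\<lambda>c v. c * sign_functional p v)"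
  then obtain c where "f = (\<lambda>v. c * sign_functional p v)" by blast
  then have f: "f = lin_ext ?B (\<lambda>z. c * of_int (inversion_sign z))"
    by (simp only: sign_functional_def lin_ext_scale[abs_def])
  have "f (push_fm (map \<pi>) v) = of_int (sign \<pi>) * f v"
    if \<pi>: "\<pi> permutes {1..p}" and v: "keys v \<subseteq> ?B" for \<pi> v
  proof -
    have im: "map \<pi> ` ?B \<subseteq> ?B"
      using permutes_image[OF \<pi>] permutes_inj_on[OF \<pi>]
      by (intro image_subsetI) (simp add: permutations_of_set_def distinct_map)
    have "f (push_fm (map \<pi>) v) = lin_ext ?B (\<lambda>z. f (single (map \<pi> z) 1)) v"
      unfolding f by (rule functional_push_fm[OF lin_ext_in_functionals im v])
    also have "lin_ext ?B (\<lambda>z. f (single (map \<pi> z) 1)) =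
        lin_ext ?B (\<lambda>z. of_int (sign \<pi>) * (c * of_int (inversion_sign z)))"
    proof (rule lin_ext_cong)
      fix z assume z: "z \<in> ?B"
      then have "map \<pi> z \<in> ?B" using im by blast
      then show "f (single (map \<pi> z) 1) = of_int (sign \<pi>) * (c * of_int (inversion_sign z))"
        unfolding f by (simp add: lin_ext_single inversion_sign_map_permutation[OF \<pi> z])
    qed
    finally show ?thesis by (simp only: lin_ext_scale f)
  qed
  then show "f \<in> koszul linear_orders p"
    using lin_ext_in_functionals[of ?B] unfolding f by (auto simp: koszul_def)
qed

text \<open>
  Monotone relabelling does not change inversion signs, so the values of the product are the sums
  computed in \<open>sum_splittings\<close>.
\<close>

lemma koszul_prod_sign_functional:
  "koszul_prod linear_orders p q (\<lambda>v. a * sign_functional p v) (\<lambda>v. b * sign_functional q v) =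
    (\<lambda>v. of_int (signed_shuffles p q) * (a * b) * sign_functional (p + q) v)"
proof -
  let ?B = "permutations_of_set {1..p + q}"
  have val: "sign_functional (card S) (single (map (order_relabel S) (filter (\<lambda>s. s \<in> S) z)) 1) =
      (of_int (inversion_sign (filter (\<lambda>s. s \<in> S) z)) :: 'a)" if z: "z \<in> ?B" and S: "S \<subseteq> {1..p + q}" for S z
  proof -
    have fin: "finite S" using S finite_subset by blast
    have "filter (\<lambda>s. s \<in> S) z \<in> permutations_of_set S" using z S by (rule filter_in_permutations)
    then have "set (filter (\<lambda>s. s \<in> S) z) = S" "distinct (filter (\<lambda>s. s \<in> S) z)"
      unfolding permutations_of_set_def by blast+
    then have "map (order_relabel S) (filter (\<lambda>s. s \<in> S) z) \<in> permutations_of_set {1..card S}"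
      using order_relabel(2)[OF fin] unfolding permutations_of_set_def bij_betw_def
      by (simp only: mem_Collect_eq distinct_map set_map simp_thms)
    moreover have "inversion_sign (map (order_relabel S) (filter (\<lambda>s. s \<in> S) z)) =
        inversion_sign (filter (\<lambda>s. s \<in> S) z)"
      by (rule inversion_sign_map_mono[OF order_relabel(1)[OF fin]]) auto
    ultimately show ?thesis by (simp only: sign_functional_single)
  qed
  have "koszul_prod linear_orders p q (\<lambda>v. a * sign_functional p v) (\<lambda>v. b * sign_functional q v) =
      lin_ext ?B (\<lambda>z. of_int (signed_shuffles p q) * (a * b) * of_int (inversion_sign z))"
    unfolding koszul_prod_def linear_orders_simps
  proof (rule lin_ext_cong, goal_cases)
    case (1 z)
    then have z: "z \<in> ?B" by simp
    then have zs: "set z = {1..p + q}" "distinct z" by (auto simp: permutations_of_set_def)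
    then have len: "length z = p + q" using distinct_card by fastforce
    let ?g = "\<lambda>(S, T). (-1) ^ sch S T *
      inversion_sign (filter (\<lambda>s. s \<in> S) z) * inversion_sign (filter (\<lambda>s. s \<in> T) z)"
    have summand: "(-1) ^ sch S T *
        (a * sign_functional p (single (map (order_relabel S) (filter (\<lambda>s. s \<in> S) z)) 1)) *
        (b * sign_functional q (single (map (order_relabel T) (filter (\<lambda>s. s \<in> T) z)) 1)) =
        (a * b) * of_int (?g (S, T))" if "(S, T) \<in> splittings {1..p + q} p q" for S T
    proof -
      have "S \<subseteq> {1..p + q}" "T \<subseteq> {1..p + q}" "card S = p" "card T = q"
        using that by (auto simp: splittings_def)
      with val[OF z, of S] val[OF z, of T] show ?thesis by (simp add: mult_ac)
    qed
    have "(\<Sum>(S, T)\<in>splittings {1..p + q} p q. (-1) ^ sch S T *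
        (a * sign_functional p (single (map (order_relabel S) (filter (\<lambda>s. s \<in> S) z)) 1)) *
        (b * sign_functional q (single (map (order_relabel T) (filter (\<lambda>s. s \<in> T) z)) 1))) =
      (\<Sum>ST\<in>splittings {1..p + q} p q. (a * b) * of_int (?g ST))"
      by (rule sum.cong[OF refl]) (simp only: split_paired_all prod.case summand)
    also have "\<dots> = (a * b) * of_int (\<Sum>ST\<in>splittings {1..p + q} p q. ?g ST)"
      by (simp only: sum_distrib_left of_int_sum)
    also have "(\<Sum>ST\<in>splittings {1..p + q} p q. ?g ST) = signed_shuffles p q * inversion_sign z"
      using sum_splittings[OF zs(2) len] unfolding zs(1) .
    finally show ?case
      unfolding splittings_def[symmetric] by (simp add: mult_ac)
  qed
  then show ?thesis by (simp only: sign_functional_def lin_ext_scale[abs_def])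
qed

section \<open>Graded algebras with one basis element in every degree\<close>

text \<open>
  The bilinear product with basis \<open>x\<^sub>p = single p 1\<close> and \<open>x\<^sub>p x\<^sub>q = s p q x\<^sub>p\<^sub>+\<^sub>q\<close>. The divided power
  algebra and the model of the Koszul and cohomology algebras are both of this form.
\<close>

definition structure_mult :: "(nat \<Rightarrow> nat \<Rightarrow> 'k) \<Rightarrow> (nat \<Rightarrow>\<^sub>0 'k::comm_ring_1) \<Rightarrow> (nat \<Rightarrow>\<^sub>0 'k) \<Rightarrow> (nat \<Rightarrow>\<^sub>0 'k)"
  where "structure_mult s u v = (\<Sum>p\<in>keys u. \<Sum>q\<in>keys v.
    single (p + q) (s p q * (lookup u p * lookup v q)))"

lemma lookup_structure_mult:
  "lookup (structure_mult s u v) n = (\<Sum>p\<le>n. s p (n - p) * (lookup u p * lookup v (n - p)))"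
proof -
  have inner: "(\<Sum>q\<in>keys v. lookup (single (p + q) (s p q * (lookup u p * lookup v q))) n) =
      (if p \<le> n then s p (n - p) * (lookup u p * lookup v (n - p)) else 0)" for p
  proof -
    have "(\<Sum>q\<in>keys v. lookup (single (p + q) (s p q * (lookup u p * lookup v q))) n) =
        (\<Sum>q\<in>keys v. if q = n - p \<and> p \<le> n then s p q * (lookup u p * lookup v q) else 0)"
      by (intro sum.cong) (auto simp: lookup_single when_def)
    then show ?thesis by (cases "p \<le> n") (auto simp: in_keys_iff)
  qed
  have "lookup (structure_mult s u v) n =
      (\<Sum>p\<in>keys u. if p \<le> n then s p (n - p) * (lookup u p * lookup v (n - p)) else 0)"
    unfolding structure_mult_def lookup_sum inner ..
  also have "\<dots> = (\<Sum>p\<in>keys u \<union> {..n}. if p \<le> n then s p (n - p) * (lookup u p * lookup v (n - p)) else 0)"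
    by (intro sum.mono_neutral_left) (auto simp: in_keys_iff)
  also have "\<dots> = (\<Sum>p\<le>n. if p \<le> n then s p (n - p) * (lookup u p * lookup v (n - p)) else 0)"
    by (intro sum.mono_neutral_right) auto
  finally show ?thesis by simp
qed

lemma structure_mult_add:
  "structure_mult s (u + u') v = structure_mult s u v + structure_mult s u' v"
  "structure_mult s u (v + v') = structure_mult s u v + structure_mult s u v'"
  by (rule poly_mapping_eqI, simp add: lookup_structure_mult lookup_add distrib_left distrib_right sum.distrib)+

lemma structure_mult_scale:
  "structure_mult s (scale_fm c u) v = scale_fm c (structure_mult s u v)"
  "structure_mult s u (scale_fm c v) = scale_fm c (structure_mult s u v)"
  by (rule poly_mapping_eqI, simp add: lookup_structure_mult lookup_scale_fm sum_distrib_left mult_ac)+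

lemma structure_mult_single:
  "structure_mult s (single p a) (single q b) = single (p + q) (s p q * (a * b))"
  by (auto simp: structure_mult_def)

text \<open>
  Two ways to sum over the triples with \<open>p + q + r = n\<close>.
\<close>

lemma sum_nested_swap:
  "(\<Sum>m\<le>n. \<Sum>p\<le>m. G p (m - p) (n - m)) = (\<Sum>p\<le>(n :: nat). \<Sum>q\<le>n - p. G p q (n - p - q) :: 'k::comm_monoid_add)"
proof -
  have "(\<Sum>(m, p)\<in>Sigma {..n} (\<lambda>m. {..m}). G p (m - p) (n - m)) =
      (\<Sum>(p, q)\<in>Sigma {..n} (\<lambda>p. {..n - p}). G p q (n - p - q))"
    by (rule sum.reindex_bij_witness[where i = "\<lambda>(p, q). (p + q, p)" and j = "\<lambda>(m, p). (p, m - p)"]) auto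
  then show ?thesis by (simp add: sum.Sigma)
qed

lemma structure_mult_assoc:
  assumes "\<And>p q r. s p q * s (p + q) r = s q r * s p (q + r)"
  shows "structure_mult s (structure_mult s u v) w = structure_mult s u (structure_mult s v w)"
proof (rule poly_mapping_eqI)
  fix n
  let ?G = "\<lambda>p q r. s p q * s (p + q) r * (lookup u p * lookup v q * lookup w r)"
  have "lookup (structure_mult s (structure_mult s u v) w) n =
      (\<Sum>m\<le>n. \<Sum>p\<le>m. ?G p (m - p) (n - m))"
    unfolding lookup_structure_mult sum_distrib_left sum_distrib_right
    by (intro sum.cong refl) (simp add: mult_ac)
  also have "\<dots> = (\<Sum>p\<le>n. \<Sum>q\<le>n - p. ?G p q (n - p - q))" by (rule sum_nested_swap)
  also have "\<dots> = lookup (structure_mult s u (structure_mult s v w)) n"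
    unfolding lookup_structure_mult sum_distrib_left sum_distrib_right assms
    by (intro sum.cong refl) (simp add: mult_ac)
  finally show "lookup (structure_mult s (structure_mult s u v) w) n =
      lookup (structure_mult s u (structure_mult s v w)) n" .
qed

lemma structure_mult_one:
  assumes "\<And>q. s 0 q = 1" "\<And>p. s p 0 = 1"
  shows "structure_mult s (single 0 1) v = v" "structure_mult s v (single 0 1) = v"
proof -
  show "structure_mult s (single 0 1) v = v"
  proof (rule poly_mapping_eqI)
    fix n
    have "(\<Sum>p\<le>n. s p (n - p) * (lookup (single 0 1) p * lookup v (n - p))) =
        (\<Sum>p\<le>n. if p = 0 then lookup v n else 0)"
      using assms by (intro sum.cong) (auto simp: lookup_single when_def simp del: single_one)
    then show "lookup (structure_mult s (single 0 1) v) n = lookup v n"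
      by (simp add: lookup_structure_mult del: single_one)
  qed
  show "structure_mult s v (single 0 1) = v"
  proof (rule poly_mapping_eqI)
    fix n
    have "(\<Sum>p\<le>n. s p (n - p) * (lookup v p * lookup (single 0 1) (n - p))) =
        (\<Sum>p\<le>n. if p = n then lookup v p else 0)"
      using assms by (intro sum.cong) (auto simp: lookup_single when_def simp del: single_one)
    then show "lookup (structure_mult s v (single 0 1)) n = lookup v n"
      by (simp add: lookup_structure_mult del: single_one)
  qed
qed

text \<open>
  Shuffles of three words can be grouped in either way. By parity, this reduces to the corresponding identity
  of binomial coefficients of the halves.
\<close>

lemma signed_shuffles_assoc:
  "signed_shuffles p q * signed_shuffles (p + q) r = signed_shuffles q r * signed_shuffles p (q + r)"
proof -
  have choose: "((a + b) choose a) * ((a + b + c) choose (a + b)) = ((b + c) choose b) * ((a + (b + c)) choose a)"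
    for a b c :: nat
    using choose_mult[of a "a + b" "a + b + c"] by (simp add: mult.commute add.assoc)
  have int: "int ((a + b) choose a) * int ((a + b + c) choose (a + b)) =
      int ((b + c) choose b) * int ((a + (b + c)) choose a)" for a b c
    using choose[of a b c] by (metis of_nat_mult)
  have half: "(m + n) div 2 = (if odd m \<and> odd n then Suc (m div 2 + n div 2) else m div 2 + n div 2)" for m n :: nat
    by (auto elim!: oddE evenE)
  show ?thesis
    unfolding signed_shuffles_eq
    using int[of "p div 2" "q div 2" "r div 2"] by (auto simp: half)
qed

definition shuffle_algebra :: "('k::comm_ring_1, nat \<Rightarrow>\<^sub>0 'k) graded_alg"
  where "shuffle_algebra =
    \<lparr> carrier = UNIV,
      monoid.mult = structure_mult (\<lambda>p q. of_int (signed_shuffles p q)),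
      one = single 0 1,
      zero = 0,
      add = (+),
      smult = scale_fm,
      hpart = (\<lambda>n. {u. keys u \<subseteq> {n}}) \<rparr>"

lemma shuffle_algebra_simps [simp]:
  "carrier shuffle_algebra = UNIV"
  "u \<otimes>\<^bsub>shuffle_algebra\<^esub> v = structure_mult (\<lambda>p q. of_int (signed_shuffles p q)) u v"
  "\<one>\<^bsub>shuffle_algebra\<^esub> = single 0 1"
  "\<zero>\<^bsub>shuffle_algebra\<^esub> = 0"
  "u \<oplus>\<^bsub>shuffle_algebra\<^esub> v = u + v"
  "c \<odot>\<^bsub>shuffle_algebra\<^esub> u = scale_fm c u"
  "hpart shuffle_algebra n = {u. keys u \<subseteq> {n}}"
  by (simp_all add: shuffle_algebra_def)

lemma ring_shuffle_algebra: "ring (shuffle_algebra :: ('k::comm_ring_1, nat \<Rightarrow>\<^sub>0 'k) graded_alg)"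
proof (rule ringI)
  let ?A = "shuffle_algebra :: ('k, nat \<Rightarrow>\<^sub>0 'k) graded_alg"
  show "abelian_group ?A"
    by (rule abelian_groupI) (auto simp: add_ac intro: exI[of _ "- _"])
  have "of_int (signed_shuffles p q) * of_int (signed_shuffles (p + q) r) =
      (of_int (signed_shuffles q r) * of_int (signed_shuffles p (q + r)) :: 'k)" for p q r
    by (metis of_int_mult signed_shuffles_assoc)
  then show "monoid ?A"
    by (intro monoidI) (auto simp: structure_mult_assoc structure_mult_one simp del: single_one)
qed (auto simp: structure_mult_add)

lemma finsum_shuffle_algebra: "finsum shuffle_algebra f S = sum f S"
proof -
  interpret A: ring "shuffle_algebra :: ('a, nat \<Rightarrow>\<^sub>0 'a) graded_alg" by (rule ring_shuffle_algebra)
  show ?thesis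
    by (induction S rule: infinite_finite_induct) (auto simp: A.finsum_infinite)
qed

lemma poly_mapping_sum_single:
  fixes v :: "'b \<Rightarrow>\<^sub>0 'k::comm_ring_1"
  assumes "finite S" "keys v \<subseteq> S"
  shows "(\<Sum>z\<in>S. single z (lookup v z)) = v"
  using assms by (intro poly_mapping_eqI) (auto simp: lookup_sum lookup_single when_def in_keys_iff)

lemma graded_algebra_shuffle_algebra:
  "graded_algebra (shuffle_algebra :: ('k::comm_ring_1, nat \<Rightarrow>\<^sub>0 'k) graded_alg)"
proof -
  let ?A = "shuffle_algebra :: ('k, nat \<Rightarrow>\<^sub>0 'k) graded_alg"
  interpret A: ring ?A by (rule ring_shuffle_algebra)
  have minus: "\<ominus>\<^bsub>?A\<^esub> x = - x" for x
    by (rule A.minus_equality) auto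
  show ?thesis
  proof (intro graded_algebra.intro graded_algebra_axioms.intro A.ring_axioms)
    show "subgroup (hpart ?A n) (add_monoid ?A)" for n
    proof (rule A.add.subgroupI)
      fix a b assume "a \<in> hpart ?A n" "b \<in> hpart ?A n"
      then show "\<ominus>\<^bsub>?A\<^esub> a \<in> hpart ?A n" "a \<oplus>\<^bsub>?A\<^esub> b \<in> hpart ?A n"
        using Poly_Mapping.keys_add[of a b] unfolding minus by (auto simp: Poly_Mapping.keys_minus)
    qed (auto intro: exI[of _ 0])
    show "x \<otimes>\<^bsub>?A\<^esub> y \<in> hpart ?A (m + n)" if "x \<in> hpart ?A m" "y \<in> hpart ?A n" for x y m n
    proof -
      have "x = single m (lookup x m)" "y = single n (lookup y n)"
        using that poly_mapping_sum_single[of "{m}" x] poly_mapping_sum_single[of "{n}" y] by auto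
      then have "x \<otimes>\<^bsub>?A\<^esub> y = single (m + n) (of_int (signed_shuffles m n) * (lookup x m * lookup y n))"
        by (metis shuffle_algebra_simps(2) structure_mult_single)
      then show ?thesis by auto
    qed
    fix x :: "nat \<Rightarrow>\<^sub>0 'k"
    show "\<exists>!h. (\<forall>n. h n \<in> hpart ?A n) \<and> finite {n. h n \<noteq> \<zero>\<^bsub>?A\<^esub>} \<and>
        x = (\<Oplus>\<^bsub>?A\<^esub>n\<in>{n. h n \<noteq> \<zero>\<^bsub>?A\<^esub>}. h n)"
    proof (rule ex1I)
      let ?h = "\<lambda>n. single n (lookup x n)"
      have "{n. ?h n \<noteq> 0} = keys x" by (auto simp: in_keys_iff) (metis lookup_single_eq lookup_zero)
      then show "(\<forall>n. ?h n \<in> hpart ?A n) \<and> finite {n. ?h n \<noteq> \<zero>\<^bsub>?A\<^esub>} \<and>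
          x = (\<Oplus>\<^bsub>?A\<^esub>n\<in>{n. ?h n \<noteq> \<zero>\<^bsub>?A\<^esub>}. ?h n)"
        using poly_mapping_sum_single[of "keys x" x] by (simp add: finsum_shuffle_algebra)
      fix h assume h: "(\<forall>n. h n \<in> hpart ?A n) \<and> finite {n. h n \<noteq> \<zero>\<^bsub>?A\<^esub>} \<and>
          x = (\<Oplus>\<^bsub>?A\<^esub>n\<in>{n. h n \<noteq> \<zero>\<^bsub>?A\<^esub>}. h n)"
      then have hn: "h n = single n (lookup (h n) n)" for n
        using poly_mapping_sum_single[of "{n}" "h n"] by auto
      show "h = ?h"
      proof
        fix n
        have "lookup x n = (\<Sum>m\<in>{m. h m \<noteq> 0}. lookup (h m) n)"
          using h by (simp add: finsum_shuffle_algebra lookup_sum)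
        also have "\<dots> = (\<Sum>m\<in>{m. h m \<noteq> 0}. if m = n then lookup (h n) n else 0)"
          by (intro sum.cong refl) (metis hn lookup_single_not_eq)
        also have "\<dots> = lookup (h n) n" using h by simp
        finally show "h n = ?h n" using hn by simp
      qed
    qed
  qed (auto simp: structure_mult_scale fm.scale_left_distrib fm.scale_right_distrib
      dest: subsetD[OF keys_scale_fm])
qed

section \<open>Transport along isomorphisms of graded algebras\<close>

lemma hpart_subset_carrier: "graded_algebra A \<Longrightarrow> hpart A n \<subseteq> carrier A"
  using graded_algebra.hpart_subgroup[of A n] subgroup.subset by fastforce

lemma graded_hom_comp:
  assumes "h \<in> graded_hom A B" "g \<in> graded_hom B C"
  shows "g \<circ> h \<in> graded_hom A C"
proof -
  have "h x \<in> carrier B" if "x \<in> carrier A" for x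
    using assms(1) that by (auto simp: graded_hom_def ring_hom_def)
  moreover have "g \<circ> h \<in> ring_hom A C"
    using assms by (intro ring_hom_trans) (auto simp: graded_hom_def)
  ultimately show ?thesis using assms by (fastforce simp: graded_hom_def)
qed

lemma graded_hom_zero_finsum:
  assumes A: "graded_algebra A" and B: "graded_algebra B" and \<phi>: "\<phi> \<in> graded_hom A B"
  shows "\<phi> \<zero>\<^bsub>A\<^esub> = \<zero>\<^bsub>B\<^esub>"
    and "f \<in> S \<rightarrow> carrier A \<Longrightarrow> \<phi> (finsum A f S) = finsum B (\<lambda>x. \<phi> (f x)) S"
proof -
  interpret A: ring A using A by (rule graded_algebra.axioms)
  interpret B: ring B using B by (rule graded_algebra.axioms)
  have hom: "\<phi> \<in> ring_hom A B" using \<phi> by (simp add: graded_hom_def)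
  interpret ring_hom_ring A B \<phi> using hom by (intro ring_hom_ringI2) unfold_locales
  show "\<phi> \<zero>\<^bsub>A\<^esub> = \<zero>\<^bsub>B\<^esub>" by simp
  show "f \<in> S \<rightarrow> carrier A \<Longrightarrow> \<phi> (finsum A f S) = finsum B (\<lambda>x. \<phi> (f x)) S"
    by (induction S rule: infinite_finite_induct) (auto simp: Pi_def)
qed

text \<open>
  The target is only assumed to carry operations that correspond to those of \<open>A\<close>; all the laws follow.
  For the cohomology algebra, this spares the verification that the coset operations satisfy
  the axioms.
\<close>

lemma graded_algebra_transport:
  fixes A :: "('k::comm_ring_1, 'a) graded_alg" and B :: "('k, 'b) graded_alg"
  assumes A: "graded_algebra A" and bij: "bij_betw \<phi> (carrier A) (carrier B)"
    and mult: "\<And>x y. x \<in> carrier A \<Longrightarrow> y \<in> carrier A \<Longrightarrow> \<phi> (x \<otimes>\<^bsub>A\<^esub> y) = \<phi> x \<otimes>\<^bsub>B\<^esub> \<phi> y"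
    and add: "\<And>x y. x \<in> carrier A \<Longrightarrow> y \<in> carrier A \<Longrightarrow> \<phi> (x \<oplus>\<^bsub>A\<^esub> y) = \<phi> x \<oplus>\<^bsub>B\<^esub> \<phi> y"
    and one: "\<phi> \<one>\<^bsub>A\<^esub> = \<one>\<^bsub>B\<^esub>" and zero: "\<phi> \<zero>\<^bsub>A\<^esub> = \<zero>\<^bsub>B\<^esub>"
    and smult: "\<And>c x. x \<in> carrier A \<Longrightarrow> \<phi> (c \<odot>\<^bsub>A\<^esub> x) = c \<odot>\<^bsub>B\<^esub> \<phi> x"
    and hpart: "\<And>n. hpart B n = \<phi> ` hpart A n"
  shows "graded_algebra B" "\<phi> \<in> graded_iso A B"
proof -
  interpret A: graded_algebra A by (rule A)
  have car: "carrier B = \<phi> ` carrier A" and inj: "inj_on \<phi> (carrier A)"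
    using bij by (auto simp: bij_betw_def)
  have hsub: "hpart A n \<subseteq> carrier A" for n by (rule hpart_subset_carrier[OF A])
  have hom: "\<phi> \<in> ring_hom A B"
    using mult add one car by (intro ring_hom_memI) auto
  then have "ring (B \<lparr> zero := \<phi> \<zero>\<^bsub>A\<^esub> \<rparr>)"
    using bij by (intro A.ring_iso_imp_img_ring) (simp add: ring_iso_def)
  then have B: "ring B" by (simp add: zero)
  interpret B: ring B by (rule B)
  interpret h: ring_hom_ring A B \<phi> using hom by (intro ring_hom_ringI2) unfold_locales
  have finsum: "\<phi> (finsum A f S) = finsum B (\<lambda>x. \<phi> (f x)) S" if "f \<in> S \<rightarrow> carrier A" for f and S :: "nat set"
    using that by (induction S rule: infinite_finite_induct) (auto simp: Pi_def)
  have sub: "subgroup (hpart B n) (add_monoid B)" for n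
  proof (rule B.add.subgroupI)
    show "hpart B n \<subseteq> carrier B" unfolding hpart car using hsub by blast
    show "hpart B n \<noteq> {}" unfolding hpart using subgroup.one_closed[OF A.hpart_subgroup[of n]] by auto
    fix x y assume x: "x \<in> hpart B n" and y: "y \<in> hpart B n"
    then obtain a b where a: "a \<in> hpart A n" "x = \<phi> a" and b: "b \<in> hpart A n" "y = \<phi> b"
      unfolding hpart by blast
    have "a \<in> carrier A" "b \<in> carrier A" using a b hsub by auto
    moreover have "a \<oplus>\<^bsub>A\<^esub> b \<in> hpart A n" "\<ominus>\<^bsub>A\<^esub> a \<in> hpart A n"
      using subgroup.m_closed[OF A.hpart_subgroup] subgroup.m_inv_closed[OF A.hpart_subgroup] a b
      by (auto simp: a_inv_def)
    ultimately show "x \<oplus>\<^bsub>B\<^esub> y \<in> hpart B n" "\<ominus>\<^bsub>B\<^esub> x \<in> hpart B n"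
      unfolding hpart a(2) b(2) using add h.hom_a_inv by (metis imageI)+
  qed
  show "graded_algebra B"
  proof (intro graded_algebra.intro graded_algebra_axioms.intro B sub)
    fix x y c d assume "x \<in> carrier B" "y \<in> carrier B"
    then obtain a b where *: "a \<in> carrier A" "x = \<phi> a" "b \<in> carrier A" "y = \<phi> b" unfolding car by blast
    note cl = A.smult_closed A.m_closed A.a_closed
    show "c \<odot>\<^bsub>B\<^esub> (x \<oplus>\<^bsub>B\<^esub> y) = c \<odot>\<^bsub>B\<^esub> x \<oplus>\<^bsub>B\<^esub> c \<odot>\<^bsub>B\<^esub> y"
      using * arg_cong[where f = \<phi>, OF A.smult_add_right[of a b c]] by (simp add: smult add mult cl)
    show "(c \<odot>\<^bsub>B\<^esub> x) \<otimes>\<^bsub>B\<^esub> y = c \<odot>\<^bsub>B\<^esub> (x \<otimes>\<^bsub>B\<^esub> y)"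
      using * arg_cong[where f = \<phi>, OF A.smult_mult_left[of a b c]] by (simp add: smult add mult cl)
    show "x \<otimes>\<^bsub>B\<^esub> (c \<odot>\<^bsub>B\<^esub> y) = c \<odot>\<^bsub>B\<^esub> (x \<otimes>\<^bsub>B\<^esub> y)"
      using * arg_cong[where f = \<phi>, OF A.smult_mult_right[of a b c]] by (simp add: smult add mult cl)
  next
    fix x c d assume "x \<in> carrier B"
    then obtain a where *: "a \<in> carrier A" "x = \<phi> a" unfolding car by blast
    show "c \<odot>\<^bsub>B\<^esub> x \<in> carrier B" using * A.smult_closed[of a c] smult[of a c] car by (metis image_eqI)
    show "(c + d) \<odot>\<^bsub>B\<^esub> x = c \<odot>\<^bsub>B\<^esub> x \<oplus>\<^bsub>B\<^esub> d \<odot>\<^bsub>B\<^esub> x"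
      using * arg_cong[where f = \<phi>, OF A.smult_add_left[of a c d]] by (simp add: smult add A.smult_closed)
    show "(c * d) \<odot>\<^bsub>B\<^esub> x = c \<odot>\<^bsub>B\<^esub> (d \<odot>\<^bsub>B\<^esub> x)"
      using * arg_cong[where f = \<phi>, OF A.smult_smult[of a c d]] by (simp add: smult A.smult_closed)
    show "1 \<odot>\<^bsub>B\<^esub> x = x" using * arg_cong[where f = \<phi>, OF A.smult_unit[of a]] by (simp add: smult)
    show "\<exists>!h. (\<forall>n. h n \<in> hpart B n) \<and> finite {n. h n \<noteq> \<zero>\<^bsub>B\<^esub>} \<and>
        x = (\<Oplus>\<^bsub>B\<^esub>n\<in>{n. h n \<noteq> \<zero>\<^bsub>B\<^esub>}. h n)"
    proof -
      have transfer: "finite {n. \<phi> (g n) \<noteq> \<zero>\<^bsub>B\<^esub>} \<and> x = (\<Oplus>\<^bsub>B\<^esub>n\<in>{n. \<phi> (g n) \<noteq> \<zero>\<^bsub>B\<^esub>}. \<phi> (g n)) \<longleftrightarrow>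
          finite {n. g n \<noteq> \<zero>\<^bsub>A\<^esub>} \<and> a = (\<Oplus>\<^bsub>A\<^esub>n\<in>{n. g n \<noteq> \<zero>\<^bsub>A\<^esub>}. g n)"
        if "\<forall>n. g n \<in> hpart A n" for g
      proof -
        have g: "g n \<in> carrier A" for n using that hsub by blast
        have "\<phi> (g n) = \<zero>\<^bsub>B\<^esub> \<longleftrightarrow> g n = \<zero>\<^bsub>A\<^esub>" for n
          using inj_on_eq_iff[OF inj g A.zero_closed] by (simp add: zero)
        then have "{n. \<phi> (g n) \<noteq> \<zero>\<^bsub>B\<^esub>} = {n. g n \<noteq> \<zero>\<^bsub>A\<^esub>}" by simp
        moreover have "(\<Oplus>\<^bsub>B\<^esub>n\<in>{n. g n \<noteq> \<zero>\<^bsub>A\<^esub>}. \<phi> (g n)) = \<phi> (\<Oplus>\<^bsub>A\<^esub>n\<in>{n. g n \<noteq> \<zero>\<^bsub>A\<^esub>}. g n)"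
          using g by (subst finsum) auto
        moreover have "(\<Oplus>\<^bsub>A\<^esub>n\<in>{n. g n \<noteq> \<zero>\<^bsub>A\<^esub>}. g n) \<in> carrier A" using g by (intro A.finsum_closed) auto
        ultimately show ?thesis using inj * by (auto dest: inj_onD)
      qed
      obtain g where g: "\<forall>n. g n \<in> hpart A n" "finite {n. g n \<noteq> \<zero>\<^bsub>A\<^esub>} \<and> a = (\<Oplus>\<^bsub>A\<^esub>n\<in>{n. g n \<noteq> \<zero>\<^bsub>A\<^esub>}. g n)"
        using A.hpart_direct_sum[OF *(1)] by blast
      show ?thesis
      proof (rule ex1I)
        show "(\<forall>n. \<phi> (g n) \<in> hpart B n) \<and> finite {n. \<phi> (g n) \<noteq> \<zero>\<^bsub>B\<^esub>} \<and>
            x = (\<Oplus>\<^bsub>B\<^esub>n\<in>{n. \<phi> (g n) \<noteq> \<zero>\<^bsub>B\<^esub>}. \<phi> (g n))"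
          using transfer[OF g(1)] g by (auto simp: hpart)
        fix h assume h: "(\<forall>n. h n \<in> hpart B n) \<and> finite {n. h n \<noteq> \<zero>\<^bsub>B\<^esub>} \<and>
            x = (\<Oplus>\<^bsub>B\<^esub>n\<in>{n. h n \<noteq> \<zero>\<^bsub>B\<^esub>}. h n)"
        then have "\<forall>n. \<exists>b\<in>hpart A n. h n = \<phi> b" unfolding hpart by blast
        then obtain g' where g': "\<forall>n. g' n \<in> hpart A n" "\<And>n. h n = \<phi> (g' n)" by metis
        have "g' = g"
          using A.hpart_direct_sum[OF *(1)] g g'(1) transfer[OF g'(1)] h unfolding g'(2) by blast
        then show "h = (\<lambda>n. \<phi> (g n))" using g'(2) by auto
      qed
    qed
  next
    show "c \<odot>\<^bsub>B\<^esub> x \<in> hpart B n" if x: "x \<in> hpart B n" for x c n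
    proof -
      obtain a where "a \<in> hpart A n" "x = \<phi> a" using x unfolding hpart by blast
      then show ?thesis using A.hpart_smult[of a n c] smult[of a c] hsub[of n] unfolding hpart
        by (metis image_eqI subsetD)
    qed
    show "\<one>\<^bsub>B\<^esub> \<in> hpart B 0" unfolding hpart one[symmetric] using A.hpart_one by blast
    show "x \<otimes>\<^bsub>B\<^esub> y \<in> hpart B (m + n)" if x: "x \<in> hpart B m" and y: "y \<in> hpart B n" for x y m n
    proof -
      obtain a b where "a \<in> hpart A m" "x = \<phi> a" "b \<in> hpart A n" "y = \<phi> b" using x y unfolding hpart by blast
      then show ?thesis using A.hpart_mult[of a m b n] mult[of a b] hsub[of n] hsub[of m] unfolding hpart
        by (metis image_eqI subsetD)
    qed
  qed
  show "\<phi> \<in> graded_iso A B"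
    using hom bij smult hpart by (auto simp: graded_iso_def graded_hom_def)
qed

lemma graded_tensor_product_transport:
  fixes \<Gamma> :: "('k::comm_ring_1, 'g) graded_alg" and \<Lambda> :: "('k, 'l) graded_alg"
    and A :: "('k, 'a) graded_alg" and B :: "('k, 'b) graded_alg"
  assumes T: "graded_tensor_product \<Gamma> \<Lambda> A i j" and B: "graded_algebra B" and \<phi>: "\<phi> \<in> graded_iso A B"
  shows "graded_tensor_product \<Gamma> \<Lambda> B (\<phi> \<circ> i) (\<phi> \<circ> j)"
proof -
  have A: "graded_algebra A" and i: "i \<in> graded_hom \<Gamma> A" and j: "j \<in> graded_hom \<Lambda> A"
    using T by (auto simp: graded_tensor_product_def)
  interpret A: graded_algebra A by (rule A)
  have hom: "\<phi> \<in> graded_hom A B" and bij: "bij_betw \<phi> (carrier A) (carrier B)"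
    using \<phi> by (auto simp: graded_iso_def)
  have \<phi>m: "\<phi> (x \<otimes>\<^bsub>A\<^esub> y) = \<phi> x \<otimes>\<^bsub>B\<^esub> \<phi> y" if "x \<in> carrier A" "y \<in> carrier A" for x y
    using hom that by (auto simp: graded_hom_def ring_hom_def)
  have \<phi>s: "\<phi> (c \<odot>\<^bsub>A\<^esub> x) = c \<odot>\<^bsub>B\<^esub> \<phi> x" if "x \<in> carrier A" for c x
    using hom that by (auto simp: graded_hom_def)
  have ic: "i a \<in> carrier A" if "a \<in> carrier \<Gamma>" for a using i that by (auto simp: graded_hom_def ring_hom_def)
  have jc: "j a \<in> carrier A" if "a \<in> carrier \<Lambda>" for a using j that by (auto simp: graded_hom_def ring_hom_def)
  have ih: "i a \<in> carrier A" if "a \<in> hpart \<Gamma> m" for a m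
    using i that hpart_subset_carrier[OF A] unfolding graded_hom_def by blast
  have jh: "j a \<in> carrier A" if "a \<in> hpart \<Lambda> m" for a m
    using j that hpart_subset_carrier[OF A] unfolding graded_hom_def by blast
  have comm: "\<phi> (j b) \<otimes>\<^bsub>B\<^esub> \<phi> (i a) = ((-1) ^ (m * n)) \<odot>\<^bsub>B\<^esub> (\<phi> (i a) \<otimes>\<^bsub>B\<^esub> \<phi> (j b))"
    if "a \<in> hpart \<Gamma> m" "b \<in> hpart \<Lambda> n" for m n a b
  proof -
    have "j b \<otimes>\<^bsub>A\<^esub> i a = ((-1) ^ (m * n)) \<odot>\<^bsub>A\<^esub> (i a \<otimes>\<^bsub>A\<^esub> j b)"
      using T that by (auto simp: graded_tensor_product_def)
    then show ?thesis using ih[OF that(1)] jh[OF that(2)]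
      by (simp add: \<phi>m[symmetric] \<phi>s[symmetric])
  qed
  define F where "F = {v :: ('g \<times> 'l) \<Rightarrow>\<^sub>0 'k. keys v \<subseteq> carrier \<Gamma> \<times> carrier \<Lambda>}"
  define \<mu> where "\<mu> = (\<lambda>v. \<Oplus>\<^bsub>A\<^esub>x\<in>keys v. lookup v x \<odot>\<^bsub>A\<^esub> (i (fst x) \<otimes>\<^bsub>A\<^esub> j (snd x)))"
  define \<mu>' where "\<mu>' = (\<lambda>v. \<Oplus>\<^bsub>B\<^esub>x\<in>keys v. lookup v x \<odot>\<^bsub>B\<^esub> (\<phi> (i (fst x)) \<otimes>\<^bsub>B\<^esub> \<phi> (j (snd x))))"
  have \<mu>T: "\<mu> ` F = carrier A" "{v \<in> F. \<mu> v = \<zero>\<^bsub>A\<^esub>} = tensor_relations \<Gamma> \<Lambda>"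
    using T unfolding graded_tensor_product_def F_def \<mu>_def Let_def by blast+
  have \<mu>': "\<mu>' v = \<phi> (\<mu> v)" if v: "v \<in> F" for v
  proof -
    have c: "i (fst x) \<in> carrier A" "j (snd x) \<in> carrier A" if "x \<in> keys v" for x
      using that v ic jc by (auto simp: F_def)
    have "\<phi> (\<mu> v) = (\<Oplus>\<^bsub>B\<^esub>x\<in>keys v. \<phi> (lookup v x \<odot>\<^bsub>A\<^esub> (i (fst x) \<otimes>\<^bsub>A\<^esub> j (snd x))))"
      unfolding \<mu>_def using c by (intro graded_hom_zero_finsum(2)[OF A B hom]) (auto intro!: A.smult_closed A.m_closed)
    also have "\<dots> = \<mu>' v"
      unfolding \<mu>'_def
    proof (rule abelian_monoid.finsum_cong')
      show "abelian_monoid B" using B by (simp add: graded_algebra_def ring_def abelian_group_def)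
      have "\<phi> y \<in> carrier B" if "y \<in> carrier A" for y using bij that by (auto simp: bij_betw_def)
      then show "(\<lambda>x. lookup v x \<odot>\<^bsub>B\<^esub> (\<phi> (i (fst x)) \<otimes>\<^bsub>B\<^esub> \<phi> (j (snd x)))) \<in> keys v \<rightarrow> carrier B"
        using c by (auto simp: \<phi>m[symmetric] \<phi>s[symmetric] A.smult_closed)
    qed (use c in \<open>auto simp: \<phi>m \<phi>s\<close>)
    finally show ?thesis by simp
  qed
  have "\<mu>' ` F = carrier B"
    using \<mu>' \<mu>T(1) bij unfolding bij_betw_def by (metis (mono_tags, lifting) image_cong image_image)
  moreover have "{v \<in> F. \<mu>' v = \<zero>\<^bsub>B\<^esub>} = tensor_relations \<Gamma> \<Lambda>"
  proof -
    have "\<mu>' v = \<zero>\<^bsub>B\<^esub> \<longleftrightarrow> \<mu> v = \<zero>\<^bsub>A\<^esub>" if "v \<in> F" for v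
    proof -
      have "\<mu> v \<in> carrier A" using \<mu>T(1) that by blast
      then show ?thesis unfolding \<mu>'[OF that] graded_hom_zero_finsum(1)[OF A B hom, symmetric]
        using bij by (auto simp: bij_betw_def dest: inj_onD)
    qed
    then show ?thesis using \<mu>T(2) by blast
  qed
  ultimately show ?thesis
    using B graded_hom_comp[OF i hom] graded_hom_comp[OF j hom] comm
    unfolding graded_tensor_product_def F_def \<mu>'_def Let_def by simp
qed

section \<open>The model as divided power algebra tensor exterior algebra\<close>

text \<open>
  The inclusions of the two tensor factors into the model: divided powers go to the even basis
  elements, and the generator of the exterior algebra goes to the basis element of degree 1.
\<close>

definition even_inclusion :: "(nat \<Rightarrow>\<^sub>0 'k::comm_ring_1) \<Rightarrow> (nat \<Rightarrow>\<^sub>0 'k)"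
  where "even_inclusion u = (\<Sum>p\<in>keys u. single (2 * p) (lookup u p))"

definition exterior_inclusion :: "'k \<times> 'k \<Rightarrow> (nat \<Rightarrow>\<^sub>0 'k::comm_ring_1)"
  where "exterior_inclusion y = single 0 (fst y) + single 1 (snd y)"

abbreviation (input) shuffle_mult :: "(nat \<Rightarrow>\<^sub>0 'k::comm_ring_1) \<Rightarrow> (nat \<Rightarrow>\<^sub>0 'k) \<Rightarrow> (nat \<Rightarrow>\<^sub>0 'k)"
  where "shuffle_mult \<equiv> structure_mult (\<lambda>p q. of_int (signed_shuffles p q))"

lemma lookup_even_inclusion:
  "lookup (even_inclusion u) n = (if even n then lookup u (n div 2) else 0)"
proof -
  have "lookup (even_inclusion u) n = (\<Sum>p\<in>keys u. if p = n div 2 \<and> even n then lookup u p else 0)"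
    unfolding even_inclusion_def lookup_sum by (intro sum.cong) (auto simp: lookup_single when_def)
  then show ?thesis by (cases "even n") (auto simp: in_keys_iff)
qed

lemma even_inclusion_single: "even_inclusion (single p c) = single (2 * p) c"
  by (auto simp: even_inclusion_def)

lemma signed_shuffles_even: "signed_shuffles (2 * p) (2 * q) = int ((p + q) choose p)"
  by (simp add: signed_shuffles_eq)

lemma signed_shuffles_commute: "signed_shuffles p q = signed_shuffles q p"
  using binomial_symmetric[of "p div 2" "p div 2 + q div 2"]
  by (auto simp: signed_shuffles_eq add.commute)

lemma structure_mult_commute:
  assumes "\<And>p q. s p q = s q p"
  shows "structure_mult s u v = structure_mult s v u"
proof (rule poly_mapping_eqI)
  fix n
  show "lookup (structure_mult s u v) n = lookup (structure_mult s v u) n"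
    unfolding lookup_structure_mult
    by (rule sum.reindex_bij_witness[where i = "\<lambda>p. n - p" and j = "\<lambda>p. n - p"])
      (auto simp: assms[of "n - _"] mult.commute)
qed

text \<open>
  In even degrees the signed numbers of shuffles are the structure constants of the divided power algebra.
\<close>

lemma even_inclusion_mult:
  "even_inclusion (structure_mult (\<lambda>p q. of_nat ((p + q) choose p)) u v) =
    shuffle_mult (even_inclusion u) (even_inclusion v)"
proof (rule poly_mapping_eqI)
  fix n
  let ?f = "\<lambda>p. of_int (signed_shuffles p (n - p)) * (lookup (even_inclusion u) p * lookup (even_inclusion v) (n - p))"
  show "lookup (even_inclusion (structure_mult (\<lambda>p q. of_nat ((p + q) choose p)) u v)) n =
      lookup (shuffle_mult (even_inclusion u) (even_inclusion v)) n"
  proof (cases "even n")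
    case True
    then obtain m where m: "n = 2 * m" by blast
    have "(\<Sum>p\<le>n. ?f p) = (\<Sum>p\<in>(\<lambda>k. 2 * k) ` {..m}. ?f p)"
      by (rule sum.mono_neutral_right) (auto simp: m lookup_even_inclusion elim!: evenE)
    also have "\<dots> = (\<Sum>k\<le>m. of_nat (m choose k) * (lookup u k * lookup v (m - k)))"
    proof (subst sum.reindex)
      have "signed_shuffles (2 * k) (2 * m - 2 * k) = int (m choose k)" if "k \<le> m" for k
        using that signed_shuffles_even[of k "m - k"] by (simp add: diff_mult_distrib2)
      then show "sum (?f \<circ> (\<lambda>k. 2 * k)) {..m} = (\<Sum>k\<le>m. of_nat (m choose k) * (lookup u k * lookup v (m - k)))"
        by (intro sum.cong) (auto simp: m lookup_even_inclusion simp flip: diff_mult_distrib2)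
    qed (auto simp: inj_on_def)
    also have "\<dots> = lookup (even_inclusion (structure_mult (\<lambda>p q. of_nat ((p + q) choose p)) u v)) n"
      by (simp add: lookup_structure_mult lookup_even_inclusion m)
    finally show ?thesis by (simp only: lookup_structure_mult)
  next
    case False
    then have "?f p = 0" if "p \<le> n" for p using that by (auto simp: lookup_even_inclusion)
    then show ?thesis using False by (simp add: lookup_structure_mult lookup_even_inclusion[of _ n])
  qed
qed

lemma exterior_inclusion_mult:
  "shuffle_mult (exterior_inclusion (a, b)) (exterior_inclusion (a', b')) =
    exterior_inclusion (a * a', a * b' + b * a')"
  by (simp add: exterior_inclusion_def structure_mult_add structure_mult_single single_add signed_shuffles_eq
      del: single_one)

lemma tensor_relations_base:
  fixes A :: "('k::comm_ring_1, 'a) graded_alg" and B :: "('k, 'b) graded_alg"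
  assumes "a \<in> carrier A" "b \<in> carrier B"
  shows "a' \<in> carrier A \<Longrightarrow> single (a \<oplus>\<^bsub>A\<^esub> a', b) 1 - single (a, b) 1 - single (a', b) 1
      \<in> tensor_relations A B"
    and "b' \<in> carrier B \<Longrightarrow> single (a, b \<oplus>\<^bsub>B\<^esub> b') 1 - single (a, b) 1 - single (a, b') 1
      \<in> tensor_relations A B"
    and "single (c \<odot>\<^bsub>A\<^esub> a, b) 1 - scale_fm c (single (a, b) 1) \<in> tensor_relations A B"
    and "single (a, c \<odot>\<^bsub>B\<^esub> b) 1 - scale_fm c (single (a, b) 1) \<in> tensor_relations A B"
  unfolding tensor_relations_def Let_def using assms by (blast intro: fm.span_base)+

lemma divided_power_algebra_simps [simp]:
  "carrier (divided_power_algebra d) = UNIV"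
  "u \<otimes>\<^bsub>divided_power_algebra d\<^esub> v = structure_mult (\<lambda>p q. of_nat ((p + q) choose p)) u v"
  "\<one>\<^bsub>divided_power_algebra d\<^esub> = single 0 1"
  "u \<oplus>\<^bsub>divided_power_algebra d\<^esub> v = u + v"
  "c \<odot>\<^bsub>divided_power_algebra d\<^esub> u = scale_fm c u"
  "hpart (divided_power_algebra d) n = {u. \<forall>p\<in>keys u. d * p = n}"
  by (simp_all add: divided_power_algebra_def structure_mult_def)

lemma exterior_algebra_simps [simp]:
  "carrier (exterior_algebra d) = UNIV"
  "(a, b) \<otimes>\<^bsub>exterior_algebra d\<^esub> (a', b') = (a * a', a * b' + b * a')"
  "\<one>\<^bsub>exterior_algebra d\<^esub> = (1, 0)"
  "(a, b) \<oplus>\<^bsub>exterior_algebra d\<^esub> (a', b') = (a + a', b + b')"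
  "c \<odot>\<^bsub>exterior_algebra d\<^esub> (a, b) = (c * a, c * b)"
  "hpart (exterior_algebra d) n = {(a, b). (n \<noteq> 0 \<longrightarrow> a = 0) \<and> (n \<noteq> d \<longrightarrow> b = 0)}"
  by (simp_all add: exterior_algebra_def)

lemma scale_fm_single: "scale_fm c (single z d) = single z (c * d)"
  by (rule poly_mapping_eqI) (auto simp: lookup_scale_fm lookup_single when_def)

text \<open>
  Modulo the relations, every element of the tensor product has the form
  \<open>a \<otimes> 1 + b \<otimes> y\<close>, because the exterior algebra is free on \<open>1\<close> and \<open>y\<close>.
\<close>

lemma tensor_normal_form:
  fixes v :: "((nat \<Rightarrow>\<^sub>0 'k::comm_ring_1) \<times> ('k \<times> 'k)) \<Rightarrow>\<^sub>0 'k"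
  shows "\<exists>a b. v - (single (a, (1, 0)) 1 + single (b, (0, 1)) 1)
    \<in> tensor_relations (divided_power_algebra d) (exterior_algebra e)"
proof -
  let ?R = "tensor_relations (divided_power_algebra d) (exterior_algebra e) ::
    (((nat \<Rightarrow>\<^sub>0 'k) \<times> ('k \<times> 'k)) \<Rightarrow>\<^sub>0 'k) set"
  let ?e = "\<lambda>a y. single (a, y) 1 :: ((nat \<Rightarrow>\<^sub>0 'k) \<times> ('k \<times> 'k)) \<Rightarrow>\<^sub>0 'k"
  note rel = tensor_relations_base[where A = "divided_power_algebra d" and B = "exterior_algebra e", simplified]
  have add: "x + y \<in> ?R" and diff: "x - y \<in> ?R" and scale: "scale_fm c x \<in> ?R" if "x \<in> ?R" "y \<in> ?R" for x y c
    using that unfolding tensor_relations_def Let_def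
    by (blast intro: fm.span_add fm.span_diff fm.span_scale)+
  have single: "\<exists>a b. single x k - (?e a (1, 0) + ?e b (0, 1)) \<in> ?R" for x k
  proof -
    obtain a s t where x: "x = (a, (s, t))" by (metis surj_pair)
    have 1: "?e a (s, t) - ?e a (s, 0) - ?e a (0, t) \<in> ?R"
      using rel(2)[of a "(s, 0)" "(0, t)"] by simp
    have 2: "?e a (s, 0) - scale_fm s (?e a (1, 0)) \<in> ?R"
      using rel(4)[of a s "(1, 0)"] by simp
    have 3: "?e a (0, t) - scale_fm t (?e a (0, 1)) \<in> ?R"
      using rel(4)[of a t "(0, 1)"] by simp
    have 4: "?e (scale_fm c a) y - scale_fm c (?e a y) \<in> ?R" for c y
      using rel(3)[of c a y] by simp
    have "scale_fm k (?e a (s, t)) - (?e (scale_fm (k * s) a) (1, 0) + ?e (scale_fm (k * t) a) (0, 1)) =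
        scale_fm k (?e a (s, t) - ?e a (s, 0) - ?e a (0, t)) +
        scale_fm k (?e a (s, 0) - scale_fm s (?e a (1, 0))) +
        scale_fm k (?e a (0, t) - scale_fm t (?e a (0, 1))) -
        (?e (scale_fm (k * s) a) (1, 0) - scale_fm (k * s) (?e a (1, 0))) -
        (?e (scale_fm (k * t) a) (0, 1) - scale_fm (k * t) (?e a (0, 1)))"
      by (simp add: fm.scale_right_diff_distrib)
    also have "\<dots> \<in> ?R"
      by (intro diff add scale[OF 1 1] scale[OF 2 2] scale[OF 3 3] 4)
    finally have "scale_fm k (?e a (s, t)) - (?e (scale_fm (k * s) a) (1, 0) + ?e (scale_fm (k * t) a) (0, 1)) \<in> ?R" .
    then show ?thesis unfolding x scale_fm_single mult_1_right by blast
  qed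
  have "\<exists>a b. (\<Sum>x\<in>S. single x (lookup v x)) - (?e a (1, 0) + ?e b (0, 1)) \<in> ?R" if "finite S" for S
    using that
  proof (induction S rule: finite_induct)
    case empty
    have "single (0, (0, 0)) 0 = (0 :: ((nat \<Rightarrow>\<^sub>0 'k) \<times> ('k \<times> 'k)) \<Rightarrow>\<^sub>0 'k)" by simp
    then show ?case using single[of "(0, (0, 0))" 0] by simp
  next
    case (insert x S)
    obtain a b where 1: "(\<Sum>x\<in>S. single x (lookup v x)) - (?e a (1, 0) + ?e b (0, 1)) \<in> ?R"
      using insert.IH by blast
    obtain a' b' where 2: "single x (lookup v x) - (?e a' (1, 0) + ?e b' (0, 1)) \<in> ?R"
      using single by blast
    have 3: "?e (a + a') y - ?e a y - ?e a' y \<in> ?R" for a a' y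
      using rel(1)[of a a' y] by simp
    have "(\<Sum>x\<in>insert x S. single x (lookup v x)) - (?e (a + a') (1, 0) + ?e (b + b') (0, 1)) =
        ((\<Sum>x\<in>S. single x (lookup v x)) - (?e a (1, 0) + ?e b (0, 1))) +
        (single x (lookup v x) - (?e a' (1, 0) + ?e b' (0, 1))) -
        (?e (a + a') (1, 0) - ?e a (1, 0) - ?e a' (1, 0)) - (?e (b + b') (0, 1) - ?e b (0, 1) - ?e b' (0, 1))"
      using insert.hyps by simp
    also have "\<dots> \<in> ?R" by (intro diff add 1 2 3)
    finally show ?case by blast
  qed
  from this[of "keys v"] show ?thesis by (simp add: poly_mapping_sum_single)
qed

text \<open>
  The multiplication map sends \<open>a \<otimes> 1 + b \<otimes> y\<close> to the element with even coefficients \<open>a\<close> and odd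
  coefficients \<open>b\<close>. With the normal form, this gives both injectivity and surjectivity. In the sign rule
  all signs are \<open>1\<close>, as the divided power algebra lives in even degrees; so it expresses the
  commutativity of the model.
\<close>

lemma graded_tensor_product_shuffle_algebra:
  "graded_tensor_product (divided_power_algebra 2) (exterior_algebra 1)
    (shuffle_algebra :: ('k::comm_ring_1, nat \<Rightarrow>\<^sub>0 'k) graded_alg) even_inclusion exterior_inclusion"
proof -
  let ?\<Gamma> = "divided_power_algebra 2 :: ('k, nat \<Rightarrow>\<^sub>0 'k) graded_alg"
  let ?\<Lambda> = "exterior_algebra 1 :: ('k, 'k \<times> 'k) graded_alg"
  let ?A = "shuffle_algebra :: ('k, nat \<Rightarrow>\<^sub>0 'k) graded_alg"
  let ?R = "tensor_relations ?\<Gamma> ?\<Lambda>"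
  have i_add: "even_inclusion (u + v) = even_inclusion u + even_inclusion v" for u v :: "nat \<Rightarrow>\<^sub>0 'k"
    by (rule poly_mapping_eqI) (simp add: lookup_even_inclusion lookup_add)
  have i_scale: "even_inclusion (scale_fm c u) = scale_fm c (even_inclusion u)" for c and u :: "nat \<Rightarrow>\<^sub>0 'k"
    by (rule poly_mapping_eqI) (simp add: lookup_even_inclusion lookup_scale_fm)
  have i: "even_inclusion \<in> graded_hom ?\<Gamma> ?A"
    unfolding graded_hom_def
  proof (intro CollectI conjI allI ballI ring_hom_memI)
    show "even_inclusion ` hpart ?\<Gamma> n \<subseteq> hpart ?A n" for n
      by (auto simp: in_keys_iff lookup_even_inclusion split: if_splits)
        (metis dvd_mult_div_cancel in_keys_iff)
  qed (auto simp: i_add i_scale even_inclusion_mult even_inclusion_single simp del: single_one)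
  have j_add: "exterior_inclusion (a + a', b + b') = exterior_inclusion (a, b) + exterior_inclusion (a', b')"
    for a b a' b' :: 'k
    by (simp add: exterior_inclusion_def single_add)
  have j_scale: "exterior_inclusion (c * a, c * b) = scale_fm c (exterior_inclusion (a, b))" for a b c :: 'k
    by (simp add: exterior_inclusion_def fm.scale_right_distrib scale_fm_single)
  have j: "exterior_inclusion \<in> graded_hom ?\<Lambda> ?A"
    unfolding graded_hom_def
  proof (intro CollectI conjI allI ballI ring_hom_memI)
    show "exterior_inclusion ` hpart ?\<Lambda> n \<subseteq> hpart ?A n" for n
      by (auto simp: exterior_inclusion_def in_keys_iff lookup_add lookup_single when_def split: if_splits)
    show "exterior_inclusion (x \<otimes>\<^bsub>?\<Lambda>\<^esub> y) = exterior_inclusion x \<otimes>\<^bsub>?A\<^esub> exterior_inclusion y" for x y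
      by (cases x; cases y) (simp add: exterior_inclusion_mult)
    show "exterior_inclusion (x \<oplus>\<^bsub>?\<Lambda>\<^esub> y) = exterior_inclusion x \<oplus>\<^bsub>?A\<^esub> exterior_inclusion y" for x y
      by (cases x; cases y) (simp add: j_add)
    show "exterior_inclusion (c \<odot>\<^bsub>?\<Lambda>\<^esub> x) = c \<odot>\<^bsub>?A\<^esub> exterior_inclusion x" for c x
      by (cases x) (simp add: j_scale)
  qed (auto simp: exterior_inclusion_def)
  have comm: "exterior_inclusion b \<otimes>\<^bsub>?A\<^esub> even_inclusion a =
      ((-1) ^ (m * n)) \<odot>\<^bsub>?A\<^esub> (even_inclusion a \<otimes>\<^bsub>?A\<^esub> exterior_inclusion b)"
    if a: "a \<in> hpart ?\<Gamma> m" for m n a b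
  proof (cases "even m")
    case True
    then show ?thesis
      using structure_mult_commute[of "\<lambda>p q. of_int (signed_shuffles p q)" "even_inclusion a" "exterior_inclusion b"]
      by (simp add: signed_shuffles_commute fm.scale_one)
  next
    case False
    then have "p \<notin> keys a" for p using a by auto
    then have "keys a = {}" by blast
    then have "even_inclusion a = 0" by (simp add: even_inclusion_def)
    moreover have "structure_mult s 0 u = 0" "structure_mult s u 0 = 0" for s and u :: "nat \<Rightarrow>\<^sub>0 'k"
      by (simp_all add: structure_mult_def)
    ultimately show ?thesis by (simp add: fm.scale_zero_right)
  qed
  let ?M = "\<lambda>a b. even_inclusion a + shuffle_mult (even_inclusion b) (single 1 1) :: nat \<Rightarrow>\<^sub>0 'k"
  define \<mu> where "\<mu> = (\<lambda>v. \<Sum>x\<in>keys v. scale_fm (lookup v x) (shuffle_mult (even_inclusion (fst x)) (exterior_inclusion (snd x))) :: nat \<Rightarrow>\<^sub>0 'k)"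
  have \<mu>_add: "\<mu> (v + w) = \<mu> v + \<mu> w" for v w
    unfolding \<mu>_def by (rule setsum_keys_plus_distrib) (simp_all add: fm.scale_left_distrib)
  have \<mu>_scale: "\<mu> (scale_fm c v) = scale_fm c (\<mu> v)" for c v
  proof -
    let ?g = "\<lambda>x. shuffle_mult (even_inclusion (fst x)) (exterior_inclusion (snd x))"
    have "\<mu> (scale_fm c v) = (\<Sum>x\<in>keys v. scale_fm (lookup (scale_fm c v) x) (?g x))"
      unfolding \<mu>_def
      by (intro sum.mono_neutral_left keys_scale_fm finite_keys) (auto simp: in_keys_iff)
    then show ?thesis by (simp add: \<mu>_def lookup_scale_fm fm.scale_sum_right)
  qed
  have \<mu>_single: "\<mu> (single (a, b) 1) = shuffle_mult (even_inclusion a) (exterior_inclusion b)" for a b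
    by (simp add: \<mu>_def)
  have \<mu>_diff: "\<mu> (v - w) = \<mu> v - \<mu> w" for v w
    using \<mu>_add[of "v - w" w] by simp
  have \<mu>_normal: "\<mu> (single (a, (1, 0)) 1 + single (b, (0, 1)) 1) =
      ?M a b" for a b
    unfolding \<mu>_add \<mu>_single by (simp add: exterior_inclusion_def structure_mult_one del: single_one)
  have normal_lookup: "lookup (?M a b) (2 * p) = lookup a p"
    "lookup (?M a b) (Suc (2 * p)) = lookup b p" for a b :: "nat \<Rightarrow>\<^sub>0 'k" and p
  proof -
    have *: "lookup (shuffle_mult (even_inclusion b) (single 1 1)) n =
        (if odd n then lookup b (n div 2) else 0)" for n
    proof (cases n)
      case (Suc m)
      have "(\<Sum>p\<le>n. of_int (signed_shuffles p (n - p)) * (lookup (even_inclusion b) p * lookup (single 1 1) (n - p))) =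
          (\<Sum>p\<le>n. if p = m then of_int (signed_shuffles m 1) * lookup (even_inclusion b) m else 0)"
        by (intro sum.cong refl) (auto simp: lookup_single when_def Suc)
      then show ?thesis
        by (auto simp: lookup_structure_mult Suc lookup_even_inclusion signed_shuffles_eq)
    qed (simp add: lookup_structure_mult lookup_single)
    show "lookup (?M a b) (2 * p) = lookup a p"
      "lookup (?M a b) (Suc (2 * p)) = lookup b p"
      unfolding lookup_add * by (simp_all add: lookup_even_inclusion)
  qed
  have zero_rel: "\<mu> v = 0" if "v \<in> ?R" for v
  proof -
    have "fm.subspace {v. \<mu> v = 0}"
      by (rule fm.subspaceI) (auto simp: \<mu>_add \<mu>_scale, simp add: \<mu>_def)
    moreover have "v \<in> fm.span {v. \<mu> v = 0}"
    proof -
      show ?thesis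
        by (rule subsetD[OF fm.span_mono that[unfolded tensor_relations_def Let_def]])
          (auto simp: \<mu>_diff \<mu>_single \<mu>_scale i_add i_scale j_add j_scale structure_mult_add structure_mult_scale)
    qed
    ultimately show ?thesis by (metis (mono_tags) fm.span_eq_iff mem_Collect_eq)
  qed
  have rel_zero: "v \<in> ?R" if "\<mu> v = 0" for v
  proof -
    obtain a b where ab: "v - (single (a, (1, 0)) 1 + single (b, (0, 1)) 1) \<in> ?R"
      using tensor_normal_form by blast
    have "\<mu> v - (?M a b) = 0"
      using zero_rel[OF ab] by (simp only: \<mu>_diff \<mu>_normal)
    then have "?M a b = 0"
      unfolding that by (simp only: diff_0 neg_equal_0_iff_equal)
    then have "a = 0" "b = 0" using normal_lookup[of a b] by (auto intro!: poly_mapping_eqI)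
    moreover have "single (0 :: nat \<Rightarrow>\<^sub>0 'k, y) 1 \<in> ?R" for y
      using tensor_relations_base(3)[of 0 ?\<Gamma> y ?\<Lambda> 0] by (simp add: fm.scale_zero_left)
    ultimately have "single (a, (1, 0)) 1 + single (b, (0, 1)) 1 \<in> ?R"
      unfolding tensor_relations_def Let_def by (blast intro: fm.span_add)
    then have "(v - (single (a, (1, 0)) 1 + single (b, (0, 1)) 1)) +
        (single (a, (1, 0)) 1 + single (b, (0, 1)) 1) \<in> ?R"
      using ab unfolding tensor_relations_def Let_def by (blast intro: fm.span_add)
    then show ?thesis by simp
  qed
  have surj: "\<exists>v. \<mu> v = u" for u
  proof -
    define a where "a = Poly_Mapping.map_key (\<lambda>p. 2 * p) u"
    define b where "b = Poly_Mapping.map_key (\<lambda>p. Suc (2 * p)) u"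
    have "lookup a p = lookup u (2 * p)" "lookup b p = lookup u (Suc (2 * p))" for p
      by (simp_all add: a_def b_def map_key.rep_eq inj_def)
    then have "?M a b = u"
      using normal_lookup[of a b] by (intro poly_mapping_eqI) (metis evenE oddE Suc_eq_plus1)
    then show ?thesis using \<mu>_normal by blast
  qed
  have \<mu>_finsum: "(\<lambda>v. \<Oplus>\<^bsub>?A\<^esub>x\<in>keys v. lookup v x \<odot>\<^bsub>?A\<^esub> (even_inclusion (fst x) \<otimes>\<^bsub>?A\<^esub> exterior_inclusion (snd x))) = \<mu>"
    by (simp add: \<mu>_def finsum_shuffle_algebra)
  have "{v. \<mu> v = 0} = ?R" using zero_rel rel_zero by blast
  moreover have "range \<mu> = UNIV" using surj by (metis surj_def)
  ultimately show ?thesis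
    using i j comm graded_algebra_shuffle_algebra
    unfolding graded_tensor_product_def Let_def \<mu>_finsum
    by (simp del: shuffle_algebra_simps(2,6,7) divided_power_algebra_simps(6) exterior_algebra_simps(6))
qed

section \<open>The Koszul algebra\<close>

abbreviation (input) order_cocycles ::
    "('k::comm_ring_1, nat \<Rightarrow> nat set list \<Rightarrow> (nat list \<Rightarrow>\<^sub>0 'k) \<Rightarrow> 'k) graded_alg"
  where "order_cocycles \<equiv> cocycle_algebra linear_orders"

lemma fun_sum_apply: "(\<Sum>i\<in>A. f i) x = (\<Sum>i\<in>A. f i x)"
  by (induction A rule: infinite_finite_induct) auto

definition koszul_family :: "(nat \<Rightarrow>\<^sub>0 'k::comm_ring_1) \<Rightarrow> nat \<Rightarrow> (nat list \<Rightarrow>\<^sub>0 'k) \<Rightarrow> 'k"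
  where "koszul_family u = (\<lambda>n v. lookup u n * sign_functional n v)"

lemma koszul_algebra_simps:
  "carrier (koszul_algebra linear_orders) = {x. (\<forall>n. x n \<in> koszul linear_orders n) \<and> finite {n. x n \<noteq> 0}}"
  "x \<otimes>\<^bsub>koszul_algebra linear_orders\<^esub> y = (\<lambda>n. \<Sum>p\<le>n. koszul_prod linear_orders p (n - p) (x p) (y (n - p)))"
  "\<one>\<^bsub>koszul_algebra linear_orders\<^esub> = (\<lambda>n. if n = 0 then lin_ext (permutations_of_set {}) (\<lambda>z. 1) else 0)"
  "\<zero>\<^bsub>koszul_algebra linear_orders\<^esub> = (\<lambda>n. 0)"
  "x \<oplus>\<^bsub>koszul_algebra linear_orders\<^esub> y = (\<lambda>n. x n + y n)"
  "c \<odot>\<^bsub>koszul_algebra linear_orders\<^esub> x = (\<lambda>n v. c * x n v)"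
  "hpart (koszul_algebra linear_orders) n = {x. x n \<in> koszul linear_orders n \<and> (\<forall>k. k \<noteq> n \<longrightarrow> x k = 0)}"
  by (simp_all add: koszul_algebra_def direct_sum_algebra_def cong: if_cong)

lemma lookup_koszul_family:
  "koszul_family u n (single [1..<n + 1] 1) = lookup u n"
  unfolding koszul_family_def sign_functional_standard by simp

lemma koszul_gen_eq_family: "koszul_gen j = koszul_family (single j 1)"
  by (auto simp: fun_eq_iff koszul_gen_eq koszul_family_def lookup_single when_def)

lemma koszul_family_in: "koszul_family u n \<in> koszul linear_orders n"
  unfolding koszul_eq koszul_family_def by blast

lemma ex_koszul_family:
  assumes "\<forall>n. x n \<in> koszul linear_orders n" "finite {n. x n \<noteq> 0}"
  shows "\<exists>u. x = koszul_family u \<and> keys u \<subseteq> {n. x n \<noteq> 0}"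
proof -
  have "\<forall>n. \<exists>c. x n = (\<lambda>v. c * sign_functional n v)"
    using assms(1) unfolding koszul_eq by blast
  then obtain c where c: "\<And>n. x n = (\<lambda>v. c n * sign_functional n v)" by metis
  have "c n = x n (single [1..<n + 1] 1)" for n
    unfolding c sign_functional_standard by simp
  then have sub: "{n. c n \<noteq> 0} \<subseteq> {n. x n \<noteq> 0}" by auto
  then have "finite {n. c n \<noteq> 0}" using assms(2) finite_subset by fastforce
  then have "lookup (Abs_poly_mapping c) = c" by (rule lookup_Abs_poly_mapping)
  then have "x = koszul_family (Abs_poly_mapping c)" "keys (Abs_poly_mapping c) \<subseteq> {n. x n \<noteq> 0}"
    using sub by (auto simp: koszul_family_def c in_keys_iff)
  then show ?thesis by blast
qed

text \<open>
  The element \<open>f\<^sub>n\<close> corresponds to the basis element of degree \<open>n\<close>, and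
  \<open>koszul_prod_sign_functional\<close> says that the structure constants agree.
\<close>

lemma koszul_family_iso:
  "graded_algebra (koszul_algebra linear_orders :: ('k::comm_ring_1, nat \<Rightarrow> (nat list \<Rightarrow>\<^sub>0 'k) \<Rightarrow> 'k) graded_alg)"
  "(koszul_family :: (nat \<Rightarrow>\<^sub>0 'k) \<Rightarrow> _) \<in> graded_iso shuffle_algebra (koszul_algebra linear_orders)"
proof -
  let ?K = "koszul_algebra linear_orders :: ('k, nat \<Rightarrow> (nat list \<Rightarrow>\<^sub>0 'k) \<Rightarrow> 'k) graded_alg"
  let ?A = "shuffle_algebra :: ('k, nat \<Rightarrow>\<^sub>0 'k) graded_alg"
  have fin: "finite {n. koszul_family u n \<noteq> 0}" for u :: "nat \<Rightarrow>\<^sub>0 'k"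
    by (rule finite_subset[OF _ finite_keys[of u]]) (auto simp: koszul_family_def in_keys_iff fun_eq_iff)
  have bij: "bij_betw koszul_family (carrier ?A) (carrier ?K)"
  proof (rule bij_betw_imageI)
    show "inj_on koszul_family (carrier ?A)"
      by (rule inj_onI) (metis lookup_koszul_family poly_mapping_eqI)
    show "koszul_family ` carrier ?A = carrier ?K"
      using fin koszul_family_in ex_koszul_family unfolding koszul_algebra_simps by fastforce
  qed
  have mult: "koszul_family (u \<otimes>\<^bsub>?A\<^esub> v) = koszul_family u \<otimes>\<^bsub>?K\<^esub> koszul_family v" for u v
  proof (intro ext)
    fix n and x :: "nat list \<Rightarrow>\<^sub>0 'k"
    have "koszul_prod linear_orders p (n - p) (koszul_family u p) (koszul_family v (n - p)) x =
        of_int (signed_shuffles p (n - p)) * (lookup u p * lookup v (n - p)) * sign_functional n x" if "p \<le> n" for p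
      using that unfolding koszul_family_def koszul_prod_sign_functional by simp
    then show "koszul_family (u \<otimes>\<^bsub>?A\<^esub> v) n x = (koszul_family u \<otimes>\<^bsub>?K\<^esub> koszul_family v) n x"
      by (simp add: koszul_algebra_simps fun_sum_apply koszul_family_def[of "structure_mult _ _ _"]
        lookup_structure_mult sum_distrib_right)
  qed
  have one: "koszul_family \<one>\<^bsub>?A\<^esub> = \<one>\<^bsub>?K\<^esub>"
  proof -
    have "lin_ext (permutations_of_set {}) (\<lambda>z. 1) = (sign_functional 0 :: _ \<Rightarrow> 'k)"
      unfolding sign_functional_def by (auto intro!: lin_ext_cong)
    then show ?thesis
      by (auto simp: koszul_family_def koszul_algebra_simps lookup_single when_def fun_eq_iff simp del: single_one)
  qed
  have hpart: "hpart ?K n = koszul_family ` hpart ?A n" for n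
  proof (intro equalityI subsetI)
    fix x assume x: "x \<in> hpart ?K n"
    have "0 \<in> koszul linear_orders k" for k
      unfolding koszul_eq by (rule range_eqI[of _ _ 0]) (simp add: fun_eq_iff)
    then have "x k \<in> koszul linear_orders k" for k
      using x by (cases "k = n") (simp_all add: koszul_algebra_simps)
    moreover have sub: "{k. x k \<noteq> 0} \<subseteq> {n}" using x by (auto simp: koszul_algebra_simps)
    ultimately obtain u where "x = koszul_family u" "keys u \<subseteq> {k. x k \<noteq> 0}"
      using ex_koszul_family[of x] finite_subset[OF sub] by blast
    then show "x \<in> koszul_family ` hpart ?A n" using sub by auto
  next
    fix x assume "x \<in> koszul_family ` hpart ?A n"
    then obtain u where u: "keys u \<subseteq> {n}" "x = koszul_family u" by auto
    have "x k = 0" if "k \<noteq> n" for k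
    proof -
      have "lookup u k = 0" using u(1) that by (metis in_keys_iff singletonD subsetD)
      then show ?thesis by (simp add: u(2) koszul_family_def fun_eq_iff)
    qed
    then show "x \<in> hpart ?K n" using koszul_family_in u(2) by (simp add: koszul_algebra_simps)
  qed
  show "graded_algebra ?K" "koszul_family \<in> graded_iso ?A ?K"
    by (rule graded_algebra_transport[OF graded_algebra_shuffle_algebra bij mult _ one _ _ hpart],
      auto simp: koszul_algebra_simps koszul_family_def lookup_add lookup_scale_fm distrib_right mult.assoc fun_eq_iff)+
qed

section \<open>Cocycles and their characteristic numbers\<close>

lemma word_face_word_face:
  assumes "j < i" "i \<le> Suc (Suc n)" "set w \<subseteq> {..<Suc (Suc n)}"
  shows "word_face (Suc n) j (word_face (Suc (Suc n)) i w) = word_face (Suc n) (i - 1) (word_face (Suc (Suc n)) j w)"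
  unfolding word_face_def
  by (rule map_filter_map_filter_cong) (use assms in \<open>auto simp: survives_def merge_at_def split: if_splits\<close>)

lemma word_coboundary_word_coboundary:
  assumes w: "set w \<subseteq> {..<Suc (Suc n)}"
  shows "word_coboundary (Suc n) (word_coboundary n a) w = 0"
proof -
  let ?g = "\<lambda>(i, j). (-1) ^ (i + j) * a (word_face (Suc n) j (word_face (Suc (Suc n)) i w))"
  let ?lo = "{(i, j). i \<le> Suc (Suc n) \<and> j < i}" and ?hi = "{(i, j). j \<le> Suc n \<and> i \<le> j}"
  have fin: "finite ?lo" "finite ?hi"
    by (rule finite_subset[of _ "{..Suc (Suc n)} \<times> {..Suc (Suc n)}"]; auto)+
  have "word_coboundary (Suc n) (word_coboundary n a) w = sum ?g ({..Suc (Suc n)} \<times> {..Suc n})"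
    unfolding word_coboundary_def sum_distrib_left sum.cartesian_product
    by (intro sum.cong refl) (auto simp: power_add mult.assoc)
  also have "{..Suc (Suc n)} \<times> {..Suc n} = ?lo \<union> ?hi" by auto
  also have "sum ?g (?lo \<union> ?hi) = sum ?g ?lo + sum ?g ?hi"
    using fin by (intro sum.union_disjoint) auto
  also have "sum ?g ?lo = sum (\<lambda>x. - ?g x) ?hi"
  proof (rule sum.reindex_bij_witness[where i = "\<lambda>(i, j). (Suc j, i)" and j = "\<lambda>(i, j). (j, i - 1)"])
    fix x assume "x \<in> ?lo"
    then obtain i j where x: "x = (i, j)" "i \<le> Suc (Suc n)" "j < i" by auto
    then obtain k where "i = Suc k" by (cases i) auto
    then show "- ?g (case x of (i, j) \<Rightarrow> (j, i - 1)) = ?g x"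
      using word_face_word_face[OF x(3,2) w] by (simp add: x(1) add.commute)
  qed auto
  finally show ?thesis by (simp add: sum_negf)
qed

lemma alternation_sum:
  "finite S \<Longrightarrow> alternation n (\<lambda>w. \<Sum>i\<in>S. f i w) = (\<Sum>i\<in>S. alternation n (f i))"
proof (induction S rule: finite_induct)
  case empty
  then show ?case using alternation_scale[of n 0 "\<lambda>w. 0"] by simp
qed (simp add: alternation_add)

definition cochain_family :: "(nat \<Rightarrow> nat list \<Rightarrow> 'k::comm_ring_1) \<Rightarrow> nat \<Rightarrow> nat set list \<Rightarrow> (nat list \<Rightarrow>\<^sub>0 'k) \<Rightarrow> 'k"
  where "cochain_family a n = cochain_of n (a n)"

text \<open>
  The complete invariant of cohomology classes: the alternating sum of the component of
  degree \<open>n\<close>, for every \<open>n\<close>.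
\<close>

definition characteristic :: "(nat \<Rightarrow> nat set list \<Rightarrow> (nat list \<Rightarrow>\<^sub>0 'k) \<Rightarrow> 'k) \<Rightarrow> nat \<Rightarrow> 'k::comm_ring_1"
  where "characteristic x n = alternation n (word_function n (x n))"

lemma characteristic_family: "characteristic (cochain_family a) n = alternation n (a n)"
  unfolding characteristic_def cochain_family_def by (rule alternation_cong) (rule word_function_cochain_of)

lemma cochain_of_zero: "cochain_of n (\<lambda>w. 0) = 0"
  by (auto simp: cochain_of_def lin_ext_zero fun_eq_iff)

lemma cochain_of_eq_0_iff: "cochain_of n a = 0 \<longleftrightarrow> (\<forall>w. set w \<subseteq> {..<n} \<longrightarrow> a w = 0)"
proof
  assume "cochain_of n a = 0"
  then show "\<forall>w. set w \<subseteq> {..<n} \<longrightarrow> a w = 0"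
    using word_function_cochain_of[of _ n a] by (simp add: word_function_def)
next
  assume "\<forall>w. set w \<subseteq> {..<n} \<longrightarrow> a w = 0"
  then have "cochain_of n a = cochain_of n (\<lambda>w. 0)" by (intro cochain_of_cong) simp
  then show "cochain_of n a = 0" by (simp add: cochain_of_zero)
qed

lemma cochain_of_plus: "cochain_of n a + cochain_of n b = cochain_of n (\<lambda>w. a w + b w)"
  using cochain_of_linear[of n a 1 b] by (simp add: fun_eq_iff)

lemma cochain_of_sum: "finite S \<Longrightarrow> (\<Sum>i\<in>S. cochain_of n (f i)) = cochain_of n (\<lambda>w. \<Sum>i\<in>S. f i w)"
  by (induction S rule: finite_induct) (simp_all add: cochain_of_zero cochain_of_plus)

abbreviation (input) word_cocycle :: "nat \<Rightarrow> (nat list \<Rightarrow> 'k::comm_ring_1) \<Rightarrow> bool"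
  where "word_cocycle n a \<equiv> \<forall>w. set w \<subseteq> {..<Suc n} \<longrightarrow> word_coboundary n a w = 0"

lemma cochain_algebra_simps:
  "carrier (cochain_algebra X) = {x. (\<forall>n. x n \<in> cochains X n) \<and> finite {n. x n \<noteq> 0}}"
  by (simp add: cochain_algebra_def direct_sum_algebra_def)

lemma cocycle_algebra_simps:
  "carrier (cocycle_algebra X) = {x. (\<forall>n. x n \<in> cochains X n) \<and> finite {n. x n \<noteq> 0} \<and> differential X x = 0}"
  "x \<otimes>\<^bsub>cocycle_algebra X\<^esub> y = (\<lambda>n. \<Sum>p\<le>n. cup X p (n - p) (x p) (y (n - p)))"
  "\<one>\<^bsub>cocycle_algebra X\<^esub> = (\<lambda>n. if n = 0 then (\<lambda>F. if F = [] then lin_ext (sp_basis X {}) (\<lambda>z. 1) else 0) else 0)"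
  "\<zero>\<^bsub>cocycle_algebra X\<^esub> = (\<lambda>n. 0)"
  "x \<oplus>\<^bsub>cocycle_algebra X\<^esub> y = (\<lambda>n. x n + y n)"
  "c \<odot>\<^bsub>cocycle_algebra X\<^esub> x = (\<lambda>n F v. c * x n F v)"
  "hpart (cocycle_algebra X) n = {x. x n \<in> cochains X n \<and> (\<forall>k. k \<noteq> n \<longrightarrow> x k = 0) \<and> differential X x = 0}"
  by (auto simp: cocycle_algebra_def cochain_algebra_def direct_sum_algebra_def)

lemma differential_family:
  "differential linear_orders (cochain_family a) =
    cochain_family (\<lambda>n. case n of 0 \<Rightarrow> \<lambda>w. 0 | Suc m \<Rightarrow> word_coboundary m (a m))"
  by (rule ext) (simp add: differential_def cochain_family_def coboundary_cochain_of cochain_of_zero split: nat.split)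

lemma cocycle_family_iff:
  "cochain_family a \<in> carrier order_cocycles \<longleftrightarrow>
    finite {n. cochain_family a n \<noteq> 0} \<and> (\<forall>n. word_cocycle n (a n))"
proof -
  have "differential linear_orders (cochain_family a) = 0 \<longleftrightarrow> (\<forall>n. word_cocycle n (a n))"
  proof -
    have zero: "cochain_family g = 0 \<longleftrightarrow> (\<forall>n. cochain_of n (g n) = 0)" for g :: "nat \<Rightarrow> nat list \<Rightarrow> 'a"
      unfolding cochain_family_def[abs_def] by (auto simp: fun_eq_iff)
    have "(\<forall>n. cochain_of n (case n of 0 \<Rightarrow> \<lambda>w. 0 | Suc m \<Rightarrow> word_coboundary m (a m)) = 0) \<longleftrightarrow>
        (\<forall>m. cochain_of (Suc m) (word_coboundary m (a m)) = 0)"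
      by (auto simp: cochain_of_zero split: nat.split)
    then show ?thesis unfolding differential_family zero by (simp only: cochain_of_eq_0_iff)
  qed
  then show ?thesis
    by (simp add: cocycle_algebra_simps cochain_family_def cochain_of_in_cochains)
qed

lemma ex_cochain_family: "\<forall>n. x n \<in> cochains linear_orders n \<Longrightarrow> x = cochain_family (\<lambda>n. word_function n (x n))"
  by (auto simp: cochain_family_def cochain_of_word_function)

lemma cocycle_obtain:
  assumes "x \<in> carrier order_cocycles"
  obtains a where "x = cochain_family a" "\<And>n. x n = 0 \<Longrightarrow> a n = (\<lambda>w. 0)" "finite {n. x n \<noteq> 0}"
    "\<And>n. word_cocycle n (a n)"
proof -
  let ?a = "\<lambda>n. word_function n (x n)"
  have x: "x = cochain_family ?a" using assms by (intro ex_cochain_family) (simp add: cocycle_algebra_simps)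
  have "?a n = (\<lambda>w. 0)" if "x n = 0" for n using that by (simp add: word_function_def fun_eq_iff)
  moreover have "finite {n. x n \<noteq> 0}" using assms by (simp add: cocycle_algebra_simps)
  moreover have "\<forall>n. word_cocycle n (?a n)" using assms cocycle_family_iff[of ?a] unfolding x[symmetric] by simp
  ultimately show thesis using that[OF x] by simp
qed

text \<open>
  This is the computation of the cohomology: a cocycle with vanishing characteristic numbers is a
  coboundary by \<open>word_cocycle_decomp\<close>. The primitives obtained there are replaced by \<open>0\<close> where the cocycle vanishes, so that the family of
  primitives has finite support.
\<close>

lemma coboundaries_iff:
  assumes x: "x \<in> carrier order_cocycles"
  shows "x \<in> coboundaries linear_orders \<longleftrightarrow> (\<forall>n. characteristic x n = 0)"
proof
  assume "x \<in> coboundaries linear_orders"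
  then obtain y where y: "\<forall>n. y n \<in> cochains linear_orders n" "x = differential linear_orders y"
    by (auto simp: coboundaries_def cochain_algebra_simps)
  obtain b where "y = cochain_family b" using ex_cochain_family[OF y(1)] by blast
  then have x: "x = cochain_family (\<lambda>n. case n of 0 \<Rightarrow> \<lambda>w. 0 | Suc m \<Rightarrow> word_coboundary m (b m))"
    using y(2) differential_family by simp
  show "\<forall>n. characteristic x n = 0"
    unfolding x characteristic_family by (auto simp: alternation_coboundary simp del: alternation.simps(2) split: nat.split)
next
  assume 0: "\<forall>n. characteristic x n = 0"
  obtain a where a: "x = cochain_family a" "\<And>n. x n = 0 \<Longrightarrow> a n = (\<lambda>w. 0)" "finite {n. x n \<noteq> 0}"
    "\<And>n. word_cocycle n (a n)" using cocycle_obtain[OF x] by metis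
  have alt: "alternation n (a n) = 0" for n using 0 unfolding a(1) characteristic_family by blast
  have "\<exists>b. \<forall>w. set w \<subseteq> {..<n} \<longrightarrow> a n w = (case n of 0 \<Rightarrow> 0 | Suc m \<Rightarrow> word_coboundary m b w)" for n
    using word_cocycle_decomp[of n "a n"] a(4)[of n] unfolding alt by simp
  then obtain b where b: "\<And>n w. set w \<subseteq> {..<n} \<Longrightarrow> a n w = (case n of 0 \<Rightarrow> 0 | Suc m \<Rightarrow> word_coboundary m (b n) w)"
    by metis
  define c where "c = (\<lambda>m. if x (Suc m) = 0 then (\<lambda>w. 0) else b (Suc m))"
  have "differential linear_orders (cochain_family c) = x"
  proof
    fix n
    show "differential linear_orders (cochain_family c) n = x n"
    proof (cases n)
      case 0
      have "cochain_of 0 (a 0) = cochain_of 0 (\<lambda>w. 0)" by (rule cochain_of_cong) (simp add: b)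
      then show ?thesis unfolding differential_family by (simp add: 0 a(1) cochain_family_def)
    next
      case (Suc m)
      have "cochain_of (Suc m) (word_coboundary m (c m)) = cochain_of (Suc m) (a (Suc m))"
      proof (cases "x (Suc m) = 0")
        case True
        then have "word_coboundary m (c m) = a (Suc m)"
          using a(2) by (simp add: c_def word_coboundary_def fun_eq_iff)
        then show ?thesis by simp
      next
        case False
        then show ?thesis by (intro cochain_of_cong) (simp add: b c_def)
      qed
      then show ?thesis unfolding differential_family by (simp add: Suc a(1) cochain_family_def)
    qed
  qed
  moreover have "finite {n. cochain_family c n \<noteq> 0}"
  proof (rule finite_subset)
    show "{n. cochain_family c n \<noteq> 0} \<subseteq> Suc -` {n. x n \<noteq> 0}"
      by (auto simp: cochain_family_def c_def cochain_of_zero)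
    show "finite (Suc -` {n. x n \<noteq> 0})" using a(3) by (intro finite_vimageI) auto
  qed
  ultimately show "x \<in> coboundaries linear_orders"
    unfolding coboundaries_def cochain_algebra_simps
    using cochain_of_in_cochains by (intro image_eqI[of _ _ "cochain_family c"]) (auto simp: cochain_family_def)
qed

lemma coboundaries_subset: "coboundaries linear_orders \<subseteq> carrier order_cocycles"
proof
  fix x :: "nat \<Rightarrow> nat set list \<Rightarrow> (nat list \<Rightarrow>\<^sub>0 'k::comm_ring_1) \<Rightarrow> 'k"
  assume "x \<in> coboundaries linear_orders"
  then obtain y where y: "\<forall>n. y n \<in> cochains linear_orders n" "finite {n. y n \<noteq> 0}" "x = differential linear_orders y"
    by (auto simp: coboundaries_def cochain_algebra_simps)
  obtain b where b: "y = cochain_family b" using ex_cochain_family[OF y(1)] by blast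
  let ?a = "\<lambda>n. case n of 0 \<Rightarrow> \<lambda>w. 0 | Suc m \<Rightarrow> word_coboundary m (b m)"
  have x: "x = cochain_family ?a" using y(3) b differential_family by simp
  have "x n \<noteq> 0 \<Longrightarrow> n \<in> Suc ` {n. y n \<noteq> 0}" for n
  proof -
    assume n: "x n \<noteq> 0"
    then obtain m where m: "n = Suc m" by (cases n) (auto simp: x cochain_family_def cochain_of_zero)
    have "y m \<noteq> 0"
    proof
      assume "y m = 0"
      then have "\<forall>w. set w \<subseteq> {..<m} \<longrightarrow> b m w = 0" unfolding b cochain_family_def cochain_of_eq_0_iff .
      then have "word_coboundary m (b m) w = word_coboundary m (\<lambda>w. 0) w" if "set w \<subseteq> {..<Suc m}" for w
        using that by (intro word_coboundary_cong) auto
      then have "cochain_of (Suc m) (word_coboundary m (b m)) = 0"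
        unfolding cochain_of_eq_0_iff by (simp add: word_coboundary_def)
      then show False using n by (simp add: x m cochain_family_def)
    qed
    then show ?thesis using m by blast
  qed
  then have "{n. x n \<noteq> 0} \<subseteq> Suc ` {n. y n \<noteq> 0}" by blast
  then have "finite {n. x n \<noteq> 0}" using y(2) finite_subset by blast
  moreover have "word_cocycle n (?a n)" for n
    by (cases n) (auto simp: word_coboundary_word_coboundary, simp add: word_coboundary_def)
  ultimately show "x \<in> carrier order_cocycles"
    using cocycle_family_iff[of ?a] unfolding x by blast
qed

lemma cocycle_linear:
  assumes x: "x \<in> carrier order_cocycles" and y: "y \<in> carrier order_cocycles"
  shows "(\<lambda>n F v. x n F v + c * y n F v) \<in> carrier order_cocycles"
    and "characteristic (\<lambda>n F v. x n F v + c * y n F v) n = characteristic x n + c * characteristic y n"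
proof -
  obtain a where a: "x = cochain_family a" "finite {n. x n \<noteq> 0}" "\<And>n. word_cocycle n (a n)"
    using cocycle_obtain[OF x] by metis
  obtain b where b: "y = cochain_family b" "finite {n. y n \<noteq> 0}" "\<And>n. word_cocycle n (b n)"
    using cocycle_obtain[OF y] by metis
  let ?z = "\<lambda>n F v. x n F v + c * y n F v"
  have z: "?z = cochain_family (\<lambda>n w. a n w + c * b n w)"
    by (simp add: a(1) b(1) cochain_family_def cochain_of_linear fun_eq_iff)
  have "?z n = 0" if "x n = 0" "y n = 0" for n using that by (simp add: fun_eq_iff)
  then have "{n. ?z n \<noteq> 0} \<subseteq> {n. x n \<noteq> 0} \<union> {n. y n \<noteq> 0}" by blast
  then have "finite {n. cochain_family (\<lambda>n w. a n w + c * b n w) n \<noteq> 0}"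
    unfolding z[symmetric] using a(2) b(2) finite_subset by blast
  moreover have "word_cocycle n (\<lambda>w. a n w + c * b n w)" for n
    using a(3) b(3) by (simp add: word_coboundary_linear)
  ultimately show "?z \<in> carrier order_cocycles"
    using cocycle_family_iff[of "\<lambda>n w. a n w + c * b n w"] unfolding z by blast
  show "characteristic ?z n = characteristic x n + c * characteristic y n"
    unfolding z unfolding a(1) b(1) characteristic_family by (rule alternation_linear)
qed

text \<open>
  Characteristic numbers multiply with the structure constants of the model; products of cocycles
  are cocycles by the Leibniz rule \<open>word_coboundary_word_cup\<close>.
\<close>

lemma cocycle_mult:
  assumes x: "x \<in> carrier order_cocycles" and y: "y \<in> carrier order_cocycles"
  shows "x \<otimes>\<^bsub>order_cocycles\<^esub> y \<in> carrier order_cocycles"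
    and "characteristic (x \<otimes>\<^bsub>order_cocycles\<^esub> y) n =
      (\<Sum>p\<le>n. of_int (signed_shuffles p (n - p)) * (characteristic x p * characteristic y (n - p)))"
proof -
  obtain a where a: "x = cochain_family a" "\<And>n. x n = 0 \<Longrightarrow> a n = (\<lambda>w. 0)" "finite {n. x n \<noteq> 0}"
    "\<And>n. word_cocycle n (a n)" using cocycle_obtain[OF x] by metis
  obtain b where b: "y = cochain_family b" "\<And>n. y n = 0 \<Longrightarrow> b n = (\<lambda>w. 0)" "finite {n. y n \<noteq> 0}"
    "\<And>n. word_cocycle n (b n)" using cocycle_obtain[OF y] by metis
  let ?z = "x \<otimes>\<^bsub>order_cocycles\<^esub> y"
  let ?c = "\<lambda>n w. \<Sum>p\<le>n. word_cup p (a p) (b (n - p)) w"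
  have z: "?z = cochain_family ?c"
  proof
    fix n
    have "cup linear_orders p (n - p) (x p) (y (n - p)) = cochain_of n (word_cup p (a p) (b (n - p)))" if "p \<le> n" for p
      using that cup_cochain_of[of p "n - p" "a p" "b (n - p)"] by (simp add: a(1) b(1) cochain_family_def)
    then show "?z n = cochain_family ?c n"
      by (simp add: cocycle_algebra_simps cochain_family_def cochain_of_sum[symmetric])
  qed
  have "{n. ?z n \<noteq> 0} \<subseteq> (\<lambda>(p, q). p + q) ` ({n. x n \<noteq> 0} \<times> {n. y n \<noteq> 0})"
  proof
    fix n assume n: "n \<in> {n. ?z n \<noteq> 0}"
    have "\<exists>p\<le>n. x p \<noteq> 0 \<and> y (n - p) \<noteq> 0"
    proof (rule ccontr)
      assume "\<not> ?thesis"
      then have "word_cup p (a p) (b (n - p)) w = 0" if "p \<le> n" for p w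
        using that a(2)[of p] b(2)[of "n - p"] by (auto simp: word_cup_def)
      then have "?z n = 0" unfolding z cochain_family_def cochain_of_eq_0_iff by simp
      then show False using n by simp
    qed
    then obtain p where "p \<le> n" "x p \<noteq> 0" "y (n - p) \<noteq> 0" by blast
    then show "n \<in> (\<lambda>(p, q). p + q) ` ({n. x n \<noteq> 0} \<times> {n. y n \<noteq> 0})"
      by (intro image_eqI[of _ _ "(p, n - p)"]) auto
  qed
  then have "finite {n. ?z n \<noteq> 0}" using a(3) b(3) finite_subset by blast
  moreover have "word_cocycle n (?c n)" for n
  proof (intro allI impI)
    fix w assume w: "set w \<subseteq> {..<Suc n}"
    have "word_coboundary n (word_cup p (a p) (b (n - p))) w = 0" if "p \<le> n" for p
    proof -
      have "word_coboundary n (word_cup p (a p) (b (n - p))) w =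
          word_cup (Suc p) (word_coboundary p (a p)) (b (n - p)) w +
          (-1) ^ p * word_cup p (a p) (word_coboundary (n - p) (b (n - p))) w"
        using word_coboundary_word_cup[of w p "n - p"] w that by simp
      moreover have "word_coboundary p (a p) (filter (\<lambda>c. c < Suc p) w) = 0"
        by (rule a(4)[rule_format]) auto
      moreover have "word_coboundary (n - p) (b (n - p)) (map (\<lambda>c. c - p) (filter (\<lambda>c. p \<le> c) w)) = 0"
        by (rule b(4)[rule_format]) (use w that in auto)
      ultimately show ?thesis by (simp add: word_cup_def)
    qed
    moreover have "word_coboundary n (?c n) w = (\<Sum>p\<le>n. word_coboundary n (word_cup p (a p) (b (n - p))) w)"
      unfolding word_coboundary_def sum_distrib_left by (rule sum.swap)
    ultimately show "word_coboundary n (?c n) w = 0" by simp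
  qed
  ultimately show "?z \<in> carrier order_cocycles"
    using cocycle_family_iff[of ?c] unfolding z by blast
  have "alternation n (word_cup p (a p) (b (n - p))) =
      of_int (signed_shuffles p (n - p)) * (alternation p (a p) * alternation (n - p) (b (n - p)))" if "p \<le> n" for p
    using that alternation_word_cup[of p "n - p" "a p" "b (n - p)"] by simp
  then show "characteristic ?z n =
      (\<Sum>p\<le>n. of_int (signed_shuffles p (n - p)) * (characteristic x p * characteristic y (n - p)))"
    unfolding z unfolding a(1) b(1) characteristic_family by (simp add: alternation_sum)
qed

section \<open>The cohomology algebra\<close>

text \<open>
  The cocycles with prescribed characteristic numbers. These sets turn out to be precisely the cosets of
  the coboundaries, so the quotient operations can be computed without reference to representatives.
\<close>

definition cohomology_class :: "(nat \<Rightarrow>\<^sub>0 'k::comm_ring_1) \<Rightarrow> (nat \<Rightarrow> nat set list \<Rightarrow> (nat list \<Rightarrow>\<^sub>0 'k) \<Rightarrow> 'k) set"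
  where "cohomology_class u = {x \<in> carrier order_cocycles. \<forall>n. characteristic x n = lookup u n}"

definition counting_cocycle :: "(nat \<Rightarrow>\<^sub>0 'k::comm_ring_1) \<Rightarrow> nat \<Rightarrow> nat set list \<Rightarrow> (nat list \<Rightarrow>\<^sub>0 'k) \<Rightarrow> 'k"
  where "counting_cocycle u = cochain_family (\<lambda>n w. lookup u n * subword_count n w)"

lemma counting_cocycle_eq_0: "lookup u n = 0 \<Longrightarrow> counting_cocycle u n = 0"
  by (simp add: counting_cocycle_def cochain_family_def cochain_of_zero)

lemma counting_cocycle_in_class: "counting_cocycle u \<in> cohomology_class u"
proof -
  have "{n. counting_cocycle u n \<noteq> 0} \<subseteq> keys u"
    using counting_cocycle_eq_0[of u] by (auto simp: in_keys_iff)
  then have "finite {n. counting_cocycle u n \<noteq> 0}" using finite_keys finite_subset by blast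
  moreover have "word_coboundary n (\<lambda>w. lookup u n * subword_count n w) w = 0" if "set w \<subseteq> {..<Suc n}" for n w
    using word_coboundary_linear[of n "\<lambda>w. 0" "lookup u n" "subword_count n" w]
    unfolding subword_count_cocycle[OF that] by (simp add: word_coboundary_def[of n "\<lambda>w. 0"])
  ultimately show ?thesis
    by (simp add: cohomology_class_def cocycle_family_iff counting_cocycle_def characteristic_family
      alternation_scale alternation_subword_count)
qed

lemma cohomology_class_inj: "cohomology_class u = cohomology_class v \<Longrightarrow> u = v"
proof (rule poly_mapping_eqI)
  fix n
  assume "cohomology_class u = cohomology_class v"
  then have "counting_cocycle u \<in> cohomology_class u" "counting_cocycle u \<in> cohomology_class v"
    using counting_cocycle_in_class[of u] by simp_all
  then show "lookup u n = lookup v n" by (simp add: cohomology_class_def)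
qed

lemma ex_cohomology_class:
  assumes x: "x \<in> carrier order_cocycles"
  shows "\<exists>u. x \<in> cohomology_class u \<and> keys u \<subseteq> {n. x n \<noteq> 0}"
proof -
  have sub: "{n. characteristic x n \<noteq> 0} \<subseteq> {n. x n \<noteq> 0}"
  proof
    fix n assume n: "n \<in> {n. characteristic x n \<noteq> 0}"
    have "word_function n 0 = (\<lambda>w. 0 :: 'a)" by (simp add: word_function_def fun_eq_iff)
    then have "characteristic x n = 0" if "x n = 0"
      using that alternation_scale[of n 0 "\<lambda>w. 0 :: 'a"] by (simp add: characteristic_def)
    then show "n \<in> {n. x n \<noteq> 0}" using n by blast
  qed
  moreover have "finite {n. x n \<noteq> 0}" using x by (simp add: cocycle_algebra_simps)
  ultimately have "lookup (Abs_poly_mapping (characteristic x)) = characteristic x"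
    by (intro lookup_Abs_poly_mapping) (rule finite_subset)
  then show ?thesis using x sub
    by (intro exI[of _ "Abs_poly_mapping (characteristic x)"]) (auto simp: cohomology_class_def in_keys_iff)
qed

text \<open>
  Cocycles with the same characteristic numbers differ by a coboundary.
\<close>

lemma coset_eq_class:
  assumes x: "x \<in> cohomology_class u"
  shows "coboundaries linear_orders +>\<^bsub>order_cocycles\<^esub> x = cohomology_class u"
proof (intro equalityI subsetI)
  have xZ: "x \<in> carrier order_cocycles" and xu: "\<And>n. characteristic x n = lookup u n"
    using x by (auto simp: cohomology_class_def)
  fix y assume "y \<in> coboundaries linear_orders +>\<^bsub>order_cocycles\<^esub> x"
  then obtain b where b: "b \<in> coboundaries linear_orders" "y = (\<lambda>n F v. b n F v + 1 * x n F v)"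
    by (auto simp: a_r_coset_def' cocycle_algebra_simps fun_eq_iff)
  have bZ: "b \<in> carrier order_cocycles" using b(1) coboundaries_subset by blast
  have "characteristic b n = 0" for n using coboundaries_iff[OF bZ] b(1) by blast
  then show "y \<in> cohomology_class u"
    using cocycle_linear[OF bZ xZ, of 1] xu unfolding b(2) cohomology_class_def by simp
next
  have xZ: "x \<in> carrier order_cocycles" and xu: "\<And>n. characteristic x n = lookup u n"
    using x by (auto simp: cohomology_class_def)
  fix y assume "y \<in> cohomology_class u"
  then have yZ: "y \<in> carrier order_cocycles" and yu: "\<And>n. characteristic y n = lookup u n"
    by (auto simp: cohomology_class_def)
  let ?b = "\<lambda>n F v. y n F v + (-1) * x n F v"
  have "?b \<in> coboundaries linear_orders"
    unfolding coboundaries_iff[OF cocycle_linear(1)[OF yZ xZ]] cocycle_linear(2)[OF yZ xZ] xu yu by simp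
  moreover have "y = ?b \<oplus>\<^bsub>order_cocycles\<^esub> x" by (simp add: cocycle_algebra_simps fun_eq_iff)
  ultimately show "y \<in> coboundaries linear_orders +>\<^bsub>order_cocycles\<^esub> x"
    unfolding a_r_coset_def' by blast
qed

lemma cohomology_class_plus:
  assumes "x \<in> cohomology_class u" "y \<in> cohomology_class v"
  shows "x \<oplus>\<^bsub>order_cocycles\<^esub> y \<in> cohomology_class (u + v)"
proof -
  have "x \<oplus>\<^bsub>order_cocycles\<^esub> y = (\<lambda>n F v. x n F v + 1 * y n F v)"
    by (simp add: cocycle_algebra_simps fun_eq_iff)
  then show ?thesis using assms cocycle_linear[of x y 1] by (auto simp: cohomology_class_def lookup_add)
qed

lemma zero_in_cocycles: "(\<lambda>n F v. 0) \<in> carrier order_cocycles"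
  and characteristic_zero: "characteristic (\<lambda>n F v. 0) n = 0"
proof -
  have *: "(\<lambda>n F v. 0) = cochain_family (\<lambda>n w. 0)"
    by (simp add: cochain_family_def cochain_of_zero fun_eq_iff)
  show "(\<lambda>n F v. 0) \<in> carrier order_cocycles"
    unfolding * by (simp add: cocycle_family_iff word_coboundary_def cochain_family_def cochain_of_zero)
  show "characteristic (\<lambda>n F v. 0) n = 0"
    unfolding * characteristic_family using alternation_scale[of n 0 "\<lambda>w. 0"] by simp
qed

lemma cohomology_class_scale:
  assumes "x \<in> cohomology_class u"
  shows "c \<odot>\<^bsub>order_cocycles\<^esub> x \<in> cohomology_class (scale_fm c u)"
proof -
  have "c \<odot>\<^bsub>order_cocycles\<^esub> x = (\<lambda>n F v. 0 + c * x n F v)"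
    by (simp add: cocycle_algebra_simps fun_eq_iff)
  then show ?thesis using assms cocycle_linear[OF zero_in_cocycles, of x c] characteristic_zero
    by (auto simp: cohomology_class_def lookup_scale_fm)
qed

lemma cohomology_class_mult:
  assumes "x \<in> cohomology_class u" "y \<in> cohomology_class v"
  shows "x \<otimes>\<^bsub>order_cocycles\<^esub> y \<in> cohomology_class (shuffle_mult u v)"
  using assms cocycle_mult[of x y] by (auto simp: cohomology_class_def lookup_structure_mult)

lemma cocycle_one_in_class: "\<one>\<^bsub>order_cocycles\<^esub> \<in> cohomology_class (single 0 (1 :: 'k::comm_ring_1))"
proof -
  have dec: "decompositions 0 = {[]}" by (auto simp: decompositions_def)
  have "\<one>\<^bsub>order_cocycles\<^esub> = counting_cocycle (single 0 (1 :: 'k))"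
  proof
    fix n
    show "\<one>\<^bsub>order_cocycles\<^esub> n = counting_cocycle (single 0 (1 :: 'k)) n"
    proof (cases "n = 0")
      case True
      then show ?thesis
        by (auto simp: cocycle_algebra_simps counting_cocycle_def cochain_family_def cochain_of_def dec fun_eq_iff
          simp del: single_one)
    next
      case False
      then show ?thesis
        using counting_cocycle_eq_0[of "single 0 1" n, symmetric]
        by (simp add: cocycle_algebra_simps lookup_single_not_eq del: single_one)
    qed
  qed
  then show ?thesis using counting_cocycle_in_class by simp
qed

lemma cohomology_algebra_simps:
  "carrier (cohomology_algebra X) = (\<Union>x\<in>carrier (cocycle_algebra X). {coboundaries X +>\<^bsub>cocycle_algebra X\<^esub> x})"
  "a \<otimes>\<^bsub>cohomology_algebra X\<^esub> b =
    (\<Union>x\<in>a. \<Union>y\<in>b. coboundaries X +>\<^bsub>cocycle_algebra X\<^esub> (x \<otimes>\<^bsub>cocycle_algebra X\<^esub> y))"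
  "\<one>\<^bsub>cohomology_algebra X\<^esub> = coboundaries X +>\<^bsub>cocycle_algebra X\<^esub> \<one>\<^bsub>cocycle_algebra X\<^esub>"
  "\<zero>\<^bsub>cohomology_algebra X\<^esub> = coboundaries X"
  "a \<oplus>\<^bsub>cohomology_algebra X\<^esub> b = (\<Union>x\<in>a. \<Union>y\<in>b. {x \<oplus>\<^bsub>cocycle_algebra X\<^esub> y})"
  "c \<odot>\<^bsub>cohomology_algebra X\<^esub> a = (\<Union>x\<in>a. coboundaries X +>\<^bsub>cocycle_algebra X\<^esub> (c \<odot>\<^bsub>cocycle_algebra X\<^esub> x))"
  "hpart (cohomology_algebra X) n = (\<lambda>x. coboundaries X +>\<^bsub>cocycle_algebra X\<^esub> x) ` hpart (cocycle_algebra X) n"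
  by (simp_all add: cohomology_algebra_def Let_def FactRing_def A_RCOSETS_def' rcoset_mult_def set_add_def')

text \<open>
  Sums, products and multiples of cocycles have the expected characteristic numbers; since a class is
  determined by these numbers, each coset operation yields a single class.
\<close>

lemma cohomology_class_iso:
  "graded_algebra (cohomology_algebra linear_orders ::
    ('k::comm_ring_1, (nat \<Rightarrow> nat set list \<Rightarrow> (nat list \<Rightarrow>\<^sub>0 'k) \<Rightarrow> 'k) set) graded_alg)"
  "(cohomology_class :: (nat \<Rightarrow>\<^sub>0 'k) \<Rightarrow> _) \<in> graded_iso shuffle_algebra (cohomology_algebra linear_orders)"
proof -
  let ?H = "cohomology_algebra linear_orders ::
    ('k, (nat \<Rightarrow> nat set list \<Rightarrow> (nat list \<Rightarrow>\<^sub>0 'k) \<Rightarrow> 'k) set) graded_alg"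
  let ?A = "shuffle_algebra :: ('k, nat \<Rightarrow>\<^sub>0 'k) graded_alg"
  let ?Z = "order_cocycles :: ('k, _) graded_alg"
  have class_Z: "x \<in> carrier ?Z" if "x \<in> cohomology_class u" for x u using that by (simp add: cohomology_class_def)
  have bij: "bij_betw cohomology_class (carrier ?A) (carrier ?H)"
  proof (rule bij_betw_imageI)
    show "inj_on cohomology_class (carrier ?A)" by (rule inj_onI) (rule cohomology_class_inj)
    show "cohomology_class ` carrier ?A = carrier ?H"
    proof (intro equalityI subsetI)
      fix a :: "(nat \<Rightarrow> nat set list \<Rightarrow> (nat list \<Rightarrow>\<^sub>0 'k) \<Rightarrow> 'k) set"
      assume "a \<in> cohomology_class ` carrier ?A"
      then obtain u where "a = cohomology_class u" by blast
      then show "a \<in> carrier ?H"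
        unfolding cohomology_algebra_simps
        using coset_eq_class[OF counting_cocycle_in_class] class_Z[OF counting_cocycle_in_class] by blast
    next
      fix a assume "a \<in> carrier ?H"
      then obtain x where "x \<in> carrier ?Z" "a = coboundaries linear_orders +>\<^bsub>?Z\<^esub> x"
        unfolding cohomology_algebra_simps by blast
      then show "a \<in> cohomology_class ` carrier ?A"
        using ex_cohomology_class coset_eq_class by (metis UNIV_I image_eqI shuffle_algebra_simps(1))
    qed
  qed
  have mult: "cohomology_class (u \<otimes>\<^bsub>?A\<^esub> v) = cohomology_class u \<otimes>\<^bsub>?H\<^esub> cohomology_class v" for u v
  proof -
    have "coboundaries linear_orders +>\<^bsub>?Z\<^esub> (x \<otimes>\<^bsub>?Z\<^esub> y) = cohomology_class (shuffle_mult u v)"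
      if "x \<in> cohomology_class u" "y \<in> cohomology_class v" for x y
      by (rule coset_eq_class[OF cohomology_class_mult[OF that]])
    then show ?thesis
      unfolding cohomology_algebra_simps
      using counting_cocycle_in_class[of u] counting_cocycle_in_class[of v] by auto
  qed
  have add: "cohomology_class (u \<oplus>\<^bsub>?A\<^esub> v) = cohomology_class u \<oplus>\<^bsub>?H\<^esub> cohomology_class v" for u v
  proof (intro equalityI subsetI)
    fix y assume "y \<in> cohomology_class (u \<oplus>\<^bsub>?A\<^esub> v)"
    then have y: "y \<in> cohomology_class (u + v)" by simp
    let ?x = "counting_cocycle u"
    let ?y = "y \<oplus>\<^bsub>?Z\<^esub> ((-1) \<odot>\<^bsub>?Z\<^esub> ?x)"
    have "?y \<in> cohomology_class (u + v + scale_fm (-1) u)"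
      by (intro cohomology_class_plus cohomology_class_scale y counting_cocycle_in_class)
    also have "u + v + scale_fm (-1) u = v"
      by (rule poly_mapping_eqI) (simp add: lookup_add lookup_scale_fm)
    finally have "?y \<in> cohomology_class v" .
    moreover have "y = ?x \<oplus>\<^bsub>?Z\<^esub> ?y" by (simp add: cocycle_algebra_simps fun_eq_iff)
    ultimately show "y \<in> cohomology_class u \<oplus>\<^bsub>?H\<^esub> cohomology_class v"
      unfolding cohomology_algebra_simps using counting_cocycle_in_class[of u] by blast
  next
    fix y assume "y \<in> cohomology_class u \<oplus>\<^bsub>?H\<^esub> cohomology_class v"
    then show "y \<in> cohomology_class (u \<oplus>\<^bsub>?A\<^esub> v)"
      unfolding cohomology_algebra_simps using cohomology_class_plus by auto
  qed
  have smult: "cohomology_class (c \<odot>\<^bsub>?A\<^esub> u) = c \<odot>\<^bsub>?H\<^esub> cohomology_class u" for c u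
  proof -
    have "coboundaries linear_orders +>\<^bsub>?Z\<^esub> (c \<odot>\<^bsub>?Z\<^esub> x) = cohomology_class (scale_fm c u)"
      if "x \<in> cohomology_class u" for x
      by (rule coset_eq_class[OF cohomology_class_scale[OF that]])
    then show ?thesis
      unfolding cohomology_algebra_simps using counting_cocycle_in_class[of u] by auto
  qed
  have one: "cohomology_class \<one>\<^bsub>?A\<^esub> = \<one>\<^bsub>?H\<^esub>"
    unfolding cohomology_algebra_simps shuffle_algebra_simps coset_eq_class[OF cocycle_one_in_class] ..
  have zero: "cohomology_class \<zero>\<^bsub>?A\<^esub> = \<zero>\<^bsub>?H\<^esub>"
    unfolding cohomology_algebra_simps
    using coboundaries_iff coboundaries_subset by (auto simp: cohomology_class_def)
  have hpart: "hpart ?H n = cohomology_class ` hpart ?A n" for n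
  proof (intro equalityI subsetI)
    fix a assume "a \<in> hpart ?H n"
    then obtain x where x: "x \<in> hpart ?Z n" "a = coboundaries linear_orders +>\<^bsub>?Z\<^esub> x"
      unfolding cohomology_algebra_simps by blast
    have sub: "{k. x k \<noteq> 0} \<subseteq> {n}" using x(1) by (auto simp: cocycle_algebra_simps)
    have "(0 :: nat set list \<Rightarrow> (nat list \<Rightarrow>\<^sub>0 'k) \<Rightarrow> 'k) \<in> cochains linear_orders k" for k
      using cochain_of_in_cochains[of k "\<lambda>w. 0"] by (simp only: cochain_of_zero)
    then have "x k \<in> cochains linear_orders k" for k
      using x(1) by (cases "k = n") (simp_all add: cocycle_algebra_simps)
    then have "x \<in> carrier ?Z"
      using x(1) finite_subset[OF sub] by (simp add: cocycle_algebra_simps)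
    then obtain u where u: "x \<in> cohomology_class u" "keys u \<subseteq> {k. x k \<noteq> 0}" using ex_cohomology_class by blast
    then have "a = cohomology_class u" using x(2) coset_eq_class by blast
    then show "a \<in> cohomology_class ` hpart ?A n" using u(2) sub by auto
  next
    fix a :: "(nat \<Rightarrow> nat set list \<Rightarrow> (nat list \<Rightarrow>\<^sub>0 'k) \<Rightarrow> 'k) set"
    assume "a \<in> cohomology_class ` hpart ?A n"
    then obtain u where u: "keys u \<subseteq> {n}" "a = cohomology_class u" by auto
    have "counting_cocycle u k = 0" if "k \<noteq> n" for k
      using u(1) that by (intro counting_cocycle_eq_0) (metis in_keys_iff singletonD subsetD)
    then have "counting_cocycle u \<in> hpart ?Z n"
      using class_Z[OF counting_cocycle_in_class[of u]] by (simp add: cocycle_algebra_simps)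
    then show "a \<in> hpart ?H n"
      unfolding cohomology_algebra_simps u(2) using coset_eq_class[OF counting_cocycle_in_class] by blast
  qed
  show "graded_algebra ?H" "cohomology_class \<in> graded_iso ?A ?H"
    by (rule graded_algebra_transport[OF graded_algebra_shuffle_algebra bij mult add one zero smult hpart])+
qed

section \<open>Generators and relations\<close>

text \<open>
  Two isomorphisms out of the same algebra give an isomorphism between their targets. Applied to the
  model, it takes \<open>f\<^sub>n\<close> to the class of the cocycle that counts the subword \<open>0 1 \<dots> (n - 1)\<close>.
\<close>

lemma graded_iso_quotient:
  assumes A: "graded_algebra A" and \<phi>: "\<phi> \<in> graded_iso A B" and \<psi>: "\<psi> \<in> graded_iso A C"
  shows "\<psi> \<circ> inv_into (carrier A) \<phi> \<in> graded_iso B C"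
    and "a \<in> carrier A \<Longrightarrow> (\<psi> \<circ> inv_into (carrier A) \<phi>) (\<phi> a) = \<psi> a"
proof -
  interpret A: graded_algebra A by (rule A)
  let ?\<Omega> = "\<psi> \<circ> inv_into (carrier A) \<phi>"
  have bij: "bij_betw \<phi> (carrier A) (carrier B)" "bij_betw \<psi> (carrier A) (carrier C)"
    using \<phi> \<psi> by (auto simp: graded_iso_def)
  have hom: "\<phi> \<in> ring_hom A B" "\<psi> \<in> ring_hom A C"
    and smult: "\<And>c x. x \<in> carrier A \<Longrightarrow> \<phi> (c \<odot>\<^bsub>A\<^esub> x) = c \<odot>\<^bsub>B\<^esub> \<phi> x"
      "\<And>c x. x \<in> carrier A \<Longrightarrow> \<psi> (c \<odot>\<^bsub>A\<^esub> x) = c \<odot>\<^bsub>C\<^esub> \<psi> x"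
    and hpart: "\<And>n. \<phi> ` hpart A n = hpart B n" "\<And>n. \<psi> ` hpart A n = hpart C n"
    using \<phi> \<psi> by (auto simp: graded_iso_def graded_hom_def)
  show *: "?\<Omega> (\<phi> a) = \<psi> a" if "a \<in> carrier A" for a
    using bij(1) that by (simp add: bij_betw_def)
  have car: "carrier B = \<phi> ` carrier A" using bij(1) by (simp add: bij_betw_def)
  have bij\<Omega>: "bij_betw ?\<Omega> (carrier B) (carrier C)"
    using bij_betw_inv_into[OF bij(1)] bij(2) by (rule bij_betw_trans)
  have "?\<Omega> \<in> ring_hom B C"
  proof (rule ring_hom_memI)
    fix x y assume "x \<in> carrier B" "y \<in> carrier B"
    then obtain a b where ab: "a \<in> carrier A" "x = \<phi> a" "b \<in> carrier A" "y = \<phi> b" by (auto simp: car)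
    show "?\<Omega> x \<in> carrier C" using * ab bij(2) by (auto simp: bij_betw_def)
    show "?\<Omega> (x \<otimes>\<^bsub>B\<^esub> y) = ?\<Omega> x \<otimes>\<^bsub>C\<^esub> ?\<Omega> y"
      unfolding ab(2,4) *[OF ab(1)] *[OF ab(3)] ring_hom_mult[OF hom(1) ab(1,3), symmetric]
        ring_hom_mult[OF hom(2) ab(1,3), symmetric]
      by (rule *[OF A.m_closed[OF ab(1,3)]])
    show "?\<Omega> (x \<oplus>\<^bsub>B\<^esub> y) = ?\<Omega> x \<oplus>\<^bsub>C\<^esub> ?\<Omega> y"
      unfolding ab(2,4) *[OF ab(1)] *[OF ab(3)] ring_hom_add[OF hom(1) ab(1,3), symmetric]
        ring_hom_add[OF hom(2) ab(1,3), symmetric]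
      by (rule *[OF A.a_closed[OF ab(1,3)]])
  next
    show "?\<Omega> \<one>\<^bsub>B\<^esub> = \<one>\<^bsub>C\<^esub>"
      using *[OF A.one_closed] unfolding ring_hom_one[OF hom(1)] ring_hom_one[OF hom(2)] .
  qed
  moreover have "?\<Omega> (c \<odot>\<^bsub>B\<^esub> x) = c \<odot>\<^bsub>C\<^esub> ?\<Omega> x" if "x \<in> carrier B" for c x
  proof -
    from that obtain a where a: "a \<in> carrier A" "x = \<phi> a" by (auto simp: car)
    show ?thesis
      unfolding a(2) *[OF a(1)] smult(1)[OF a(1), symmetric] smult(2)[OF a(1), symmetric]
      by (rule *[OF A.smult_closed[OF a(1)]])
  qed
  moreover have "?\<Omega> ` hpart B n = hpart C n" for n
  proof -
    have "?\<Omega> ` hpart B n = (\<lambda>a. ?\<Omega> (\<phi> a)) ` hpart A n" unfolding hpart(1)[symmetric] by (simp only: image_image)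
    also have "\<dots> = \<psi> ` hpart A n"
      using * hpart_subset_carrier[OF A] by (intro image_cong refl) blast
    finally show ?thesis unfolding hpart(2) .
  qed
  ultimately show "?\<Omega> \<in> graded_iso B C" using bij\<Omega> by (simp add: graded_iso_def graded_hom_def)
qed

text \<open>
  The products \<open>f\<^sub>1 f\<^sub>2\<^sub>p = f\<^sub>2\<^sub>p\<^sub>+\<^sub>1\<close> supply the generators of odd degree, and the Koszul algebra is spanned by all \<open>f\<^sub>n\<close>.
\<close>

lemma koszul_subalgebra_eq_carrier:
  assumes S: "subalgebra S (koszul_algebra linear_orders)"
    and 1: "koszul_gen 1 \<in> S" and even: "\<And>p. koszul_gen (2 * p) \<in> S"
  shows "S = (carrier (koszul_algebra linear_orders) :: (nat \<Rightarrow> (nat list \<Rightarrow>\<^sub>0 'k::comm_ring_1) \<Rightarrow> 'k) set)"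
proof
  let ?K = "koszul_algebra linear_orders :: ('k, nat \<Rightarrow> (nat list \<Rightarrow>\<^sub>0 'k) \<Rightarrow> 'k) graded_alg"
  let ?A = "shuffle_algebra :: ('k, nat \<Rightarrow>\<^sub>0 'k) graded_alg"
  interpret K: graded_algebra ?K by (rule koszul_family_iso(1))
  have sub: "subring S ?K" and smult: "\<And>c x. x \<in> S \<Longrightarrow> c \<odot>\<^bsub>?K\<^esub> x \<in> S"
    using S by (auto simp: subalgebra_def)
  note subE = subringE[OF sub]
  show "S \<subseteq> carrier ?K" by (rule subE(1))
  have hom: "koszul_family \<in> graded_hom ?A ?K" using koszul_family_iso(2)[where 'k = 'k] by (simp add: graded_iso_def)
  have mult: "koszul_family (shuffle_mult u v) = koszul_family u \<otimes>\<^bsub>?K\<^esub> koszul_family v" for u v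
    using hom by (auto simp: graded_hom_def ring_hom_def)
  have add: "koszul_family (u + v) = koszul_family u \<oplus>\<^bsub>?K\<^esub> koszul_family v" for u v
    using hom by (auto simp: graded_hom_def ring_hom_def)
  have scale: "koszul_family (scale_fm c u) = c \<odot>\<^bsub>?K\<^esub> koszul_family u" for c u
    using hom by (auto simp: graded_hom_def)
  have gen: "koszul_gen n \<in> S" for n
  proof (cases "even n")
    case False
    then obtain p where p: "n = Suc (2 * p)" by (metis oddE Suc_eq_plus1)
    have "koszul_gen n = koszul_gen 1 \<otimes>\<^bsub>?K\<^esub> (koszul_gen (2 * p) :: _ \<Rightarrow> _ \<Rightarrow> 'k)"
      unfolding koszul_gen_eq_family mult[symmetric] structure_mult_single
      by (simp add: p signed_shuffles_eq)
    then show ?thesis using 1 even subE(6) by metis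
  qed (use even in auto)
  have "koszul_family (\<Sum>n\<in>N. single n (c n)) \<in> S" if "finite N" for N c
    using that
  proof (induction N rule: finite_induct)
    case empty
    have "koszul_family 0 = \<zero>\<^bsub>?K\<^esub>" by (simp add: koszul_family_def koszul_algebra_simps fun_eq_iff)
    then show ?case using subE(2) by simp
  next
    case (insert n N)
    have "koszul_family (single n (c n)) \<in> S"
      using smult[OF gen[of n], of "c n"] unfolding koszul_gen_eq_family scale[symmetric] scale_fm_single by simp
    then show ?case using insert subE(7) by (simp add: add)
  qed
  then have "koszul_family u \<in> S" for u
    using poly_mapping_sum_single[of "keys u" u] by (metis finite_keys order_refl)
  moreover have "carrier ?K = koszul_family ` UNIV"
    using koszul_family_iso(2)[where 'k = 'k] by (simp add: graded_iso_def bij_betw_def)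
  ultimately show "carrier ?K \<subseteq> S" by auto
qed

theorem proposition3p7:
  fixes f :: "nat \<Rightarrow> nat \<Rightarrow> (nat list \<Rightarrow>\<^sub>0 'k::comm_ring_1) \<Rightarrow> 'k"
    and K :: "('k, nat \<Rightarrow> (nat list \<Rightarrow>\<^sub>0 'k) \<Rightarrow> 'k) graded_alg"
    and H :: "('k, (nat \<Rightarrow> nat set list \<Rightarrow> (nat list \<Rightarrow>\<^sub>0 'k) \<Rightarrow> 'k) set) graded_alg"
    and \<Gamma> :: "('k, nat \<Rightarrow>\<^sub>0 'k) graded_alg"
    and \<Lambda> :: "('k, 'k \<times> 'k) graded_alg"
  assumes f: "f = koszul_gen"
    and K: "K = koszul_algebra linear_orders"
    and H: "H = cohomology_algebra linear_orders"
    and \<Gamma>: "\<Gamma> = divided_power_algebra 2"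
    and \<Lambda>: "\<Lambda> = exterior_algebra 1"
  shows
    "(\<forall>j. f j \<in> hpart K j \<and> hpart K j = {c \<odot>\<^bsub>K\<^esub> f j | c. True}) \<and>
     generated_subalgebra K ({f 1} \<union> {f (2 * p) | p. True}) = carrier K \<and>
     ((\<forall>n::nat. n > 0 \<longrightarrow> (of_nat n :: 'k) dvd 1) \<longrightarrow>
        generated_subalgebra K {f 1, f 2} = carrier K) \<and>
     (\<forall>p q. f (2 * p) \<otimes>\<^bsub>K\<^esub> f (2 * q) = of_nat ((p + q) choose p) \<odot>\<^bsub>K\<^esub> f (2 * (p + q))) \<and>
     (\<forall>p. f 1 \<otimes>\<^bsub>K\<^esub> f (2 * p) = f (2 * p + 1)) \<and>
     (\<forall>p. f 1 \<otimes>\<^bsub>K\<^esub> f (2 * p + 1) = \<zero>\<^bsub>K\<^esub>) \<and>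
     (\<exists>i j \<Omega>.
        graded_tensor_product \<Gamma> \<Lambda> K i j \<and>
        (\<forall>p. i (Poly_Mapping.single p 1) = f (2 * p)) \<and> j (0, 1) = f 1 \<and>
        \<Omega> \<in> graded_iso K H \<and>
        graded_tensor_product \<Gamma> \<Lambda> H (\<Omega> \<circ> i) (\<Omega> \<circ> j))"
proof -
  let ?A = "shuffle_algebra :: ('k, nat \<Rightarrow>\<^sub>0 'k) graded_alg"
  note iso = koszul_family_iso[where 'k = 'k, folded K] and isoH = cohomology_class_iso[where 'k = 'k, folded H]
  interpret K: graded_algebra K by (rule iso(1))
  have f_family: "f n = koszul_family (single n 1)" for n
    unfolding f by (rule koszul_gen_eq_family)
  have hom: "koszul_family \<in> graded_hom ?A K" using iso(2) by (simp add: graded_iso_def)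
  have mult: "koszul_family (shuffle_mult u v) = koszul_family u \<otimes>\<^bsub>K\<^esub> koszul_family v" for u v
    using hom by (auto simp: graded_hom_def ring_hom_def)
  have scale: "koszul_family (scale_fm c u) = c \<odot>\<^bsub>K\<^esub> koszul_family u" for c u
    using hom by (auto simp: graded_hom_def)
  have zero: "koszul_family 0 = \<zero>\<^bsub>K\<^esub>"
    by (simp add: K koszul_family_def koszul_algebra_simps fun_eq_iff)
  have product: "f p \<otimes>\<^bsub>K\<^esub> f q = of_int (signed_shuffles p q) \<odot>\<^bsub>K\<^esub> f (p + q)" for p q
    unfolding f_family mult[symmetric] scale[symmetric] structure_mult_single scale_fm_single by simp
  have hpart: "hpart K j = {c \<odot>\<^bsub>K\<^esub> f j | c. True}" for j
  proof -
    have "{u :: nat \<Rightarrow>\<^sub>0 'k. keys u \<subseteq> {j}} = range (\<lambda>c. scale_fm c (single j 1))"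
    proof (intro equalityI subsetI)
      fix u :: "nat \<Rightarrow>\<^sub>0 'k" assume "u \<in> {u. keys u \<subseteq> {j}}"
      then have "u = scale_fm (lookup u j) (single j 1)"
        using poly_mapping_sum_single[of "{j}" u] by (simp add: scale_fm_single)
      then show "u \<in> range (\<lambda>c. scale_fm c (single j 1))" by blast
    qed (auto simp: scale_fm_single split: if_splits)
    moreover have "hpart K j = koszul_family ` {u. keys u \<subseteq> {j}}"
      using iso(2) by (auto simp: graded_iso_def)
    ultimately show ?thesis unfolding f_family scale[symmetric] by auto
  qed
  have f_carrier: "f j \<in> carrier K" for j
    using hom ring_hom_closed[of koszul_family ?A K] unfolding f_family by (simp add: graded_hom_def)
  have f_in: "f j \<in> hpart K j" for j
    unfolding hpart using K.smult_unit[OF f_carrier, of j, symmetric] by blast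
  have whole: "subalgebra (carrier K) K"
    using K.carrier_is_subring K.smult_closed by (simp add: subalgebra_def)
  have gen1: "generated_subalgebra K ({f 1} \<union> {f (2 * p) | p. True}) = carrier K"
  proof -
    have "S = carrier K" if "subalgebra S K" "{f 1} \<union> {f (2 * p) | p. True} \<subseteq> S" for S
      using koszul_subalgebra_eq_carrier[of S] that unfolding K f by blast
    moreover have "{f 1} \<union> {f (2 * p) | p. True} \<subseteq> carrier K" using f_carrier by blast
    ultimately have "{S. subalgebra S K \<and> {f 1} \<union> {f (2 * p) | p. True} \<subseteq> S} = {carrier K}"
      using whole by blast
    then show ?thesis unfolding generated_subalgebra_def by simp
  qed
  have gen2: "generated_subalgebra K {f 1, f 2} = carrier K"
    if units: "\<forall>n::nat. n > 0 \<longrightarrow> (of_nat n :: 'k) dvd 1"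
  proof -
    have "S = carrier K" if S: "subalgebra S K" "{f 1, f 2} \<subseteq> S" for S
    proof -
      have sub: "subring S K" and smult: "\<And>c x. x \<in> S \<Longrightarrow> c \<odot>\<^bsub>K\<^esub> x \<in> S"
        using S by (auto simp: subalgebra_def)
      have "f (2 * p) \<in> S" for p
      proof (induction p)
        case 0
        have "f 0 = \<one>\<^bsub>K\<^esub>" using hom unfolding f_family by (simp add: graded_hom_def ring_hom_def)
        then show ?case using subringE(3)[OF sub] by simp
      next
        case (Suc p)
        (* the product of f 2 and f (2 * p) is p + 1 times f (2 * Suc p) *)
        obtain c :: 'k where c: "1 = of_nat (Suc p) * c"
          using units[rule_format, of "Suc p"] unfolding dvd_def by blast
        have "f 2 \<otimes>\<^bsub>K\<^esub> f (2 * p) = of_nat (Suc p) \<odot>\<^bsub>K\<^esub> f (2 * Suc p)"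
          unfolding product by (simp add: signed_shuffles_eq)
        moreover have "f 2 \<otimes>\<^bsub>K\<^esub> f (2 * p) \<in> S" using subringE(6)[OF sub] Suc S(2) by blast
        ultimately have "c \<odot>\<^bsub>K\<^esub> (of_nat (Suc p) \<odot>\<^bsub>K\<^esub> f (2 * Suc p)) \<in> S" using smult by simp
        also have "c \<odot>\<^bsub>K\<^esub> (of_nat (Suc p) \<odot>\<^bsub>K\<^esub> f (2 * Suc p)) = 1 \<odot>\<^bsub>K\<^esub> f (2 * Suc p)"
          unfolding K.smult_smult[OF f_carrier, symmetric] c mult.commute[of c] ..
        finally show ?case unfolding K.smult_unit[OF f_carrier] .
      qed
      then show ?thesis using koszul_subalgebra_eq_carrier[of S] S unfolding K f by simp
    qed
    moreover have "{f 1, f 2} \<subseteq> carrier K" using f_carrier by blast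
    ultimately have "{S. subalgebra S K \<and> {f 1, f 2} \<subseteq> S} = {carrier K}"
      using whole by blast
    then show ?thesis unfolding generated_subalgebra_def by simp
  qed
  define \<Omega> where "\<Omega> = cohomology_class \<circ> inv_into (carrier ?A) koszul_family"
  note \<Omega> = graded_iso_quotient[OF graded_algebra_shuffle_algebra iso(2) isoH(2), folded \<Omega>_def]
  have comp: "\<Omega> \<circ> (koszul_family \<circ> g) = cohomology_class \<circ> g" for g :: "'b \<Rightarrow> (nat \<Rightarrow>\<^sub>0 'k)"
    using \<Omega>(2) by (simp add: fun_eq_iff)
  note tensor = graded_tensor_product_shuffle_algebra[where 'k = 'k, folded \<Gamma> \<Lambda>]
  have "graded_tensor_product \<Gamma> \<Lambda> K (koszul_family \<circ> even_inclusion) (koszul_family \<circ> exterior_inclusion)"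
    by (rule graded_tensor_product_transport[OF tensor iso])
  moreover have "graded_tensor_product \<Gamma> \<Lambda> H (\<Omega> \<circ> (koszul_family \<circ> even_inclusion)) (\<Omega> \<circ> (koszul_family \<circ> exterior_inclusion))"
    unfolding comp by (rule graded_tensor_product_transport[OF tensor isoH])
  moreover have "(koszul_family \<circ> even_inclusion) (single p 1) = f (2 * p)" for p
    by (simp add: f_family even_inclusion_single)
  moreover have "(koszul_family \<circ> exterior_inclusion) (0, 1) = f 1"
    by (simp add: f_family exterior_inclusion_def)
  ultimately have tensor_products: "\<exists>i j \<Omega>. graded_tensor_product \<Gamma> \<Lambda> K i j \<and>
      (\<forall>p. i (single p 1) = f (2 * p)) \<and> j (0, 1) = f 1 \<and>
      \<Omega> \<in> graded_iso K H \<and> graded_tensor_product \<Gamma> \<Lambda> H (\<Omega> \<circ> i) (\<Omega> \<circ> j)"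
    using \<Omega>(1) by blast
  have "f (2 * p) \<otimes>\<^bsub>K\<^esub> f (2 * q) = of_nat ((p + q) choose p) \<odot>\<^bsub>K\<^esub> f (2 * (p + q))" for p q
    unfolding product signed_shuffles_even by (simp add: distrib_left)
  moreover have "f 1 \<otimes>\<^bsub>K\<^esub> f (2 * p) = f (2 * p + 1)" for p
    unfolding product by (simp add: signed_shuffles_eq K.smult_unit f_carrier)
  moreover have "f 1 \<otimes>\<^bsub>K\<^esub> f (2 * p + 1) = \<zero>\<^bsub>K\<^esub>" for p
    unfolding product unfolding zero[symmetric] f_family scale[symmetric] by (simp add: signed_shuffles_eq)
  ultimately show ?thesis using hpart f_in gen1 gen2 tensor_products by blast
qed

end
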